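(* Let $g\ge 1$. The Hilbert polynomial of $\Sigma_{2g-1}\subseteq\mathbb{P}(H^0(\mathbb{P}^{2g-1},\mathcal{L}_{2g-1})^* )$ is given by $$h_{\Sigma_{2g-1}}(t)=\binom{gt+2g-1}{2g-1}+\sum_{r=0}^{g-2}(-1)^{r+1}\binom{2g+1}{r+1}\binom{t(g-r-1)+2g-1-r-1}{2g-1}.$$ In particular $$h^0(\mathbb{P}^{2g-1},\mathcal{L}_{2g-1})=\binom{3g-1}{2g-1}+\sum_{r=0}^{g-2}(-1)^{r+1}\binom{2g+1}{r+1}\binom{3g-2r-3}{2g-1}$$ and $$\deg(\Sigma_{2g-1})=g^{2g-1}+\sum_{r=0}^{g-2}(-1)^{r+1}\binom{2g+1}{r+1}(g-r-1)^{2g-1}.$$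
   Context: The ground field is $\mathbb{C}$. $\Sigma_{2g-1}=(\mathbb{P}^1)^{2g+2}/\!/PGL(2)$ is the GIT quotient for the diagonal action with respect to the symmetric polarization $\mathcal{O}(1,\dots,1)$. Let $p_1,\dots,p_{2g+1}\in\mathbb{P}^{2g-1}$ be general points and let $\mathcal{L}_{2g-1}$ be the linear system of degree $g$ hypersurfaces in $\mathbb{P}^{2g-1}$ with multiplicity at least $g-1$ at each $p_i$; $H^0(\mathbb{P}^{2g-1},\mathcal{L}_{2g-1})$ is the corresponding vector space of degree $g$ forms. By a theorem of Kumar the induced rational map $\mathbb{P}^{2g-1}\dashrightarrow\mathbb{P}(H^0(\mathbb{P}^{2g-1},\mathcal{L}_{2g-1})^* )$ is birational onto its image, and the closure of the image is $\Sigma_{2g-1}$, which gives the embedding considered. Binomial coefficients $\binom{a(t)}{k}$ are read as polynomials in $t$; empty sums are $0$. *)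

theory Defs
  imports
    Complex_Main
    "HOL-Library.Poly_Mapping"
    "HOL-Computational_Algebra.Polynomial"
begin

section \<open>Polynomials and forms in finitely many variables\<close>

type_synonym monomial = "nat \<Rightarrow>\<^sub>0 nat"
type_synonym cpoly = "monomial \<Rightarrow>\<^sub>0 complex"

definition cscale :: "complex \<Rightarrow> cpoly \<Rightarrow> cpoly" where
  "cscale c f = Poly_Mapping.single 0 c * f"

global_interpretation cpoly: vector_space cscale
proof
  fix a b :: complex and x y :: cpoly
  show "cscale a (x + y) = cscale a x + cscale a y"
    by (simp add: cscale_def distrib_left)
  show "cscale (a + b) x = cscale a x + cscale b x"
    by (simp add: cscale_def single_add distrib_right)
  show "cscale a (cscale b x) = cscale (a * b) x"
    by (simp add: cscale_def mult.assoc [symmetric] mult_single)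
  show "cscale 1 x = x"
    by (simp add: cscale_def)
qed

definition eval :: "cpoly \<Rightarrow> (nat \<Rightarrow> complex) \<Rightarrow> complex" where
  "eval f x = (\<Sum>m\<in>Poly_Mapping.keys f.
     Poly_Mapping.lookup f m * (\<Prod>i\<in>Poly_Mapping.keys m. x i ^ Poly_Mapping.lookup m i))"

definition partial_deriv :: "nat \<Rightarrow> cpoly \<Rightarrow> cpoly" where
  "partial_deriv i f = (\<Sum>m\<in>Poly_Mapping.keys f.
     Poly_Mapping.single (m - Poly_Mapping.single i 1)
       (of_nat (Poly_Mapping.lookup m i) * Poly_Mapping.lookup f m))"

text \<open>
  \<open>forms k d\<close> is the space \<open>H\<^sup>0(\<P>\<^sup>k\<^sup>-\<^sup>1, \<O>(d))\<close>, and \<open>multiforms m k D\<close> is the space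
  \<open>H\<^sup>0((\<P>\<^sup>k\<^sup>-\<^sup>1)\<^sup>m, \<O>(D 0, \<dots>, D (m - 1)))\<close>; in the latter the variable with index \<open>i * k + j\<close>
  is the \<open>j\<close>-th homogeneous coordinate of the \<open>i\<close>-th factor. The zero polynomial belongs to
  all of these spaces.
\<close>

definition forms :: "nat \<Rightarrow> nat \<Rightarrow> cpoly set" where
  "forms k d = {f. \<forall>m\<in>Poly_Mapping.keys f.
     Poly_Mapping.keys m \<subseteq> {..<k} \<and> (\<Sum>j<k. Poly_Mapping.lookup m j) = d}"

definition multiforms :: "nat \<Rightarrow> nat \<Rightarrow> (nat \<Rightarrow> nat) \<Rightarrow> cpoly set" where
  "multiforms m k D = {f. \<forall>\<mu>\<in>Poly_Mapping.keys f.
     Poly_Mapping.keys \<mu> \<subseteq> {..<m * k} \<and>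
     (\<forall>i<m. (\<Sum>j<k. Poly_Mapping.lookup \<mu> (i * k + j)) = D i)}"


section \<open>Projective space, closed subsets, Hilbert polynomial\<close>

text \<open>
  Points of \<open>\<P>\<^sup>k\<^sup>-\<^sup>1\<close> are given by their homogeneous coordinate vectors; subsets of \<open>\<P>\<^sup>k\<^sup>-\<^sup>1\<close> are
  given by sets of such vectors.
\<close>

definition hcoords :: "nat \<Rightarrow> (nat \<Rightarrow> complex) set" where
  "hcoords k = {x. (\<forall>j\<ge>k. x j = 0) \<and> (\<exists>j<k. x j \<noteq> 0)}"

definition vanishing_forms :: "nat \<Rightarrow> (nat \<Rightarrow> complex) set \<Rightarrow> nat \<Rightarrow> cpoly set" where
  "vanishing_forms k X d = {F \<in> forms k d. \<forall>x\<in>X. eval F x = 0}"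

definition zariski_closure :: "nat \<Rightarrow> (nat \<Rightarrow> complex) set \<Rightarrow> (nat \<Rightarrow> complex) set" where
  "zariski_closure k X = {y \<in> hcoords k. \<forall>d. \<forall>F\<in>vanishing_forms k X d. eval F y = 0}"

text \<open>The dimension of the degree \<open>t\<close> part of the homogeneous coordinate ring.\<close>

definition hilbert_function :: "nat \<Rightarrow> (nat \<Rightarrow> complex) set \<Rightarrow> nat \<Rightarrow> nat" where
  "hilbert_function k X t = cpoly.dim (forms k t) - cpoly.dim (vanishing_forms k X t)"

definition is_hilbert_polynomial :: "nat \<Rightarrow> (nat \<Rightarrow> complex) set \<Rightarrow> rat poly \<Rightarrow> bool" where
  "is_hilbert_polynomial k X h \<longleftrightarrow>
     (\<forall>\<^sub>F t in sequentially. poly h (of_nat t) = of_nat (hilbert_function k X t))"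

lemma is_hilbert_polynomial_unique:
  assumes "is_hilbert_polynomial k X h" "is_hilbert_polynomial k X h'"
  shows "h = h'"
proof (rule ccontr)
  assume "h \<noteq> h'"
  then have fin: "finite {x. poly (h - h') x = 0}"
    by (intro poly_roots_finite) simp
  have "\<forall>\<^sub>F t in sequentially. poly (h - h') (of_nat t) = 0"
    using assms unfolding is_hilbert_polynomial_def
    by eventually_elim simp
  then obtain T where T: "\<And>t. t \<ge> T \<Longrightarrow> poly (h - h') (of_nat t) = 0"
    by (auto simp: eventually_sequentially)
  then have "of_nat ` {T..} \<subseteq> {x. poly (h - h') x = 0}"
    by auto
  then have "finite ((of_nat :: nat \<Rightarrow> rat) ` {T..})"
    using fin finite_subset by blast
  then have "finite {T..}"
    by (rule finite_imageD) (simp add: inj_on_def)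
  then show False
    using infinite_Ici by blast
qed

definition hilbert_polynomial :: "nat \<Rightarrow> (nat \<Rightarrow> complex) set \<Rightarrow> rat poly" where
  "hilbert_polynomial k X = (THE h. is_hilbert_polynomial k X h)"

lemma hilbert_polynomial_eqI:
  "is_hilbert_polynomial k X h \<Longrightarrow> hilbert_polynomial k X = h"
  unfolding hilbert_polynomial_def
  using is_hilbert_polynomial_unique by blast

text \<open>
  \<open>r!\<close> times the leading coefficient of the Hilbert polynomial, where \<open>r\<close>, the dimension of
  the variety, is the degree of the Hilbert polynomial.
\<close>

definition projective_degree :: "nat \<Rightarrow> (nat \<Rightarrow> complex) set \<Rightarrow> rat" where
  "projective_degree k X =
     fact (Polynomial.degree (hilbert_polynomial k X)) * lead_coeff (hilbert_polynomial k X)"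

definition binomial_poly :: "rat poly \<Rightarrow> nat \<Rightarrow> rat poly" where
  "binomial_poly a k = smult (1 / fact k) (\<Prod>i<k. a - [:of_nat i:])"

text \<open>
  A property of \<open>m\<close>-tuples of points holds for general points if it holds on a nonempty open
  subset of \<open>(\<P>\<^sup>k\<^sup>-\<^sup>1)\<^sup>m\<close>; the nonvanishing loci of single nonzero multihomogeneous polynomials
  are a basis of the nonempty open subsets.
\<close>

definition for_general_points ::
  "nat \<Rightarrow> nat \<Rightarrow> ((nat \<Rightarrow> nat \<Rightarrow> complex) \<Rightarrow> bool) \<Rightarrow> bool" where
  "for_general_points m k Q \<longleftrightarrow>
     (\<exists>D. \<exists>\<Phi>\<in>multiforms m k D. \<Phi> \<noteq> 0 \<and>
        (\<forall>p. (\<forall>i<m. p i \<in> hcoords k) \<longrightarrow> eval \<Phi> (\<lambda>v. p (v div k) (v mod k)) \<noteq> 0 \<longrightarrow> Q p))"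


section \<open>Isomorphism of projective varieties\<close>

text \<open>
  A classical projective variety is presented by a set of representatives of its points (the
  affine cone without its vertex) together with, for every degree \<open>d\<close>, the functions on this
  set that the homogeneous elements of degree \<open>d\<close> of its graded coordinate ring define. Two
  representatives give the same point if they differ by the action of the multiplicative group.
\<close>

record 'p proj_model =
  points :: "'p set"
  hfuns :: "nat \<Rightarrow> ('p \<Rightarrow> complex) set"

definition same_point :: "'p proj_model \<Rightarrow> 'p \<Rightarrow> 'p \<Rightarrow> bool" where
  "same_point M x y \<longleftrightarrow> (\<exists>c. c \<noteq> 0 \<and> (\<forall>d. \<forall>a\<in>hfuns M d. a y = c ^ d * a x))"

definition zariski_open :: "'p proj_model \<Rightarrow> 'p set \<Rightarrow> bool" where
  "zariski_open M U \<longleftrightarrow>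
     (\<exists>T \<subseteq> (\<Union>d. hfuns M d). U = {x \<in> points M. \<exists>a\<in>T. a x \<noteq> 0})"

definition regular_on :: "'p proj_model \<Rightarrow> 'p set \<Rightarrow> ('p \<Rightarrow> complex) \<Rightarrow> bool" where
  "regular_on M U u \<longleftrightarrow>
     (\<forall>x\<in>U. \<exists>W d. zariski_open M W \<and> x \<in> W \<and>
        (\<exists>a\<in>hfuns M d. \<exists>b\<in>hfuns M d. \<forall>y\<in>W \<inter> U. b y \<noteq> 0 \<and> u y = a y / b y))"

definition morphism :: "'p proj_model \<Rightarrow> 'q proj_model \<Rightarrow> ('p \<Rightarrow> 'q) \<Rightarrow> bool" where
  "morphism M N \<phi> \<longleftrightarrow>
     \<phi> ` points M \<subseteq> points N \<and>
     (\<forall>x\<in>points M. \<forall>y\<in>points M. same_point M x y \<longrightarrow> same_point N (\<phi> x) (\<phi> y)) \<and>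
     (\<forall>U. zariski_open N U \<longrightarrow> zariski_open M (points M \<inter> \<phi> -` U)) \<and>
     (\<forall>U u. zariski_open N U \<longrightarrow> regular_on N U u \<longrightarrow>
        regular_on M (points M \<inter> \<phi> -` U) (u \<circ> \<phi>))"

definition isomorphic :: "'p proj_model \<Rightarrow> 'q proj_model \<Rightarrow> bool" where
  "isomorphic M N \<longleftrightarrow>
     (\<exists>\<phi> \<psi>. morphism M N \<phi> \<and> morphism N M \<psi> \<and>
        (\<forall>x\<in>points M. same_point M (\<psi> (\<phi> x)) x) \<and>
        (\<forall>y\<in>points N. same_point N (\<phi> (\<psi> y)) y))"

definition closed_subvariety :: "nat \<Rightarrow> (nat \<Rightarrow> complex) set \<Rightarrow> (nat \<Rightarrow> complex) proj_model" where
  "closed_subvariety k X = \<lparr>points = X, hfuns = (\<lambda>d. eval ` forms k d)\<rparr>"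

text \<open>
  \<open>Proj\<close> of a graded subalgebra \<open>\<Oplus>\<^sub>d R d\<close> of the polynomial ring, as a classical variety: the
  nonzero points of \<open>Spec\<close> are the \<open>\<complex>\<close>-algebra homomorphisms to \<open>\<complex>\<close> that do not kill the
  irrelevant ideal. Such a homomorphism is determined by its values on homogeneous elements,
  and only these values are constrained.
\<close>

definition graded_Proj :: "(nat \<Rightarrow> cpoly set) \<Rightarrow> (cpoly \<Rightarrow> complex) proj_model" where
  "graded_Proj R =
     \<lparr>points = {l. l 1 = 1 \<and>
        (\<forall>d. \<forall>a\<in>R d. \<forall>b\<in>R d. l (a + b) = l a + l b) \<and>
        (\<forall>d c. \<forall>a\<in>R d. l (cscale c a) = c * l a) \<and>
        (\<forall>d e. \<forall>a\<in>R d. \<forall>b\<in>R e. l (a * b) = l a * l b) \<and>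
        (\<exists>d>0. \<exists>a\<in>R d. l a \<noteq> 0)},
      hfuns = (\<lambda>d. (\<lambda>a l. l a) ` R d)\<rparr>"


section \<open>The GIT quotient and the linear system\<close>

text \<open>
  The diagonal action of a matrix on the homogeneous coordinates \<open>(x (2 * i), x (2 * i + 1))\<close>
  of tuples of points of \<open>\<P>\<^sup>1\<close>.
\<close>

definition diag_act ::
  "complex \<Rightarrow> complex \<Rightarrow> complex \<Rightarrow> complex \<Rightarrow> (nat \<Rightarrow> complex) \<Rightarrow> nat \<Rightarrow> complex" where
  "diag_act a b c d x v =
     (if even v then a * x v + b * x (v + 1) else c * x (v - 1) + d * x v)"

text \<open>
  The invariant sections of \<open>\<O>(t, \<dots>, t)\<close> on \<open>(\<P>\<^sup>1)\<^sup>n\<close>. As usual, invariance under \<open>PGL(2)\<close> is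
  expressed through its cover \<open>SL(2)\<close>, which acts canonically on sections. For even \<open>n\<close> the
  centre of \<open>SL(2)\<close> acts trivially on sections of \<open>\<O>(1, \<dots>, 1)\<close>, so that this is the
  \<open>PGL(2)\<close>-linearization of \<open>\<O>(1, \<dots>, 1)\<close>.
\<close>

definition invariant_sections :: "nat \<Rightarrow> nat \<Rightarrow> cpoly set" where
  "invariant_sections n t = {F \<in> multiforms n 2 (\<lambda>_. t).
     \<forall>a b c d x. a * d - b * c = 1 \<longrightarrow> eval F (diag_act a b c d x) = eval F x}"

text \<open>The quotient \<open>(\<P>\<^sup>1)\<^sup>n // PGL(2)\<close> for the polarization \<open>\<O>(1, \<dots>, 1)\<close>.\<close>

definition GIT_quotient :: "nat \<Rightarrow> (cpoly \<Rightarrow> complex) proj_model" where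
  "GIT_quotient n = graded_Proj (invariant_sections n)"

text \<open>
  The multiplicity of a homogeneous polynomial at a point of \<open>\<P>\<^sup>k\<^sup>-\<^sup>1\<close> agrees with the one at any
  representing vector in the affine cone.
\<close>

definition has_mult_ge :: "nat \<Rightarrow> cpoly \<Rightarrow> (nat \<Rightarrow> complex) \<Rightarrow> nat \<Rightarrow> bool" where
  "has_mult_ge k f p m \<longleftrightarrow>
     (\<forall>is. set is \<subseteq> {..<k} \<longrightarrow> length is < m \<longrightarrow> eval (fold partial_deriv is f) p = 0)"

definition lin_system :: "nat \<Rightarrow> (nat \<Rightarrow> nat \<Rightarrow> complex) \<Rightarrow> cpoly set" where
  "lin_system g p = {f \<in> forms (2 * g) g. \<forall>i<2 * g + 1. has_mult_ge (2 * g) f (p i) (g - 1)}"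

definition is_basis :: "nat \<Rightarrow> (nat \<Rightarrow> cpoly) \<Rightarrow> cpoly set \<Rightarrow> bool" where
  "is_basis n s V \<longleftrightarrow>
     inj_on s {..<n} \<and> cpoly.independent (s ` {..<n}) \<and> cpoly.span (s ` {..<n}) = V"

text \<open>
  The closure of the image of the rational map given by forms \<open>s 0, \<dots>, s (n - 1)\<close> of equal
  degree on \<open>\<P>\<^sup>k\<^sup>-\<^sup>1\<close>. If the forms are a basis of \<open>V\<close>, then \<open>\<P>\<^sup>n\<^sup>-\<^sup>1\<close> is \<open>\<P>(V\<^sup>*)\<close> in the dual
  coordinates.
\<close>

definition image_closure :: "nat \<Rightarrow> nat \<Rightarrow> (nat \<Rightarrow> cpoly) \<Rightarrow> (nat \<Rightarrow> complex) set" where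
  "image_closure k n s = zariski_closure n
     (hcoords n \<inter> (\<lambda>x j. if j < n then eval (s j) x else 0) ` hcoords k)"

end

theory Submission
  imports
    Defs
    "HOL-Analysis.Derivative"
    "Jordan_Normal_Form.Determinant"
    "HOL-Computational_Algebra.Formal_Power_Series"
begin

text \<open>
  Put \<open>n = 2 * g + 2\<close> and \<open>m = 2 * g + 1\<close>. Moving the last of \<open>n\<close> points of \<open>\<P>\<^sup>1\<close> to infinity identifies the
  invariant sections of \<open>\<O>(t, \<dots>, t)\<close> with the translation invariant polynomials of degree \<open>g * t\<close> in
  \<open>m\<close> variables that have degree at most \<open>t\<close> in each variable.

  These polynomials are spanned by products of differences \<open>u\<^sub>i - u\<^sub>j\<close>: restrict to \<open>u\<^sub>i = u\<^sub>j\<close>, lift the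
  restriction by induction on the number of variables, and divide the difference by \<open>u\<^sub>i - u\<^sub>j\<close>. So the
  invariants are spanned by the bracket monomials of \<open>t\<close>-regular multigraphs on \<open>n\<close> vertices. The
  Pluecker relations make these graphs bipartite, and Hall's theorem splits off a perfect matching:
  the ring of invariants is generated in degree one (Kempe).

  The same polynomials are the kernel of \<open>\<Sum>\<^sub>i \<partial>/\<partial>u\<^sub>i\<close> on a space spanned by monomials. By \<open>sl\<^sub>2\<close>-theory this
  operator is surjective in the relevant degrees, so the dimension is a difference of two numbers of
  bounded compositions, which gives the stated alternating sum. Its leading coefficient is a
  difference of two Eulerian numbers and is positive.

  For \<open>t = 1\<close>, setting the last variable to \<open>0\<close> turns the translation invariant polynomials into the
  forms of degree \<open>g\<close> in \<open>2 * g\<close> variables with multiplicity at least \<open>g - 1\<close> at the coordinate points and at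
  \<open>(1, \<dots>, 1)\<close>, to which any \<open>2 * g + 1\<close> general points can be moved. Hence the linear system is the degree
  one part of the ring of invariants, and its image is \<open>Proj\<close> of that ring.
\<close>

text \<open>The isomorphism between the quotient and the image is obtained from graded rings. A
  basis of the linear system is lifted to invariants of degree one, which gives a map from forms in
  \<open>n\<close> variables to invariants. Generation in degree one makes it onto in every degree,
  and its kernel is the ideal of the image. So both varieties have the same graded coordinate ring,
  and the Hilbert function is the dimension of the space of invariants. The count of this dimension
  is valid from \<open>t = 1\<close> on, so the same polynomial also counts the linear system.

  A form of degree \<open>g\<close> with multiplicity at least \<open>g - 1\<close> at a point is
  affine linear along lines in the direction of that point. This turns the \<open>2 g + 1\<close>
  multiplicity conditions into degree at most one in each of \<open>2 g + 1\<close> variables.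

  Points are general enough when any \<open>2 g\<close> of them are linearly independent; they then
  form a projective frame, in which the last point is the sum of suitably scaled basis vectors.

  Positivity of the leading coefficient matters because the degree of the variety is read off at the
  actual degree of the Hilbert polynomial.\<close>

abbreviation "lookup \<equiv> Poly_Mapping.lookup"
abbreviation "keys \<equiv> Poly_Mapping.keys"
abbreviation "single \<equiv> Poly_Mapping.single"

subsection \<open>Substitution homomorphisms\<close>

definition Var :: "nat \<Rightarrow> cpoly" where "Var i = single (single i 1) 1"
definition Cst :: "complex \<Rightarrow> cpoly" where "Cst c = single 0 c"
definition mon :: "monomial \<Rightarrow> cpoly" where "mon \<mu> = single \<mu> 1"

definition mono_val :: "(nat \<Rightarrow> 'b::comm_ring_1) \<Rightarrow> monomial \<Rightarrow> 'b" where
  "mono_val \<sigma> \<mu> = (\<Prod>i\<in>keys \<mu>. \<sigma> i ^ lookup \<mu> i)"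

text \<open>One homomorphism for two purposes: with the identity on coefficients it is
  \<open>eval\<close>, with \<open>Cst\<close> it is \<open>subst\<close>.\<close>

definition ev :: "(complex \<Rightarrow> 'b::comm_ring_1) \<Rightarrow> (nat \<Rightarrow> 'b) \<Rightarrow> cpoly \<Rightarrow> 'b" where
  "ev h \<sigma> f = (\<Sum>\<mu>\<in>keys f. h (lookup f \<mu>) * mono_val \<sigma> \<mu>)"

definition subst :: "(nat \<Rightarrow> cpoly) \<Rightarrow> cpoly \<Rightarrow> cpoly" where "subst = ev Cst"

lemma cscale_Cst: "cscale c f = Cst c * f"
  by (simp add: cscale_def Cst_def)

lemma Cst_add: "Cst (a + b) = Cst a + Cst b"
  and Cst_mult: "Cst (a * b) = Cst a * Cst b"
  and Cst_0 [simp]: "Cst 0 = 0" and Cst_1 [simp]: "Cst 1 = 1"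
  by (simp_all add: Cst_def single_add mult_single)

lemma Cst_of_nat [simp]: "Cst (of_nat n) = of_nat n"
  by (simp add: Cst_def)

lemma Cst_power: "Cst (a ^ n) = Cst a ^ n"
  by (induction n) (simp_all add: Cst_mult)

lemma lookup_Cst_mult [simp]: "lookup (Cst c * f) \<mu> = c * lookup f \<mu>"
  by (simp add: Cst_def mult_map_scale_conv_mult[symmetric] Poly_Mapping.map.rep_eq when_def)

lemma mono_val_superset:
  assumes "finite S" "keys \<mu> \<subseteq> S"
  shows "mono_val \<sigma> \<mu> = (\<Prod>i\<in>S. \<sigma> i ^ lookup \<mu> i)"
  unfolding mono_val_def
  by (rule prod.mono_neutral_left) (use assms in \<open>auto simp: in_keys_iff\<close>)

lemma mono_val_0 [simp]: "mono_val \<sigma> 0 = 1"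
  by (simp add: mono_val_def)

lemma mono_val_add: "mono_val \<sigma> (\<mu> + \<nu>) = mono_val \<sigma> \<mu> * mono_val \<sigma> \<nu>"
proof -
  let ?S = "keys \<mu> \<union> keys \<nu>"
  have "mono_val \<sigma> (\<mu> + \<nu>) = (\<Prod>i\<in>?S. \<sigma> i ^ lookup (\<mu> + \<nu>) i)"
    by (rule mono_val_superset) (auto simp: Poly_Mapping.keys_add)
  also have "\<dots> = (\<Prod>i\<in>?S. \<sigma> i ^ lookup \<mu> i) * (\<Prod>i\<in>?S. \<sigma> i ^ lookup \<nu> i)"
    by (simp add: lookup_add power_add prod.distrib)
  finally show ?thesis by (simp add: mono_val_superset[where S = ?S])
qed

lemma mono_val_single [simp]: "mono_val \<sigma> (single i k) = \<sigma> i ^ k"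
  by (cases "k = 0") (simp_all add: mono_val_def)

lemma mon_add: "mon (\<mu> + \<nu>) = mon \<mu> * mon \<nu>"
  by (simp add: mon_def mult_single)

lemma mon_0 [simp]: "mon 0 = 1"
  by (simp add: mon_def)

lemma single_mon: "single \<mu> c = Cst c * mon \<mu>"
  by (simp add: Cst_def mon_def mult_single)

lemma lookup_mon: "lookup (mon \<mu>) \<nu> = (if \<mu> = \<nu> then 1 else 0)"
  by (simp add: mon_def lookup_single when_def)

lemma keys_mon [simp]: "keys (mon \<mu>) = {\<mu>}"
  by (simp add: mon_def)

lemma mon_single: "mon (single i k) = Var i ^ k"
proof (induction k)
  case (Suc k)
  have "mon (single i (Suc k)) = mon (single i 1 + single i k)"
    by (simp add: single_add [symmetric])
  then show ?case by (simp only: mon_add Suc) (simp add: Var_def mon_def)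
qed simp

lemma monomial_decomp: "(\<mu> :: monomial) = (\<Sum>i\<in>keys \<mu>. single i (lookup \<mu> i))"
  by (rule poly_mapping_eqI)
     (auto simp: lookup_sum lookup_single when_def in_keys_iff)

lemma mon_sum: "mon (\<Sum>i\<in>I. F i) = (\<Prod>i\<in>I. mon (F i))"
  by (induction I rule: infinite_finite_induct) (simp_all add: mon_add)

lemma mono_val_Var: "mono_val Var \<mu> = mon \<mu>"
  by (subst (2) monomial_decomp) (simp add: mon_sum mon_single mono_val_def)

lemma cpoly_decomp: "(f :: cpoly) = (\<Sum>\<mu>\<in>keys f. Cst (lookup f \<mu>) * mon \<mu>)"
proof (rule poly_mapping_eqI)
  fix \<nu>
  have "lookup (\<Sum>\<mu>\<in>keys f. Cst (lookup f \<mu>) * mon \<mu>) \<nu> = (\<Sum>\<mu>\<in>keys f. if \<mu> = \<nu> then lookup f \<mu> else 0)"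
    unfolding lookup_sum by (intro sum.cong refl) (simp add: lookup_mon)
  then show "lookup f \<nu> = lookup (\<Sum>\<mu>\<in>keys f. Cst (lookup f \<mu>) * mon \<mu>) \<nu>"
    by (simp add: in_keys_iff)
qed

text \<open>Constants and variables generate the ring. The rule reduces identities between
  substitutions, evaluations and derivatives to these generators.\<close>

lemma cpoly_induct [case_names Cst Var add mult]:
  assumes "\<And>c. P (Cst c)" "\<And>i. P (Var i)"
    "\<And>f g. P f \<Longrightarrow> P g \<Longrightarrow> P (f + g)" "\<And>f g. P f \<Longrightarrow> P g \<Longrightarrow> P (f * g)"
  shows "P f"
proof -
  have 1: "P 1" using assms(1)[of 1] by simp
  have 0: "P 0" using assms(1)[of 0] by simp
  have pow: "P (Var i ^ k)" for i k
    by (induction k) (auto intro: 1 assms)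
  have pr: "P (\<Prod>i\<in>I. g i)" if "\<And>i. i \<in> I \<Longrightarrow> P (g i)" for I :: "nat set" and g
    using that by (induction I rule: infinite_finite_induct) (auto intro: 1 assms)
  have su: "P (\<Sum>i\<in>I. g i)" if "\<And>i. i \<in> I \<Longrightarrow> P (g i)" for I :: "monomial set" and g
    using that by (induction I rule: infinite_finite_induct) (auto intro: 0 assms)
  have "P (mon \<mu>)" for \<mu>
    unfolding mono_val_Var[symmetric] mono_val_def by (intro pr pow)
  then show ?thesis
    by (subst cpoly_decomp) (intro su assms)
qed

locale coeff_hom =
  fixes h :: "complex \<Rightarrow> 'b::comm_ring_1"
  assumes h_add: "h (a + b) = h a + h b" and h_mult: "h (a * b) = h a * h b" and h_1: "h 1 = 1"
begin

lemma h_0: "h 0 = 0" using h_add[of 0 0] by simp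

lemma ev_0 [simp]: "ev h \<sigma> 0 = 0" by (simp add: ev_def)

lemma ev_add: "ev h \<sigma> (f + g) = ev h \<sigma> f + ev h \<sigma> g"
  unfolding ev_def
  by (rule setsum_keys_plus_distrib[where f = "\<lambda>\<mu> c. h c * mono_val \<sigma> \<mu>"])
     (simp_all add: h_0 h_add distrib_right)

lemma ev_sum: "ev h \<sigma> (\<Sum>i\<in>I. F i) = (\<Sum>i\<in>I. ev h \<sigma> (F i))"
  by (induction I rule: infinite_finite_induct) (simp_all add: ev_add)

lemma ev_single: "ev h \<sigma> (single \<mu> c) = h c * mono_val \<sigma> \<mu>"
  by (cases "c = 0") (simp_all add: ev_def h_0)

lemma ev_Cst: "ev h \<sigma> (Cst c) = h c"
  by (simp add: Cst_def ev_single)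

lemma ev_Var: "ev h \<sigma> (Var i) = \<sigma> i"
  by (simp add: Var_def ev_single h_1)

lemma ev_mult: "ev h \<sigma> (f * g) = ev h \<sigma> f * ev h \<sigma> g"
proof -
  have "f * g = (\<Sum>\<mu>\<in>keys f. \<Sum>\<nu>\<in>keys g. single (\<mu> + \<nu>) (lookup f \<mu> * lookup g \<nu>))"
    by (subst (1) cpoly_decomp[of f], subst (1) cpoly_decomp[of g])
       (simp add: sum_product single_mon[symmetric] mult_single)
  then have "ev h \<sigma> (f * g) = (\<Sum>\<mu>\<in>keys f. \<Sum>\<nu>\<in>keys g.
      (h (lookup f \<mu>) * mono_val \<sigma> \<mu>) * (h (lookup g \<nu>) * mono_val \<sigma> \<nu>))"
    by (simp add: ev_sum ev_single mono_val_add h_mult mult_ac)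
  then show ?thesis by (simp add: ev_def sum_product)
qed

end

interpretation complex_hom: coeff_hom "\<lambda>c. c :: complex"
  by unfold_locales simp_all
interpretation Cst_hom: coeff_hom Cst
  by unfold_locales (simp_all add: Cst_add Cst_mult)

lemma eval_ev: "eval f x = ev (\<lambda>c. c) x f"
  by (simp add: eval_def ev_def mono_val_def)

lemma eval_Cst [simp]: "eval (Cst c) x = c"
  and eval_Var [simp]: "eval (Var i) x = x i"
  and eval_add [simp]: "eval (f + g) x = eval f x + eval g x"
  and eval_mult [simp]: "eval (f * g) x = eval f x * eval g x"
  and eval_sum: "eval (\<Sum>i\<in>I. F i) x = (\<Sum>i\<in>I. eval (F i) x)"
  by (simp_all add: eval_ev complex_hom.ev_Cst complex_hom.ev_Var complex_hom.ev_add
      complex_hom.ev_mult complex_hom.ev_sum)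

lemma eval_0 [simp]: "eval 0 x = 0" and eval_1 [simp]: "eval 1 x = 1"
  using eval_Cst[of 0 x] eval_Cst[of 1 x] by simp_all

lemma eval_minus [simp]: "eval (- f) x = - eval f x"
  using eval_add[of f "- f" x] by (simp add: eq_neg_iff_add_eq_0 add.commute)

lemma eval_diff [simp]: "eval (f - g) x = eval f x - eval g x"
  using eval_add[of f "- g" x] by simp

lemma eval_power [simp]: "eval (f ^ n) x = eval f x ^ n"
  by (induction n) simp_all

lemma eval_prod: "eval (\<Prod>i\<in>I. F i) x = (\<Prod>i\<in>I. eval (F i) x)"
  by (induction I rule: infinite_finite_induct) simp_all

lemma eval_cscale [simp]: "eval (cscale c f) x = c * eval f x"
  by (simp add: cscale_Cst)

lemma subst_Cst [simp]: "subst \<sigma> (Cst c) = Cst c"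
  and subst_Var [simp]: "subst \<sigma> (Var i) = \<sigma> i"
  and subst_add [simp]: "subst \<sigma> (f + g) = subst \<sigma> f + subst \<sigma> g"
  and subst_mult [simp]: "subst \<sigma> (f * g) = subst \<sigma> f * subst \<sigma> g"
  by (simp_all add: subst_def Cst_hom.ev_Cst Cst_hom.ev_Var Cst_hom.ev_add
      Cst_hom.ev_mult)

lemma subst_0 [simp]: "subst \<sigma> 0 = 0" and subst_1 [simp]: "subst \<sigma> 1 = 1"
  using subst_Cst[of \<sigma> 0] subst_Cst[of \<sigma> 1] by simp_all

lemma subst_minus [simp]: "subst \<sigma> (- f) = - subst \<sigma> f"
  using subst_add[of \<sigma> f "- f"] by (simp add: eq_neg_iff_add_eq_0 add.commute)

lemma subst_diff [simp]: "subst \<sigma> (f - g) = subst \<sigma> f - subst \<sigma> g"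
  using subst_add[of \<sigma> f "- g"] by simp

lemma subst_cscale [simp]: "subst \<sigma> (cscale c f) = cscale c (subst \<sigma> f)"
  by (simp add: cscale_Cst)

lemma subst_expand: "subst \<sigma> f = (\<Sum>\<mu>\<in>keys f. Cst (lookup f \<mu>) * mono_val \<sigma> \<mu>)"
  by (simp add: subst_def ev_def)

lemma eval_expand: "eval f x = (\<Sum>\<mu>\<in>keys f. lookup f \<mu> * mono_val x \<mu>)"
  by (simp add: eval_ev ev_def)

lemma eval_subst [simp]: "eval (subst \<sigma> f) x = eval f (\<lambda>i. eval (\<sigma> i) x)"
  by (induction f rule: cpoly_induct) simp_all

lemma subst_subst: "subst \<sigma> (subst \<tau> f) = subst (\<lambda>i. subst \<sigma> (\<tau> i)) f"
  by (induction f rule: cpoly_induct) simp_all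

lemma subst_Var_id [simp]: "subst Var f = f"
  by (induction f rule: cpoly_induct) simp_all

text \<open>Modulo \<open>d\<close> the two substitutions agree on variables, hence everywhere. With
  \<open>\<tau>\<close> identifying two variables this yields the factor
  \<open>u\<^sub>i - u\<^sub>j\<close> of a polynomial that vanishes on a diagonal.\<close>

lemma dvd_subst_diff:
  assumes "\<And>i. d dvd \<sigma> i - \<tau> i"
  shows "d dvd subst \<sigma> f - subst \<tau> f"
proof (induction f rule: cpoly_induct)
  case (add f g)
  have "subst \<sigma> (f + g) - subst \<tau> (f + g) = (subst \<sigma> f - subst \<tau> f) + (subst \<sigma> g - subst \<tau> g)"
    by simp
  then show ?case using add by (metis dvd_add)
next
  case (mult f g)
  have "subst \<sigma> (f * g) - subst \<tau> (f * g)
      = (subst \<sigma> f - subst \<tau> f) * subst \<sigma> g + subst \<tau> f * (subst \<sigma> g - subst \<tau> g)"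
    by (simp add: algebra_simps)
  then show ?case using mult by (metis dvd_add dvd_mult dvd_mult2)
qed (simp_all add: assms)

lemma Var_nonzero: "Var i \<noteq> 0"
proof
  assume "Var i = 0"
  then have "eval (Var i) (\<lambda>_. 1) = 0" by simp
  then show False by simp
qed

subsection \<open>Partial derivatives\<close>

lemma lookup_partial_deriv:
  "lookup (partial_deriv i f) \<mu> = of_nat (lookup \<mu> i + 1) * lookup f (\<mu> + single i 1)"
proof -
  \<comment> \<open>A monomial without the variable \<open>i\<close> is unchanged by the truncated
    subtraction of \<open>single i 1\<close>; its factor \<open>lookup \<nu> i\<close> is 0, which
    makes it harmless.\<close>
  have eq: "(if \<nu> - single i 1 = \<mu> then of_nat (lookup \<nu> i) * lookup f \<nu> else 0)
      = (if \<nu> = \<mu> + single i 1 then of_nat (lookup \<nu> i) * lookup f \<nu> else 0)" for \<nu>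
  proof (cases "lookup \<nu> i = 0")
    case False
    have "\<nu> - single i 1 = \<mu> \<longleftrightarrow> \<nu> = \<mu> + single i 1"
    proof
      assume *: "\<nu> - single i 1 = \<mu>"
      show "\<nu> = \<mu> + single i 1"
        using False unfolding *[symmetric]
        by (intro poly_mapping_eqI) (auto simp: lookup_add lookup_minus lookup_single when_def)
    qed simp
    then show ?thesis by simp
  qed simp
  have "lookup (partial_deriv i f) \<mu>
      = (\<Sum>\<nu>\<in>keys f. if \<nu> - single i 1 = \<mu> then of_nat (lookup \<nu> i) * lookup f \<nu> else 0)"
    unfolding partial_deriv_def lookup_sum
    by (intro sum.cong refl) (simp add: lookup_single when_def)
  also have "\<dots> = (\<Sum>\<nu>\<in>keys f. if \<nu> = \<mu> + single i 1 then of_nat (lookup \<nu> i) * lookup f \<nu> else 0)"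
    by (simp only: eq)
  also have "\<dots> = of_nat (lookup \<mu> i + 1) * lookup f (\<mu> + single i 1)"
    by (simp add: in_keys_iff lookup_add)
  finally show ?thesis .
qed

lemma partial_deriv_add [simp]: "partial_deriv i (f + g) = partial_deriv i f + partial_deriv i g"
  by (rule poly_mapping_eqI) (simp add: lookup_partial_deriv lookup_add distrib_left)

lemma partial_deriv_Cst_mult [simp]: "partial_deriv i (Cst c * f) = Cst c * partial_deriv i f"
  by (rule poly_mapping_eqI) (simp add: lookup_partial_deriv)

lemma partial_deriv_0 [simp]: "partial_deriv i 0 = 0"
  by (simp add: partial_deriv_def)

lemma partial_deriv_sum: "partial_deriv i (\<Sum>j\<in>J. F j) = (\<Sum>j\<in>J. partial_deriv i (F j))"
  by (induction J rule: infinite_finite_induct) simp_all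

lemma partial_deriv_minus [simp]: "partial_deriv i (- f) = - partial_deriv i f"
  using partial_deriv_add[of i f "- f"] by (simp add: eq_neg_iff_add_eq_0 add.commute)

lemma partial_deriv_diff [simp]: "partial_deriv i (f - g) = partial_deriv i f - partial_deriv i g"
  using partial_deriv_add[of i f "- g"] by simp

lemma partial_deriv_commute: "partial_deriv i (partial_deriv j f) = partial_deriv j (partial_deriv i f)"
proof (cases "i = j")
  case False
  have "\<mu> + single i 1 + single j 1 = \<mu> + single j 1 + single i 1" for \<mu> :: monomial
    by (metis add.assoc add.commute)
  then show ?thesis
    using False by (intro poly_mapping_eqI) (simp add: lookup_partial_deriv lookup_add lookup_single)
qed simp

lemma partial_deriv_mon:
  "partial_deriv i (mon \<mu>) = of_nat (lookup \<mu> i) * mon (\<mu> - single i 1)"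
  by (simp add: partial_deriv_def single_mon lookup_mon)

lemma partial_deriv_mon_mult:
  "partial_deriv i (mon \<mu> * mon \<nu>) = partial_deriv i (mon \<mu>) * mon \<nu> + mon \<mu> * partial_deriv i (mon \<nu>)"
proof -
  have *: "of_nat (lookup \<mu> i) * mon (\<mu> - single i 1 + \<nu>) = of_nat (lookup \<mu> i) * mon (\<mu> + \<nu> - single i 1)"
    for \<mu> \<nu> :: monomial
  proof (cases "lookup \<mu> i = 0")
    case False
    then have "\<mu> - single i 1 + \<nu> = \<mu> + \<nu> - single i 1"
      by (intro poly_mapping_eqI) (auto simp: lookup_add lookup_minus lookup_single when_def)
    then show ?thesis by simp
  qed simp
  have "partial_deriv i (mon \<mu> * mon \<nu>) = of_nat (lookup \<mu> i) * mon (\<mu> + \<nu> - single i 1)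
     + of_nat (lookup \<nu> i) * mon (\<nu> + \<mu> - single i 1)"
    by (simp add: mon_add[symmetric] partial_deriv_mon lookup_add distrib_right add.commute)
  also have "\<dots> = of_nat (lookup \<mu> i) * mon (\<mu> - single i 1 + \<nu>)
     + of_nat (lookup \<nu> i) * mon (\<nu> - single i 1 + \<mu>)"
    by (simp only: *)
  finally show ?thesis by (simp add: partial_deriv_mon mon_add mult_ac)
qed

lemma partial_deriv_mult [simp]:
  "partial_deriv i (f * g) = partial_deriv i f * g + f * partial_deriv i g"
proof -
  have D: "partial_deriv i h = (\<Sum>\<mu>\<in>keys h. Cst (lookup h \<mu>) * partial_deriv i (mon \<mu>))" for h
    by (subst (1) cpoly_decomp) (simp add: partial_deriv_sum)
  have "f * g = (\<Sum>\<mu>\<in>keys f. \<Sum>\<nu>\<in>keys g. Cst (lookup f \<mu>) * (Cst (lookup g \<nu>) * (mon \<mu> * mon \<nu>)))"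
    by (subst (1) cpoly_decomp[of f], subst (1) cpoly_decomp[of g]) (simp add: sum_product mult_ac)
  then have "partial_deriv i (f * g) = (\<Sum>\<mu>\<in>keys f. \<Sum>\<nu>\<in>keys g. Cst (lookup f \<mu>) * (Cst (lookup g \<nu>) *
      (partial_deriv i (mon \<mu>) * mon \<nu> + mon \<mu> * partial_deriv i (mon \<nu>))))"
    by (simp only: partial_deriv_sum partial_deriv_Cst_mult partial_deriv_mon_mult)
  also have "\<dots> = (\<Sum>\<mu>\<in>keys f. Cst (lookup f \<mu>) * partial_deriv i (mon \<mu>)) * (\<Sum>\<nu>\<in>keys g. Cst (lookup g \<nu>) * mon \<nu>)
     + (\<Sum>\<mu>\<in>keys f. Cst (lookup f \<mu>) * mon \<mu>) * (\<Sum>\<nu>\<in>keys g. Cst (lookup g \<nu>) * partial_deriv i (mon \<nu>))"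
    unfolding sum_product sum.distrib[symmetric]
    by (intro sum.cong refl) (simp add: algebra_simps)
  finally show ?thesis
    by (simp only: D[symmetric] cpoly_decomp[symmetric])
qed

lemma partial_deriv_Cst [simp]: "partial_deriv i (Cst c) = 0"
proof (rule poly_mapping_eqI)
  fix \<mu> :: monomial
  have "lookup (\<mu> + single i 1) i \<noteq> lookup (0 :: monomial) i"
    by (simp add: lookup_add)
  then have "\<mu> + single i 1 \<noteq> 0" by metis
  then show "lookup (partial_deriv i (Cst c)) \<mu> = lookup 0 \<mu>"
    unfolding lookup_partial_deriv by (simp add: Cst_def lookup_single when_def)
qed

lemma partial_deriv_Var [simp]: "partial_deriv i (Var j) = (if i = j then 1 else 0)"
proof -
  have "partial_deriv i (mon (single j 1)) = (if i = j then 1 else 0)"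
    unfolding partial_deriv_mon by (simp add: lookup_single)
  then show ?thesis by (simp add: mon_single)
qed

text \<open>Connects the formal derivative with the analytic one. The finite set \<open>S\<close>
  contains the support of the direction \<open>y\<close>, so the sum over the variables is
  finite.\<close>

lemma has_field_derivative_eval_line:
  assumes "finite S" "\<And>i. i \<notin> S \<Longrightarrow> y i = 0"
  shows "((\<lambda>s. eval f (\<lambda>i. x i + s * y i)) has_field_derivative
    (\<Sum>i\<in>S. y i * eval (partial_deriv i f) (\<lambda>i. x i + s * y i))) (at s)"
proof (induction f rule: cpoly_induct)
  case (Var j)
  have "(\<Sum>i\<in>S. y i * eval (partial_deriv i (Var j)) (\<lambda>i. x i + s * y i)) = (\<Sum>i\<in>S. if i = j then y i else 0)"
    by (intro sum.cong refl) simp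
  also have "\<dots> = y j" using assms by simp
  finally have "(\<Sum>i\<in>S. y i * eval (partial_deriv i (Var j)) (\<lambda>i. x i + s * y i)) = y j" .
  moreover have "((\<lambda>s. x j + s * y j) has_field_derivative y j) (at s)"
    by (auto intro!: derivative_eq_intros)
  ultimately show ?case by (simp only: eval_Var)
next
  case (add f g)
  show ?case
    by (rule DERIV_cong[OF DERIV_add[OF add], folded eval_add])
       (simp add: distrib_left sum.distrib)
next
  case (mult f g)
  show ?case
    by (rule DERIV_cong[OF DERIV_mult[OF mult], folded eval_mult])
       (simp add: sum_distrib_left sum_distrib_right distrib_left sum.distrib mult_ac)
qed simp

lemma has_field_derivative_eval_coordinate:
  "((\<lambda>s. eval f (x(i := s))) has_field_derivative eval (partial_deriv i f) (x(i := s))) (at s)"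
proof -
  have "(\<lambda>j. (x(i := 0)) j + s * (if j = i then 1 else 0)) = x(i := s)" for s by auto
  with has_field_derivative_eval_line[of "{i}" "\<lambda>j. if j = i then 1 else 0" f "x(i := 0)" s]
  show ?thesis by simp
qed

lemma eval_at_0: "eval f (\<lambda>_. 0) = lookup f 0"
proof -
  have "mono_val (\<lambda>_. 0) \<mu> = (if \<mu> = 0 then 1 else 0 :: complex)" for \<mu>
  proof (cases "\<mu> = 0")
    case False
    then obtain i where "i \<in> keys \<mu>" by (metis ex_in_conv keys_eq_empty)
    then show ?thesis using False by (auto simp: mono_val_def in_keys_iff)
  qed simp
  then show ?thesis
    by (simp add: eval_expand if_distrib[where f = "\<lambda>z. _ * z"] in_keys_iff cong: if_cong)
qed

section \<open>Weighted degrees, and polynomials as functions\<close>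

definition wt :: "(nat \<Rightarrow> nat) \<Rightarrow> monomial \<Rightarrow> nat" where
  "wt w \<mu> = (\<Sum>i\<in>keys \<mu>. w i * lookup \<mu> i)"

lemma wt_superset: "finite S \<Longrightarrow> keys \<mu> \<subseteq> S \<Longrightarrow> wt w \<mu> = (\<Sum>i\<in>S. w i * lookup \<mu> i)"
  unfolding wt_def by (rule sum.mono_neutral_left) (auto simp: in_keys_iff)

lemma wt_0 [simp]: "wt w 0 = 0" by (simp add: wt_def)

lemma wt_add [simp]: "wt w (\<mu> + \<nu>) = wt w \<mu> + wt w \<nu>"
proof -
  let ?S = "keys \<mu> \<union> keys \<nu>"
  have "wt w (\<mu> + \<nu>) = (\<Sum>i\<in>?S. w i * lookup (\<mu> + \<nu>) i)"
    by (rule wt_superset) (auto simp: Poly_Mapping.keys_add)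
  then show ?thesis
    by (simp add: wt_superset[where S = ?S] lookup_add distrib_left sum.distrib)
qed

lemma wt_single [simp]: "wt w (single i k) = w i * k"
  by (cases "k = 0") (simp_all add: wt_def)

text \<open>The partial derivatives of a polynomial that vanishes everywhere vanish everywhere too,
  and the coefficient of \<open>\<mu>\<close> is, up to a nonzero factor, a coefficient of smaller
  degree of such a derivative. The induction ends at the constant term, the value at 0.\<close>

lemma eval_eq_0_imp: 
  assumes "\<And>x. eval f x = 0"
  shows "f = 0"
proof -
  have "lookup f \<mu> = 0" if "\<And>x. eval f x = 0" for \<mu> f
    using that
  proof (induction "wt (\<lambda>_. 1) \<mu>" arbitrary: \<mu> f)
    case 0
    then have "\<mu> = 0"
      by (intro poly_mapping_eqI) (auto simp: wt_def in_keys_iff)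
    then show ?case using eval_at_0[of f] 0(2) by simp
  next
    case (Suc n)
    then obtain i where i: "i \<in> keys \<mu>" 
      by (metis Zero_not_Suc ex_in_conv keys_eq_empty wt_0)
    define \<nu> where "\<nu> = \<mu> - single i 1"
    have \<mu>: "\<mu> = \<nu> + single i 1"
      unfolding \<nu>_def using i by (intro poly_mapping_eqI) (auto simp: lookup_add lookup_minus lookup_single when_def in_keys_iff)
    have "eval (partial_deriv i f) x = 0" for x
    proof -
      have "((\<lambda>s. eval f (x(i := s))) has_field_derivative 0) (at (x i))"
        using Suc.prems by simp
      from DERIV_unique[OF has_field_derivative_eval_coordinate this] show ?thesis by simp
    qed
    moreover have "n = wt (\<lambda>_. 1) \<nu>" using Suc.hyps(2) \<mu> by simp
    ultimately have "lookup (partial_deriv i f) \<nu> = 0" using Suc.hyps(1) by blast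
    then show ?case by (simp add: lookup_partial_deriv \<mu> del: of_nat_Suc)
  qed
  then show ?thesis using assms by (intro poly_mapping_eqI) simp
qed

lemma eval_eqI: "(\<And>x. eval f x = eval g x) \<Longrightarrow> f = g"
  using eval_eq_0_imp[of "f - g"] by simp

lemma partial_deriv_subst_translate:
  "partial_deriv i (subst (\<lambda>j. Var j + Cst (p j)) f) = subst (\<lambda>j. Var j + Cst (p j)) (partial_deriv i f)"
  by (induction f rule: cpoly_induct) simp_all

subsection \<open>Gradings\<close>

text \<open>The relation \<open>Q\<close> covers three notions at once: homogeneous of degree
  \<open>d\<close>, of degree at most \<open>d\<close>, and, with weights 1, vanishing at the origin
  to order at least \<open>d\<close>.\<close>

definition graded :: "(nat \<Rightarrow> nat \<Rightarrow> bool) \<Rightarrow> (nat \<Rightarrow> nat) \<Rightarrow> nat \<Rightarrow> cpoly set" where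
  "graded Q w d = {f. \<forall>\<mu>\<in>keys f. Q (wt w \<mu>) d}"

definition additive_rel :: "(nat \<Rightarrow> nat \<Rightarrow> bool) \<Rightarrow> bool" where
  "additive_rel Q \<longleftrightarrow> Q 0 0 \<and> (\<forall>a b c d. Q a b \<longrightarrow> Q c d \<longrightarrow> Q (a + c) (b + d))"

definition polys_in :: "nat \<Rightarrow> cpoly set" where
  "polys_in N = {f. \<forall>\<mu>\<in>keys f. keys \<mu> \<subseteq> {..<N}}"

lemma additive_rel [simp]: "additive_rel (=)" "additive_rel (\<le>)" "additive_rel (\<lambda>a b. b \<le> a)"
  by (auto simp: additive_rel_def)

lemma keys_cscale: "keys (cscale c f) \<subseteq> keys f"
  by (auto simp: in_keys_iff cscale_Cst)

lemma graded_0 [simp]: "0 \<in> graded Q w d"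
  by (simp add: graded_def)

lemma graded_add: "f \<in> graded Q w d \<Longrightarrow> g \<in> graded Q w d \<Longrightarrow> f + g \<in> graded Q w d"
  using Poly_Mapping.keys_add[of f g] by (auto simp: graded_def)

lemma graded_cscale: "f \<in> graded Q w d \<Longrightarrow> cscale c f \<in> graded Q w d"
  using keys_cscale[of c f] by (auto simp: graded_def)

lemma subspace_graded: "cpoly.subspace (graded Q w d)"
  by (simp add: cpoly.subspace_def graded_add graded_cscale)

lemma graded_Cst_mult: "f \<in> graded Q w d \<Longrightarrow> Cst c * f \<in> graded Q w d"
  using graded_cscale by (simp add: cscale_Cst)

lemma graded_sum: "(\<And>i. i \<in> I \<Longrightarrow> F i \<in> graded Q w d) \<Longrightarrow> (\<Sum>i\<in>I. F i) \<in> graded Q w d"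
  by (rule cpoly.subspace_sum[OF subspace_graded])

lemma graded_diff: "f \<in> graded Q w d \<Longrightarrow> g \<in> graded Q w d \<Longrightarrow> f - g \<in> graded Q w d"
  by (rule cpoly.subspace_diff[OF subspace_graded])

lemma graded_mult:
  assumes "additive_rel Q" "f \<in> graded Q w a" "g \<in> graded Q w b"
  shows "f * g \<in> graded Q w (a + b)"
  unfolding graded_def
proof (intro CollectI ballI)
  fix \<mu> assume "\<mu> \<in> keys (f * g)"
  then obtain \<alpha> \<beta> where "\<mu> = \<alpha> + \<beta>" "\<alpha> \<in> keys f" "\<beta> \<in> keys g"
    using Poly_Mapping.keys_mult[of f g] by blast
  then show "Q (wt w \<mu>) (a + b)"
    using assms by (simp add: graded_def additive_rel_def)
qed

lemma graded_Var: "Q (w i) d \<Longrightarrow> Var i \<in> graded Q w d"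
  by (simp add: graded_def Var_def)

lemma graded_Cst: "Q 0 d \<Longrightarrow> Cst c \<in> graded Q w d"
  by (cases "c = 0") (simp_all add: graded_def Cst_def)

lemma graded_1: "Q 0 d \<Longrightarrow> 1 \<in> graded Q w d"
  using graded_Cst[of Q d 1] by simp

lemma graded_prod:
  assumes "additive_rel Q" "\<And>i. i \<in> I \<Longrightarrow> F i \<in> graded Q w (d i)"
  shows "(\<Prod>i\<in>I. F i) \<in> graded Q w (\<Sum>i\<in>I. d i)"
  using assms(2)
  by (induction I rule: infinite_finite_induct)
     (use assms(1) in \<open>auto intro!: graded_mult graded_1 simp: additive_rel_def\<close>)

lemma graded_power:
  assumes "additive_rel Q" "f \<in> graded Q w d"
  shows "f ^ n \<in> graded Q w (d * n)"
  using assms by (induction n) (auto intro!: graded_mult graded_1 simp: additive_rel_def)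

lemma graded_mono_val:
  assumes "additive_rel Q" "\<And>i. \<sigma> i \<in> graded Q w (\<delta> i)"
  shows "mono_val \<sigma> \<mu> \<in> graded Q w (wt \<delta> \<mu>)"
  unfolding mono_val_def wt_def
  by (intro graded_prod graded_power assms)

text \<open>The last assumption is phrased through \<open>Q\<close> so that \<open>d\<close> may be
  weaker than the degrees of the single monomials, as the inequalities require.\<close>

lemma graded_subst:
  assumes "additive_rel Q" "\<And>i. \<sigma> i \<in> graded Q w (\<delta> i)"
    and "\<And>\<mu> a. \<mu> \<in> keys f \<Longrightarrow> Q a (wt \<delta> \<mu>) \<Longrightarrow> Q a d"
  shows "subst \<sigma> f \<in> graded Q w d"
  unfolding subst_expand
proof (intro graded_sum graded_Cst_mult)
  fix \<mu> assume "\<mu> \<in> keys f"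
  with assms(3) graded_mono_val[OF assms(1,2)] show "mono_val \<sigma> \<mu> \<in> graded Q w d"
    by (auto simp: graded_def)
qed

lemma wt_eq_0_iff: "wt w \<mu> = 0 \<longleftrightarrow> (\<forall>i\<in>keys \<mu>. w i = 0)"
  by (auto simp: wt_def in_keys_iff)

text \<open>With weight 1 on the forbidden variables, avoiding them means degree 0, so the closure
  properties come from \<open>graded\<close>.\<close>

lemma polys_in_graded: "polys_in N = graded (=) (\<lambda>i. if i < N then 0 else 1) 0"
  by (auto simp: polys_in_def graded_def wt_eq_0_iff subset_iff split: if_splits)

lemma subspace_polys_in: "cpoly.subspace (polys_in N)"
  unfolding polys_in_graded by (rule subspace_graded)

lemma polys_in_mult: "f \<in> polys_in N \<Longrightarrow> g \<in> polys_in N \<Longrightarrow> f * g \<in> polys_in N"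
  unfolding polys_in_graded using graded_mult[of "(=)" f _ 0 g 0] by simp

lemma polys_in_Var: "i < N \<Longrightarrow> Var i \<in> polys_in N"
  by (simp add: polys_in_graded graded_Var)

lemma polys_in_Cst [simp]: "Cst c \<in> polys_in N"
  by (simp add: polys_in_graded graded_Cst)

lemma polys_in_subst: "(\<And>i. \<sigma> i \<in> polys_in N) \<Longrightarrow> subst \<sigma> f \<in> polys_in N"
  unfolding polys_in_graded
  by (rule graded_subst[where \<delta> = "\<lambda>_. 0"]) (simp_all add: wt_def)

lemma mono_val_cong: "(\<And>i. i \<in> keys \<mu> \<Longrightarrow> \<sigma> i = \<tau> i) \<Longrightarrow> mono_val \<sigma> \<mu> = mono_val \<tau> \<mu>"
  by (simp add: mono_val_def)

lemma eval_cong_polys_in: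
  assumes "f \<in> polys_in N" "\<And>i. i < N \<Longrightarrow> x i = y i"
  shows "eval f x = eval f y"
  unfolding eval_expand
  by (intro sum.cong refl arg_cong2[of _ _ _ _ "(*)"] mono_val_cong) (use assms in \<open>auto simp: polys_in_def\<close>)

lemma subst_cong_polys_in:
  assumes "f \<in> polys_in N" "\<And>i. i < N \<Longrightarrow> \<sigma> i = \<tau> i"
  shows "subst \<sigma> f = subst \<tau> f"
  unfolding subst_expand
  by (intro sum.cong refl arg_cong2[of _ _ _ _ "(*)"] mono_val_cong) (use assms in \<open>auto simp: polys_in_def\<close>)

lemma polys_in_subst_lessThan:
  assumes "f \<in> polys_in M" "\<And>i. i < M \<Longrightarrow> \<sigma> i \<in> polys_in N"
  shows "subst \<sigma> f \<in> polys_in N"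
proof -
  have "subst \<sigma> f = subst (\<lambda>i. if i < M then \<sigma> i else Cst 0) f"
    by (rule subst_cong_polys_in[OF assms(1)]) simp
  also have "\<dots> \<in> polys_in N"
    by (rule polys_in_subst) (use assms(2) in \<open>auto simp del: Cst_0\<close>)
  finally show ?thesis .
qed

lemma monomial_minus_single:
  "i \<in> keys \<mu> \<Longrightarrow> (\<mu> :: monomial) = (\<mu> - single i 1) + single i 1"
  by (intro poly_mapping_eqI) (auto simp: lookup_add lookup_minus lookup_single when_def in_keys_iff)

lemma partial_deriv_eq_0_imp:
  assumes "partial_deriv i f = 0" "\<mu> \<in> keys f"
  shows "lookup \<mu> i = 0"
proof (rule ccontr)
  assume "lookup \<mu> i \<noteq> 0"
  then have \<mu>: "\<mu> = (\<mu> - single i 1) + single i 1"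
    by (intro monomial_minus_single) (simp add: in_keys_iff)
  have "lookup (partial_deriv i f) (\<mu> - single i 1) = of_nat (lookup (\<mu> - single i 1) i + 1) * lookup f \<mu>"
    using \<mu> by (metis lookup_partial_deriv)
  with assms show False by (simp add: in_keys_iff del: of_nat_Suc of_nat_add)
qed

lemma lookup_subst_scale: "lookup (subst (\<lambda>i. Cst (a i) * Var i) f) \<mu> = mono_val a \<mu> * lookup f \<mu>"
proof -
  have "mono_val (\<lambda>i. Cst (a i) * Var i) \<nu> = Cst (mono_val a \<nu>) * mon \<nu>" for \<nu>
  proof -
    have "Cst (\<Prod>i\<in>I. a i ^ lookup \<nu> i) = (\<Prod>i\<in>I. Cst (a i) ^ lookup \<nu> i)" for I
      by (induction I rule: infinite_finite_induct) (simp_all add: Cst_mult Cst_power)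
    then show ?thesis
      unfolding mono_val_Var[symmetric] by (simp add: mono_val_def power_mult_distrib prod.distrib)
  qed
  then have "subst (\<lambda>i. Cst (a i) * Var i) f = (\<Sum>\<nu>\<in>keys f. Cst (lookup f \<nu> * mono_val a \<nu>) * mon \<nu>)"
    by (simp add: subst_expand Cst_mult mult_ac)
  then have "lookup (subst (\<lambda>i. Cst (a i) * Var i) f) \<mu>
      = (\<Sum>\<nu>\<in>keys f. if \<nu> = \<mu> then lookup f \<nu> * mono_val a \<nu> else 0)"
    by (simp add: lookup_sum lookup_mon if_distrib cong: if_cong)
  then show ?thesis by (simp add: in_keys_iff)
qed

lemma mono_val_power: "mono_val (\<lambda>i. c ^ w i) \<mu> = c ^ wt w \<mu>"
  by (simp add: mono_val_def wt_def power_mult[symmetric] power_sum)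

lemma mono_val_mult: "mono_val (\<lambda>i. a i * b i) \<mu> = mono_val a \<mu> * mono_val b \<mu>"
  by (simp add: mono_val_def power_mult_distrib prod.distrib)

lemma eval_scale_graded:
  assumes "f \<in> graded (=) w d"
  shows "eval f (\<lambda>i. c ^ w i * x i) = c ^ d * eval f x"
  unfolding eval_expand sum_distrib_left
  by (intro sum.cong refl) (use assms in \<open>auto simp: mono_val_mult mono_val_power graded_def\<close>)

lemma of_nat_power_inj:
  "2 \<le> k \<Longrightarrow> (of_nat k :: complex) ^ a = of_nat k ^ b \<longleftrightarrow> a = b"
  by (metis of_nat_eq_iff of_nat_power power_inject_exp less_le_trans one_less_numeral_iff semiring_norm(76))

text \<open>One integer scalar detects the degree: scaling multiplies the coefficient of
  \<open>\<mu>\<close> by \<open>k ^ wt w \<mu>\<close>, and different powers of \<open>k\<close>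
  are different numbers.\<close>

lemma gradedI_scale:
  assumes "2 \<le> k" "\<And>x. eval f (\<lambda>i. of_nat k ^ w i * x i) = of_nat k ^ d * eval f x"
  shows "f \<in> graded (=) w d"
  unfolding graded_def
proof (intro CollectI ballI)
  fix \<mu> assume \<mu>: "\<mu> \<in> keys f"
  have "subst (\<lambda>i. Cst (of_nat k ^ w i) * Var i) f = Cst (of_nat k ^ d) * f"
    by (rule eval_eqI) (simp add: assms(2) del: Cst_of_nat)
  then have "lookup (subst (\<lambda>i. Cst (of_nat k ^ w i) * Var i) f) \<mu> = of_nat k ^ d * lookup f \<mu>"
    by (simp only: lookup_Cst_mult)
  then have "(of_nat k :: complex) ^ wt w \<mu> = of_nat k ^ d"
    using \<mu> by (simp only: lookup_subst_scale mono_val_power) (simp add: in_keys_iff)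
  then show "wt w \<mu> = d" using of_nat_power_inj[OF assms(1)] by blast
qed

lemma wt_indicator:
  assumes "finite S"
  shows "wt (\<lambda>i. if i \<in> S then 1 else 0) \<mu> = (\<Sum>i\<in>S. lookup \<mu> i)"
proof -
  have "wt (\<lambda>i. if i \<in> S then 1 else 0) \<mu> = (\<Sum>i\<in>keys \<mu> \<union> S. if i \<in> S then lookup \<mu> i else 0)"
    using assms by (simp add: wt_superset[of "keys \<mu> \<union> S"] if_distrib[where f = "\<lambda>z. z * _"] cong: if_cong)
  also have "\<dots> = (\<Sum>i\<in>S. lookup \<mu> i)"
    using assms by (simp add: sum.If_cases Int_absorb1)
  finally show ?thesis .
qed

lemma wt_cong: "(\<And>i. i \<in> keys \<mu> \<Longrightarrow> w i = w' i) \<Longrightarrow> wt w \<mu> = wt w' \<mu>"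
  by (simp add: wt_def)

lemma graded_cong_polys_in:
  assumes "f \<in> polys_in N" "\<And>i. i < N \<Longrightarrow> w i = w' i"
  shows "f \<in> graded Q w d \<longleftrightarrow> f \<in> graded Q w' d"
proof -
  have "wt w \<mu> = wt w' \<mu>" if "\<mu> \<in> keys f" for \<mu>
    by (rule wt_cong) (use assms that in \<open>auto simp: polys_in_def\<close>)
  then show ?thesis by (auto simp: graded_def)
qed

lemma forms_iff: "f \<in> forms k d \<longleftrightarrow> f \<in> polys_in k \<and> f \<in> graded (=) (\<lambda>_. 1) d"
proof -
  have "f \<in> forms k d \<longleftrightarrow> f \<in> polys_in k \<and> f \<in> graded (=) (\<lambda>i. if i \<in> {..<k} then 1 else 0) d"
    unfolding forms_def graded_def polys_in_def wt_indicator[OF finite_lessThan] by auto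
  also have "\<dots> \<longleftrightarrow> f \<in> polys_in k \<and> f \<in> graded (=) (\<lambda>_. 1) d"
    using graded_cong_polys_in[of f k "\<lambda>i. if i \<in> {..<k} then 1 else 0" "\<lambda>_. 1" "(=)" d] by auto
  finally show ?thesis .
qed

lemma multiforms_iff:
  assumes "k > 0"
  shows "f \<in> multiforms m k D \<longleftrightarrow> f \<in> polys_in (m * k) \<and>
    (\<forall>i<m. f \<in> graded (=) (\<lambda>v. if v div k = i then 1 else 0) (D i))"
proof -
  have "(\<lambda>v. if v div k = i then 1 else 0) = (\<lambda>v. if v \<in> (\<lambda>j. i * k + j) ` {..<k} then 1 else 0 :: nat)" for i
  proof
    fix v
    have "v div k = i \<longleftrightarrow> v \<in> (\<lambda>j. i * k + j) ` {..<k}"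
    proof
      assume "v div k = i"
      then have "v = i * k + v mod k" by (metis div_mult_mod_eq)
      then show "v \<in> (\<lambda>j. i * k + j) ` {..<k}" using assms by (intro image_eqI[of _ _ "v mod k"]) auto
    qed (use assms in auto)
    then show "(if v div k = i then 1 else 0) = (if v \<in> (\<lambda>j. i * k + j) ` {..<k} then 1 else 0 :: nat)" by simp
  qed
  then have "wt (\<lambda>v. if v div k = i then 1 else 0) \<mu> = (\<Sum>j<k. lookup \<mu> (i * k + j))" for i \<mu>
    by (simp add: wt_indicator sum.reindex inj_on_def)
  then show ?thesis
    unfolding multiforms_def graded_def polys_in_def by auto
qed

lemma subspace_forms: "cpoly.subspace (forms k d)"
proof -
  have "forms k d = polys_in k \<inter> graded (=) (\<lambda>_. 1) d" using forms_iff by auto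
  then show ?thesis by (simp add: cpoly.subspace_inter subspace_polys_in subspace_graded)
qed

lemma eval_forms_scale: "f \<in> forms k d \<Longrightarrow> eval f (\<lambda>i. c * x i) = c ^ d * eval f x"
  using eval_scale_graded[of f "\<lambda>_. 1" d c x] by (simp add: forms_iff)

subsection \<open>Dimensions\<close>

lemma linear_span_image:
  assumes "Vector_Spaces.linear cscale cscale T"
  shows "T ` cpoly.span S = cpoly.span (T ` S)"
proof -
  interpret T: Vector_Spaces.linear cscale cscale T by fact
  show ?thesis by (rule T.span_image[symmetric])
qed

lemma independent_imp_span_Int:
  assumes "cpoly.independent C" "B \<subseteq> C" "x \<in> cpoly.span B" "x \<in> cpoly.span (C - B)"
  shows "x = 0"
proof -
  have "cpoly.representation C x = cpoly.representation B x"
    "cpoly.representation C x = cpoly.representation (C - B) x"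
    using assms by (auto intro: cpoly.representation_extend)
  then have "cpoly.representation C x b = 0" for b
    by (metis DiffD2 cpoly.representation_ne_zero)
  moreover have "x \<in> cpoly.span C"
    using assms by (meson cpoly.span_mono subsetD)
  ultimately show "x = 0"
    using cpoly.sum_nonzero_representation_eq[OF assms(1), of x] by simp
qed

text \<open>The ambient ring has infinite dimension, so finiteness is a hypothesis on
  \<open>V\<close>. A basis \<open>B\<close> of the kernel is extended to a basis \<open>C\<close>
  of \<open>V\<close>, and \<open>T\<close> is injective on the span of
  \<open>C - B\<close>.\<close>

lemma rank_nullity:
  assumes V: "cpoly.subspace V" "finite B0" "V \<subseteq> cpoly.span B0"
    and T: "Vector_Spaces.linear cscale cscale T"
  shows "cpoly.dim V = cpoly.dim {v \<in> V. T v = 0} + cpoly.dim (T ` V)"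
proof -
  interpret T: Vector_Spaces.linear cscale cscale T by fact
  interpret pr: vector_space_pair cscale cscale ..
  let ?K = "{v \<in> V. T v = 0}"
  obtain B where B: "B \<subseteq> ?K" "cpoly.independent B" "?K \<subseteq> cpoly.span B" "card B = cpoly.dim ?K"
    using cpoly.basis_exists by blast
  obtain C where C: "B \<subseteq> C" "C \<subseteq> V" "cpoly.independent C" "V \<subseteq> cpoly.span C"
    using cpoly.maximal_independent_subset_extend[of B V] B by blast
  have fin: "finite C"
    using cpoly.independent_span_bound[OF V(2) C(3)] C(2) V(3) by blast
  have spanC: "cpoly.span C = V"
    using C V(1) by (meson cpoly.span_minimal subset_antisym)
  have K: "cpoly.subspace ?K"
    using V(1) by (auto simp: cpoly.subspace_def T.add T.scale)
  have inj: "inj_on T (cpoly.span (C - B))"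
  proof (subst T.inj_on_iff_eq_0, rule cpoly.subspace_span, intro ballI impI)
    fix x assume x: "x \<in> cpoly.span (C - B)" "T x = 0"
    then have "x \<in> V" using spanC by (metis Diff_subset cpoly.span_mono subsetD)
    with x B have "x \<in> cpoly.span B" by auto
    then show "x = 0" using independent_imp_span_Int[OF C(3,1)] x by blast
  qed
  have ind: "cpoly.independent (T ` (C - B))"
    by (rule pr.linear_independent_injective_image[OF T _ inj])
       (use C(3) cpoly.independent_mono in blast)
  have "T ` V = cpoly.span (T ` C)"
    unfolding spanC[symmetric] by (rule linear_span_image[OF T])
  also have "\<dots> = cpoly.span (T ` (C - B))"
  proof (intro subset_antisym cpoly.span_minimal cpoly.subspace_span)
    have "T x \<in> cpoly.span (T ` (C - B))" if "x \<in> C" for x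
      using that B(1) by (cases "x \<in> B") (auto intro: cpoly.span_base simp: cpoly.span_zero)
    then show "T ` C \<subseteq> cpoly.span (T ` (C - B))" by blast
    show "T ` (C - B) \<subseteq> cpoly.span (T ` C)"
      by (auto intro: cpoly.span_base)
  qed
  finally have "cpoly.dim (T ` V) = card (T ` (C - B))"
    using ind by (simp add: cpoly.dim_eq_card_independent)
  also have "\<dots> = card (C - B)"
    by (rule card_image) (use inj in \<open>meson cpoly.span_superset inj_on_subset\<close>)
  also have "\<dots> = card C - card B" using C(1) fin finite_subset by (intro card_Diff_subset) auto
  finally have *: "cpoly.dim (T ` V) = card C - card B" .
  have "cpoly.dim V = card C"
    using spanC C(3) cpoly.dim_span_eq_card_independent by metis
  with * B(4) card_mono[OF fin C(1)] show ?thesis by simp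
qed

lemma dim_image_inj:
  assumes "cpoly.subspace V" "finite B0" "V \<subseteq> cpoly.span B0"
    and "Vector_Spaces.linear cscale cscale T" and inj: "\<And>v. v \<in> V \<Longrightarrow> T v = 0 \<Longrightarrow> v = 0"
  shows "cpoly.dim (T ` V) = cpoly.dim V"
proof -
  interpret T: Vector_Spaces.linear cscale cscale T by fact
  have "{v \<in> V. T v = 0} = {0}"
    using inj assms(1) by (auto simp: cpoly.subspace_0 T.zero)
  moreover have "cpoly.dim {0} = 0"
    using cpoly.dim_span_eq_card_independent[of "{}"] cpoly.independent_empty by simp
  ultimately show ?thesis using rank_nullity[OF assms(1-4)] by simp
qed

lemma linear_subst: "Vector_Spaces.linear cscale cscale (subst \<sigma>)"
  by unfold_locales simp_all

lemma span_monomials: "cpoly.span (mon ` B) = {f. keys f \<subseteq> B}"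
proof (intro subset_antisym cpoly.span_minimal)
  show "mon ` B \<subseteq> {f. keys f \<subseteq> B}" by auto
  show "cpoly.subspace {f. keys f \<subseteq> B}"
    unfolding cpoly.subspace_def
  proof (intro conjI ballI allI CollectI)
    fix x y :: cpoly assume "x \<in> {f. keys f \<subseteq> B}" "y \<in> {f. keys f \<subseteq> B}"
    then show "keys (x + y) \<subseteq> B" using Poly_Mapping.keys_add[of x y] by blast
  next
    fix c and x :: cpoly assume "x \<in> {f. keys f \<subseteq> B}"
    then show "keys (cscale c x) \<subseteq> B" using keys_cscale[of c x] by blast
  qed simp
  show "{f. keys f \<subseteq> B} \<subseteq> cpoly.span (mon ` B)"
  proof
    fix f :: cpoly assume "f \<in> {f. keys f \<subseteq> B}"
    then show "f \<in> cpoly.span (mon ` B)"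
      by (subst cpoly_decomp, unfold cscale_Cst[symmetric])
         (auto intro!: cpoly.span_sum cpoly.span_scale intro: cpoly.span_base)
  qed
qed

lemma independent_monomials: "cpoly.independent (mon ` B)"
proof (rule ccontr)
  assume "\<not> ?thesis"
  then obtain b where "b \<in> B" "mon b \<in> cpoly.span (mon ` B - {mon b})"
    by (auto simp: cpoly.dependent_def)
  moreover have "mon ` B - {mon b} \<subseteq> mon ` (B - {b})" by auto
  ultimately have "mon b \<in> cpoly.span (mon ` (B - {b}))" using cpoly.span_mono by blast
  then show False by (simp add: span_monomials)
qed

lemma inj_mon: "inj_on mon B"
  by (metis inj_onI keys_mon singleton_inject)

lemma dim_keys_subset: "cpoly.dim {f. keys f \<subseteq> B} = card B"
  unfolding span_monomials[symmetric] cpoly.dim_span_eq_card_independent[OF independent_monomials]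
  by (rule card_image[OF inj_mon])

lemma finite_monomials: "finite {\<mu> :: monomial. keys \<mu> \<subseteq> {..<N} \<and> (\<forall>i. lookup \<mu> i \<le> M)}"
proof -
  have "finite {f :: nat \<Rightarrow> nat. \<forall>i. (i \<in> {..<N} \<longrightarrow> f i \<in> {..M}) \<and> (i \<notin> {..<N} \<longrightarrow> f i = 0)}"
    by (rule finite_set_of_finite_funs) auto
  then have "finite (lookup ` {\<mu> :: monomial. keys \<mu> \<subseteq> {..<N} \<and> (\<forall>i. lookup \<mu> i \<le> M)})"
    by (rule finite_subset[rotated]) (auto simp: in_keys_iff)
  then show ?thesis
    by (rule finite_imageD) (rule inj_onI, simp only: poly_mapping_eq_iff)
qed

lemma lookup_le_wt: "w i \<noteq> 0 \<Longrightarrow> lookup \<mu> i \<le> wt w \<mu>"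
proof (cases "i \<in> keys \<mu>")
  case True
  assume "w i \<noteq> 0"
  then have "lookup \<mu> i \<le> w i * lookup \<mu> i" by simp
  also have "\<dots> \<le> wt w \<mu>" unfolding wt_def using True by (intro member_le_sum) auto
  finally show ?thesis .
qed (simp add: in_keys_iff)

lemma finite_dim_forms: obtains B where "finite B" "forms k d \<subseteq> cpoly.span B"
proof
  let ?B = "{\<mu> :: monomial. keys \<mu> \<subseteq> {..<k} \<and> (\<forall>i. lookup \<mu> i \<le> d)}"
  show "finite (mon ` ?B)" using finite_monomials by simp
  show "forms k d \<subseteq> cpoly.span (mon ` ?B)"
    unfolding span_monomials using lookup_le_wt[of "\<lambda>_. 1"] by (fastforce simp: forms_iff polys_in_def graded_def)
qed

lemma finite_dim_multiforms:
  assumes "k > 0"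
  obtains B where "finite B" "multiforms m k D \<subseteq> cpoly.span B"
proof
  let ?B = "{\<mu> :: monomial. keys \<mu> \<subseteq> {..<m * k} \<and> (\<forall>i. lookup \<mu> i \<le> (\<Sum>i<m. D i))}"
  show "finite (mon ` ?B)" using finite_monomials by simp
  show "multiforms m k D \<subseteq> cpoly.span (mon ` ?B)"
    unfolding span_monomials
  proof (intro subsetI CollectI conjI allI)
    fix f \<mu> i assume f: "f \<in> multiforms m k D" "\<mu> \<in> keys f"
    then have \<mu>: "keys \<mu> \<subseteq> {..<m * k}" by (auto simp: multiforms_iff assms polys_in_def)
    show "lookup \<mu> i \<le> (\<Sum>i<m. D i)"
    proof (cases "i < m * k")
      case True
      then have im: "i div k < m" by (simp add: assms div_less_iff_less_mult)
      have "lookup \<mu> i \<le> wt (\<lambda>v. if v div k = i div k then 1 else 0) \<mu>"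
        by (rule lookup_le_wt) simp
      also have "\<dots> = D (i div k)" using f im by (auto simp: multiforms_iff assms graded_def)
      also have "\<dots> \<le> (\<Sum>i<m. D i)" using im by (intro member_le_sum) auto
      finally show ?thesis .
    next
      case False
      then have "lookup \<mu> i = 0" using \<mu> by (metis in_keys_iff lessThan_iff subsetD)
      then show ?thesis by simp
    qed
  qed (auto simp: multiforms_iff assms polys_in_def)
qed

subsection \<open>Translation invariant polynomials\<close>

text \<open>A multiset of pairs is a directed multigraph, whose directions record signs. A loop
  counts twice at its vertex; its factor in \<open>dprod\<close> is 0.\<close>

definition vdeg :: "(nat \<times> nat) multiset \<Rightarrow> nat \<Rightarrow> nat" where
  "vdeg E i = count (image_mset fst E) i + count (image_mset snd E) i"

definition dprod :: "(nat \<times> nat) multiset \<Rightarrow> cpoly" where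
  "dprod E = (\<Prod>e\<in>#E. Var (fst e) - Var (snd e))"

definition graphs :: "nat \<Rightarrow> (nat \<Rightarrow> nat) \<Rightarrow> nat \<Rightarrow> (nat \<times> nat) multiset set" where
  "graphs m D s = {E. set_mset E \<subseteq> {..<m} \<times> {..<m} \<and> (\<forall>i<m. vdeg E i \<le> D i) \<and> size E = s}"

text \<open>The bounds \<open>D i\<close> may differ because the induction needs this: identifying
  two variables adds their bounds, and dividing by a difference lowers two of them.\<close>

definition tinv :: "nat \<Rightarrow> (nat \<Rightarrow> nat) \<Rightarrow> nat \<Rightarrow> cpoly set" where
  "tinv m D s = {h \<in> polys_in m. (\<forall>i<m. h \<in> graded (\<le>) (\<lambda>v. if v \<in> {i} then 1 else 0) (D i)) \<and>
     h \<in> graded (=) (\<lambda>_. 1) s \<and> (\<forall>x c. eval h (\<lambda>i. x i + c) = eval h x)}"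

lemma vdeg_empty [simp]: "vdeg {#} i = 0"
  by (simp add: vdeg_def)

lemma vdeg_add_mset [simp]:
  "vdeg (add_mset e E) i = (if fst e = i then 1 else 0) + (if snd e = i then 1 else 0) + vdeg E i"
  by (simp add: vdeg_def)

lemma vdeg_union [simp]: "vdeg (E + F) i = vdeg E i + vdeg F i"
  by (simp add: vdeg_def)

lemma dprod_empty [simp]: "dprod {#} = 1"
  and dprod_add_mset [simp]: "dprod (add_mset e E) = (Var (fst e) - Var (snd e)) * dprod E"
  by (simp_all add: dprod_def)

lemma subspace_tinv: "cpoly.subspace (tinv m D s)"
  using subspace_polys_in[of m] subspace_graded
  by (auto simp: tinv_def cpoly.subspace_def)

lemma graded_le_mono: "f \<in> graded (\<le>) w d \<Longrightarrow> d \<le> d' \<Longrightarrow> f \<in> graded (\<le>) w d'"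
  by (force simp: graded_def)

lemma polys_in_diff: "f \<in> polys_in m \<Longrightarrow> g \<in> polys_in m \<Longrightarrow> f - g \<in> polys_in m"
  by (rule cpoly.subspace_diff[OF subspace_polys_in])

lemma dprod_tinv:
  assumes "set_mset E \<subseteq> {..<m} \<times> {..<m}"
  shows "dprod E \<in> tinv m (vdeg E) (size E)"
  using assms
proof (induction E)
  case empty
  show ?case by (simp add: tinv_def graded_1 polys_in_graded)
next
  case (add e E)
  let ?f = "Var (fst e) - Var (snd e)"
  have e: "fst e < m" "snd e < m" using add.prems by auto
  have IH: "dprod E \<in> tinv m (vdeg E) (size E)" using add by auto
  have "?f * dprod E \<in> polys_in m"
    using IH e by (intro polys_in_mult polys_in_diff polys_in_Var) (auto simp: tinv_def)
  moreover have "?f * dprod E \<in> graded (\<le>) (\<lambda>v. if v \<in> {i} then 1 else 0) (vdeg (add_mset e E) i)" if "i < m" for i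
    unfolding vdeg_add_mset
    using IH that by (intro graded_mult graded_diff graded_Var) (auto simp: tinv_def)
  moreover have "?f * dprod E \<in> graded (=) (\<lambda>_. 1) (1 + size E)"
    using IH by (intro graded_mult graded_diff graded_Var) (auto simp: tinv_def)
  moreover have "eval (?f * dprod E) (\<lambda>i. x i + c) = eval (?f * dprod E) x" for x c
    using IH by (auto simp: tinv_def)
  ultimately show ?case by (simp add: tinv_def)
qed

lemma dprod_graphs: "E \<in> graphs m D s \<Longrightarrow> dprod E \<in> tinv m D s"
  using dprod_tinv[of E m] graded_le_mono
  by (fastforce simp: graphs_def tinv_def)

lemma span_dprod_subset: "cpoly.span (dprod ` graphs m D s) \<subseteq> tinv m D s"
  by (intro cpoly.span_minimal subspace_tinv) (auto intro: dprod_graphs)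

section \<open>Division by a difference of two variables\<close>

lemma lookup_Var_mult:
  "lookup (Var i * q) \<mu> = (if lookup \<mu> i = 0 then 0 else lookup q (\<mu> - single i 1))"
proof -
  have eq: "(if single i 1 + \<nu> = \<mu> then lookup q \<nu> else 0)
     = (if lookup \<mu> i = 0 then 0 else if \<nu> = \<mu> - single i 1 then lookup q \<nu> else 0)" for \<nu>
  proof (cases "lookup \<mu> i = 0")
    case True
    then have "single i 1 + \<nu> \<noteq> \<mu>" by (auto simp: lookup_add)
    with True show ?thesis by simp
  next
    case False
    then have "single i 1 + (\<mu> - single i 1) = \<mu>"
      using monomial_minus_single[of i \<mu>] by (simp add: in_keys_iff add.commute)
    then have "single i 1 + \<nu> = \<mu> \<longleftrightarrow> \<nu> = \<mu> - single i 1"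
      by (metis add_diff_cancel_left')
    with False show ?thesis by simp
  qed
  have "Var i * q = (\<Sum>\<nu>\<in>keys q. Cst (lookup q \<nu>) * mon (single i 1 + \<nu>))"
    by (subst (1) cpoly_decomp[of q]) (simp add: sum_distrib_left mon_add mon_single mult_ac)
  then have "lookup (Var i * q) \<mu> = (\<Sum>\<nu>\<in>keys q. if single i 1 + \<nu> = \<mu> then lookup q \<nu> else 0)"
    by (simp add: lookup_sum lookup_mon if_distrib cong: if_cong)
  also have "\<dots> = (if lookup \<mu> i = 0 then 0 else lookup q (\<mu> - single i 1))"
    unfolding eq by (simp add: in_keys_iff)
  finally show ?thesis .
qed

text \<open>At \<open>\<mu> + single a 1\<close> the product has the coefficient of
  \<open>\<mu>\<close> in \<open>q\<close> minus that of the monomial with one \<open>b\<close>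
  replaced by one \<open>a\<close>. If this is 0, the second monomial also occurs in
  \<open>q\<close> and has a smaller exponent of \<open>b\<close>, so the chain stops at exponent 0
  at the latest. The monomial found has larger degree in \<open>a\<close> than \<open>\<mu>\<close>,
  so degree bounds on the product give sharper ones on \<open>q\<close>.\<close>

lemma keys_linear_factor:
  assumes "a \<noteq> b" "\<mu> \<in> keys q"
  shows "\<exists>\<nu>\<in>keys ((Var a - Var b) * q). \<exists>k. \<nu> + single b k = \<mu> + single a (k + 1)"
  using assms(2)
proof (induction "lookup \<mu> b" arbitrary: \<mu>)
  case 0
  have "lookup ((Var a - Var b) * q) (\<mu> + single a 1) = lookup q \<mu>"
    using 0 assms(1) by (simp add: left_diff_distrib lookup_minus lookup_Var_mult lookup_add lookup_single)
  then show ?case using 0 by (intro bexI[of _ "\<mu> + single a 1"] exI[of _ 0]) (auto simp: in_keys_iff)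
next
  case (Suc n)
  define \<mu>' where "\<mu>' = \<mu> - single b 1"
  have \<mu>: "\<mu> = \<mu>' + single b 1"
    unfolding \<mu>'_def using Suc.hyps(2) by (intro monomial_minus_single) (simp add: in_keys_iff)
  have minus: "\<mu> + single a 1 - single b 1 = \<mu>' + single a 1"
    unfolding \<mu> by (metis add.assoc add.commute add_diff_cancel_right')
  have *: "lookup ((Var a - Var b) * q) (\<mu> + single a 1) = lookup q \<mu> - lookup q (\<mu>' + single a 1)"
    using Suc.hyps(2) assms(1) minus
    by (simp add: left_diff_distrib lookup_minus lookup_Var_mult lookup_add lookup_single)
  show ?case
  proof (cases "\<mu> + single a 1 \<in> keys ((Var a - Var b) * q)")
    case True
    then show ?thesis by (intro bexI[of _ "\<mu> + single a 1"] exI[of _ 0]) auto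
  next
    case False
    then have "lookup q \<mu> = lookup q (\<mu>' + single a 1)"
      using * by (simp add: in_keys_iff)
    then have "\<mu>' + single a 1 \<in> keys q" using Suc.prems by (simp add: in_keys_iff)
    moreover have "n = lookup (\<mu>' + single a 1) b"
      using Suc.hyps(2) assms(1) unfolding \<mu> by (simp add: lookup_add lookup_single)
    ultimately obtain \<nu> k where *: "\<nu> \<in> keys ((Var a - Var b) * q)"
      "\<nu> + single b k = \<mu>' + single a 1 + single a (k + 1)"
      using Suc.hyps(1) by blast
    have "\<nu> + single b (k + 1) = \<nu> + single b k + single b 1"
      by (simp only: add.assoc single_add[symmetric])
    also have "\<dots> = \<mu>' + single b 1 + (single a 1 + single a (k + 1))"
      unfolding *(2) by (simp only: ac_simps)
    also have "\<dots> = \<mu> + single a (k + 1 + 1)"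
      unfolding \<mu> single_add[symmetric] by (simp add: add.commute)
    finally show ?thesis using *(1) by blast
  qed
qed

lemma keys_uminus: "keys (- f :: cpoly) = keys f"
  by (auto simp: in_keys_iff)

lemma linear_mult: "Vector_Spaces.linear cscale cscale ((*) p)"
  by unfold_locales (simp_all add: cscale_Cst algebra_simps)

lemma subst_dprod_relabel:
  "subst (\<lambda>i. Var (r i)) (dprod E) = dprod (image_mset (map_prod r r) E)"
  by (induction E) simp_all

section \<open>Contracting and splitting vertices\<close>

definition merge :: "nat \<Rightarrow> nat \<Rightarrow> nat \<Rightarrow> nat" where
  "merge a b i = (if i = b then a else i)"

text \<open>Reverses the contraction of \<open>b\<close> into \<open>a\<close>: edge ends at
  \<open>a\<close> are moved to \<open>b\<close> one at a time, so every division of the degree is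
  possible.\<close>

lemma split_vertex:
  assumes "a \<noteq> b" "vdeg E b = 0" "vdeg E a = p + q"
  shows "\<exists>F. vdeg F a = p \<and> vdeg F b = q \<and> (\<forall>i. i \<noteq> a \<longrightarrow> i \<noteq> b \<longrightarrow> vdeg F i = vdeg E i) \<and>
     image_mset (map_prod (merge a b) (merge a b)) F = E"
  using assms(3)
proof (induction q arbitrary: p)
  case 0
  have "image_mset (map_prod (merge a b) (merge a b)) E = image_mset id E"
  proof (rule image_mset_cong)
    fix e assume "e \<in># E"
    then obtain E' where "E = add_mset e E'" by (metis multi_member_split)
    then have "fst e \<noteq> b" "snd e \<noteq> b" using assms(2) by auto
    then show "map_prod (merge a b) (merge a b) e = id e" by (cases e) (auto simp: merge_def)
  qed
  then show ?case using 0 assms by (intro exI[of _ E]) simp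
next
  case (Suc q)
  have "vdeg E a = Suc p + q" using Suc.prems by simp
  from Suc.IH[OF this] obtain F where F: "vdeg F a = Suc p" "vdeg F b = q"
    "\<forall>i. i \<noteq> a \<longrightarrow> i \<noteq> b \<longrightarrow> vdeg F i = vdeg E i"
    "image_mset (map_prod (merge a b) (merge a b)) F = E"
    by blast
  have "\<exists>e\<in>#F. fst e = a \<or> snd e = a"
  proof (rule ccontr)
    assume "\<not> ?thesis"
    then have "a \<notin># image_mset fst F" "a \<notin># image_mset snd F" by auto
    then have "vdeg F a = 0" unfolding vdeg_def by (metis add_0 not_in_iff)
    with F(1) show False by simp
  qed
  then obtain e F' where e: "F = add_mset e F'" "fst e = a \<or> snd e = a"
    by (metis multi_member_split)
  \<comment> \<open>Only one end moves, also when the edge is a loop at \<open>a\<close>.\<close>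
  define e' where "e' = (if fst e = a then (b, snd e) else (fst e, b))"
  have "vdeg (add_mset e' F') a = p" "vdeg (add_mset e' F') b = Suc q"
    "\<forall>i. i \<noteq> a \<longrightarrow> i \<noteq> b \<longrightarrow> vdeg (add_mset e' F') i = vdeg E i"
    using F(1,2,3) e assms(1) by (auto simp: e'_def split: if_splits)
  moreover have "map_prod (merge a b) (merge a b) e' = map_prod (merge a b) (merge a b) e"
    using e(2) by (cases e) (auto simp: e'_def merge_def)
  then have "image_mset (map_prod (merge a b) (merge a b)) (add_mset e' F') = E"
    using F(4) e(1) by simp
  ultimately show ?case by blast
qed

lemma wt_single_indicator: "wt (\<lambda>v. if v \<in> {i} then 1 else 0) \<mu> = lookup \<mu> i"
  by (simp only: wt_indicator finite.intros) simp

lemma tinv_deg: "h \<in> tinv m D s \<Longrightarrow> \<mu> \<in> keys h \<Longrightarrow> i < m \<Longrightarrow> lookup \<mu> i \<le> D i"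
  unfolding tinv_def graded_def wt_single_indicator by auto

lemma tinv_merge:
  assumes h: "h \<in> tinv (Suc (Suc k)) D s"
  shows "subst (\<lambda>i. Var (merge k (Suc k) i)) h \<in> tinv (Suc k) (D(k := D k + D (Suc k))) s"
    (is "subst ?\<sigma> h \<in> tinv _ ?D s")
proof -
  have "subst ?\<sigma> h \<in> polys_in (Suc k)"
    by (rule polys_in_subst_lessThan[of _ "Suc (Suc k)"])
       (use h in \<open>auto simp: tinv_def merge_def intro!: polys_in_Var\<close>)
  moreover have "subst ?\<sigma> h \<in> graded (\<le>) (\<lambda>v. if v \<in> {i} then 1 else 0) (?D i)" if "i < Suc k" for i
  proof (cases "i = k")
    case True
    show ?thesis
    proof (rule graded_subst[where \<delta> = "\<lambda>v. if v \<in> {k, Suc k} then 1 else 0"])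
      fix v show "?\<sigma> v \<in> graded (\<le>) (\<lambda>v. if v \<in> {i} then 1 else 0) (if v \<in> {k, Suc k} then 1 else 0)"
        by (rule graded_Var) (auto simp: True merge_def)
    next
      fix \<mu> a assume *: "\<mu> \<in> keys h" "a \<le> wt (\<lambda>v. if v \<in> {k, Suc k} then 1 else 0) \<mu>"
      have "lookup \<mu> k \<le> D k" "lookup \<mu> (Suc k) \<le> D (Suc k)" using tinv_deg[OF h *(1)] by auto
      moreover have "wt (\<lambda>v. if v \<in> {k, Suc k} then 1 else 0) \<mu> = lookup \<mu> k + lookup \<mu> (Suc k)"
        by (simp only: wt_indicator finite.intros) simp
      ultimately show "a \<le> ?D i" using * by (simp add: True del: insert_iff)
    qed simp
  next
    case False
    show ?thesis
    proof (rule graded_subst[where \<delta> = "\<lambda>v. if v \<in> {i} then 1 else 0"])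
      fix v show "?\<sigma> v \<in> graded (\<le>) (\<lambda>v. if v \<in> {i} then 1 else 0) (if v \<in> {i} then 1 else 0)"
        by (rule graded_Var) (use False that in \<open>auto simp: merge_def\<close>)
    next
      fix \<mu> a assume *: "\<mu> \<in> keys h" "a \<le> wt (\<lambda>v. if v \<in> {i} then 1 else 0) \<mu>"
      have "lookup \<mu> i \<le> D i" using tinv_deg[OF h *(1)] that by auto
      with * False show "a \<le> ?D i" by (simp only: wt_single_indicator) simp
    qed simp
  qed
  moreover have "subst ?\<sigma> h \<in> graded (=) (\<lambda>_. 1) s"
    by (rule graded_subst[where \<delta> = "\<lambda>_. 1"], simp, rule graded_Var, simp) (use h in \<open>auto simp: tinv_def graded_def\<close>)
  moreover have "eval (subst ?\<sigma> h) (\<lambda>i. x i + c) = eval (subst ?\<sigma> h) x" for x c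
    using h by (simp add: tinv_def)
  ultimately show ?thesis by (simp add: tinv_def)
qed

text \<open>\<open>keys_linear_factor\<close> is used for the product and for its negative with
  \<open>a\<close> and \<open>b\<close> exchanged, so the bounds of both variables drop by one. A
  monomial of \<open>q\<close> shows that \<open>D a\<close>, \<open>D b\<close> and
  \<open>s\<close> are positive, which makes the natural number subtractions exact. Translation
  invariance follows by cancelling the invariant factor
  \<open>u\<^sub>a - u\<^sub>b\<close>.\<close>

lemma tinv_quotient:
  assumes g: "(Var a - Var b) * q \<in> tinv m D s" and ab: "a \<noteq> b" "a < m" "b < m" and q: "q \<noteq> 0"
  shows "D a > 0" "D b > 0" "s > 0" "q \<in> tinv m (\<lambda>i. D i - (if i = a then 1 else 0) - (if i = b then 1 else 0)) (s - 1)"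
proof -
  let ?g = "(Var a - Var b) * q"
  have low: "lookup \<mu> i + (if i = a then 1 else 0) + (if i = b then 1 else 0) \<le> D i"
    if "i < m" and \<mu>: "\<mu> \<in> keys q" for i \<mu>
  proof -
    obtain \<nu> k where \<nu>: "\<nu> \<in> keys ?g" "\<nu> + single b k = \<mu> + single a (k + 1)"
      using keys_linear_factor[OF ab(1) \<mu>] by blast
    have "(Var b - Var a) * q = - ?g" by (simp add: algebra_simps)
    then obtain \<nu>' k' where \<nu>': "\<nu>' \<in> keys ?g" "\<nu>' + single a k' = \<mu> + single b (k' + 1)"
      using keys_linear_factor[OF ab(1)[symmetric] \<mu>] by (metis keys_uminus)
    have "lookup \<nu> i + lookup (single b k) i = lookup \<mu> i + lookup (single a (k + 1)) i"
      "lookup \<nu>' i + lookup (single a k') i = lookup \<mu> i + lookup (single b (k' + 1)) i"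
      using \<nu>(2) \<nu>'(2) by (metis lookup_add)+
    then show ?thesis
      using tinv_deg[OF g \<nu>(1) \<open>i < m\<close>] tinv_deg[OF g \<nu>'(1) \<open>i < m\<close>] ab(1)
      by (auto simp: lookup_single when_def split: if_splits)
  qed
  have tot: "wt (\<lambda>_. 1) \<mu> + 1 = s" if \<mu>: "\<mu> \<in> keys q" for \<mu>
  proof -
    obtain \<nu> k where \<nu>: "\<nu> \<in> keys ?g" "\<nu> + single b k = \<mu> + single a (k + 1)"
      using keys_linear_factor[OF ab(1) \<mu>] by blast
    have "wt (\<lambda>_. 1) \<nu> = s" using g \<nu>(1) by (auto simp: tinv_def graded_def)
    moreover have "wt (\<lambda>_. 1) \<nu> + k = wt (\<lambda>_. 1) \<mu> + (k + 1)"
      using arg_cong[OF \<nu>(2), of "wt (\<lambda>_. 1)"] by simp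
    ultimately show ?thesis by simp
  qed
  have var: "keys \<mu> \<subseteq> {..<m}" if \<mu>: "\<mu> \<in> keys q" for \<mu>
  proof
    fix i assume i: "i \<in> keys \<mu>"
    obtain \<nu> k where \<nu>: "\<nu> \<in> keys ?g" "\<nu> + single b k = \<mu> + single a (k + 1)"
      using keys_linear_factor[OF ab(1) \<mu>] by blast
    have "lookup \<nu> i + lookup (single b k) i = lookup \<mu> i + lookup (single a (k + 1)) i"
      using \<nu>(2) by (metis lookup_add)
    then have "i = b \<or> i \<in> keys \<nu>"
      using i by (auto simp: in_keys_iff lookup_single when_def split: if_splits)
    then show "i \<in> {..<m}" using g \<nu>(1) ab(3) by (auto simp: tinv_def polys_in_def)
  qed
  obtain \<mu>0 where \<mu>0: "\<mu>0 \<in> keys q" using q by (metis all_not_in_conv poly_mapping_eqI in_keys_iff lookup_zero)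
  show "D a > 0" "D b > 0" "s > 0"
    using low[OF ab(2) \<mu>0] low[OF ab(3) \<mu>0] tot[OF \<mu>0] by auto
  have "eval q (\<lambda>i. x i + c) = eval q x" for x c
  proof -
    let ?t = "subst (\<lambda>i. Var i + Cst c)"
    have "?t ?g = ?g"
    proof (rule eval_eqI)
      fix x
      have "eval ?g (\<lambda>i. x i + c) = eval ?g x" using g unfolding tinv_def by blast
      then show "eval (?t ?g) x = eval ?g x" by (simp only: eval_subst eval_add eval_Var eval_Cst)
    qed
    then have "(Var a - Var b) * ?t q = (Var a - Var b) * q" by simp
    moreover have "Var a - Var b \<noteq> 0"
    proof
      assume "Var a - Var b = 0"
      then have "eval (Var a - Var b) (\<lambda>i. if i = a then 1 else 0) = 0" by simp
      then show False using ab(1) by simp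
    qed
    ultimately have "?t q = q" by simp
    then have "eval (?t q) x = eval q x" by simp
    then show ?thesis by simp
  qed
  moreover have "q \<in> polys_in m" using var by (auto simp: polys_in_def)
  moreover have "q \<in> graded (=) (\<lambda>_. 1) (s - 1)" using tot by (force simp: graded_def)
  moreover have "q \<in> graded (\<le>) (\<lambda>v. if v \<in> {i} then 1 else 0)
      (D i - (if i = a then 1 else 0) - (if i = b then 1 else 0))" if "i < m" for i
    unfolding graded_def wt_single_indicator using low[OF that] by fastforce
  ultimately show "q \<in> tinv m (\<lambda>i. D i - (if i = a then 1 else 0) - (if i = b then 1 else 0)) (s - 1)"
    unfolding tinv_def by blast
qed

text \<open>Translating by minus the value of the only variable leaves a constant, a multiple of the
  product over the empty graph.\<close>

lemma tinv_le_1: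
  assumes h: "h \<in> tinv m D s" and "m \<le> 1"
  shows "h \<in> cpoly.span (dprod ` graphs m D s)"
proof -
  have "h = Cst (eval h (\<lambda>_. 0))"
  proof (rule eval_eqI)
    fix x
    have *: "\<forall>x c. eval h (\<lambda>i. x i + c) = eval h x" using h unfolding tinv_def by blast
    have "eval h x = eval h (\<lambda>i. x i + (- x 0))" by (rule *[rule_format, symmetric])
    also have "\<dots> = eval h (\<lambda>_. 0)"
    proof (rule eval_cong_polys_in)
      show "h \<in> polys_in m" using h by (simp add: tinv_def)
      fix i assume "i < m"
      with assms(2) have "i = 0" by simp
      then show "x i + - x 0 = 0" by simp
    qed
    finally show "eval h x = eval (Cst (eval h (\<lambda>_. 0))) x" by simp
  qed
  then obtain c where c: "h = Cst c" by blast
  show ?thesis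
  proof (cases "c = 0")
    case False
    then have "s = 0" using h by (auto simp: c tinv_def graded_def Cst_def)
    then have "{#} \<in> graphs m D s" by (simp add: graphs_def)
    then have "cscale c (dprod {#}) \<in> cpoly.span (dprod ` graphs m D s)"
      by (intro cpoly.span_scale cpoly.span_base) blast
    then show ?thesis by (simp add: c cscale_Cst)
  qed (simp add: c cpoly.span_zero)
qed

theorem tinv_subset_span: "tinv m D s \<subseteq> cpoly.span (dprod ` graphs m D s)"
proof -
  have "h \<in> cpoly.span (dprod ` graphs m D s)" if "h \<in> tinv m D s" for h
    using that
  proof (induction m arbitrary: D s h)
    case 0
    then show ?case by (intro tinv_le_1) auto
  next
    case (Suc n)
    note outer = Suc.IH
    show ?case
    proof (cases n)
      case 0
      then show ?thesis using Suc.prems by (intro tinv_le_1) auto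
    next
      case (Suc k)
      let ?r = "merge k (Suc k)"
      let ?\<sigma> = "\<lambda>i. Var (?r i)"
      show ?thesis using Suc.prems
      proof (induction s arbitrary: D h rule: less_induct)
        case (less s)
        let ?m = "Suc n"
        let ?D = "D(k := D k + D (Suc k))"
        let ?S = "cpoly.span (dprod ` graphs ?m D s)"
        have "subst ?\<sigma> h \<in> cpoly.span (dprod ` graphs n ?D s)"
          by (rule outer) (use tinv_merge[of h k D s] less.prems Suc in blast)
        moreover have "cpoly.span (dprod ` graphs n ?D s) \<subseteq> subst ?\<sigma> ` ?S"
          unfolding linear_span_image[OF linear_subst]
        proof (rule cpoly.span_mono, rule subsetI)
          fix f assume "f \<in> dprod ` graphs n ?D s"
          then obtain E where E: "f = dprod E" "E \<in> graphs n ?D s" by blast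
          have "vdeg E (Suc k) = 0"
          proof -
            have "Suc k \<notin># image_mset fst E" "Suc k \<notin># image_mset snd E"
              using E(2) Suc by (auto simp: graphs_def)
            then show ?thesis unfolding vdeg_def by (metis add_0 not_in_iff)
          qed
          moreover have le: "vdeg E k \<le> D k + D (Suc k)" using E(2) Suc by (auto simp: graphs_def)
          \<comment> \<open>As many ends as allowed go to \<open>Suc k\<close>; the bound on the sum
            then leaves at most \<open>D k\<close> of them at \<open>k\<close>.\<close>
          moreover define q where "q = min (vdeg E k) (D (Suc k))"
          ultimately obtain F where F: "vdeg F k = vdeg E k - q" "vdeg F (Suc k) = q"
            "\<forall>i. i \<noteq> k \<longrightarrow> i \<noteq> Suc k \<longrightarrow> vdeg F i = vdeg E i" "image_mset (map_prod ?r ?r) F = E"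
            using split_vertex[of k "Suc k" E "vdeg E k - q" q] by auto
          have "set_mset F \<subseteq> {..<?m} \<times> {..<?m}"
          proof
            fix e assume "e \<in># F"
            then have "map_prod ?r ?r e \<in># E" using F(4) by auto
            then have "map_prod ?r ?r e \<in> {..<n} \<times> {..<n}" using E(2) by (auto simp: graphs_def)
            then show "e \<in> {..<?m} \<times> {..<?m}" using Suc by (cases e) (auto simp: merge_def split: if_splits)
          qed
          moreover have "vdeg F i \<le> D i" if "i < ?m" for i
          proof -
            consider "i = k" | "i = Suc k" | "i \<noteq> k" "i \<noteq> Suc k" by blast
            then show ?thesis
            proof cases
              case 3
              then have "i < n" using that Suc by simp
              then have "vdeg E i \<le> ?D i" using E(2) unfolding graphs_def by blast
              then show ?thesis using F(3) 3 by simp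
            qed (use F(1,2) le in \<open>auto simp: q_def\<close>)
          qed
          moreover have "size F = s" using F(4) E(2) by (auto simp: graphs_def)
          ultimately have "F \<in> graphs ?m D s" by (simp add: graphs_def)
          moreover have "subst ?\<sigma> (dprod F) = f" unfolding subst_dprod_relabel F(4) E(1) ..
          ultimately show "f \<in> subst ?\<sigma> ` dprod ` graphs ?m D s" by blast
        qed
        \<comment> \<open>\<open>h0\<close> lifts the restriction of \<open>h\<close> to the
          diagonal, so \<open>h - h0\<close> vanishes there and is divisible by the difference of
          the two variables.\<close>
        ultimately obtain h0 where h0: "h0 \<in> ?S" "subst ?\<sigma> h = subst ?\<sigma> h0" by blast
        define g where "g = h - h0"
        have g: "g \<in> tinv ?m D s"
          unfolding g_def using less.prems h0 span_dprod_subset subspace_tinv cpoly.subspace_diff by blast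
        have "Var (Suc k) - Var k dvd subst Var g - subst ?\<sigma> g"
          by (rule dvd_subst_diff) (simp add: merge_def)
        moreover have "subst ?\<sigma> g = 0" using h0 by (simp add: g_def)
        ultimately obtain q where "g = (Var (Suc k) - Var k) * q" by (auto simp: dvd_def)
        then have gq: "g = (Var k - Var (Suc k)) * (- q)" by (simp add: algebra_simps)
        have "g \<in> ?S"
        proof (cases "q = 0")
          case True
          then show ?thesis by (simp add: gq cpoly.span_zero)
        next
          case False
          let ?D' = "\<lambda>i. D i - (if i = k then 1 else 0) - (if i = Suc k then 1 else 0)"
          have Q: "D k > 0" "D (Suc k) > 0" "s > 0" "- q \<in> tinv ?m ?D' (s - 1)"
            using tinv_quotient[of k "Suc k" "- q" ?m D s] g[unfolded gq] False Suc by auto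
          then have "- q \<in> cpoly.span (dprod ` graphs ?m ?D' (s - 1))" using less.IH by simp
          then have "g \<in> (*) (Var k - Var (Suc k)) ` cpoly.span (dprod ` graphs ?m ?D' (s - 1))"
            unfolding gq by blast
          also have "\<dots> = cpoly.span ((*) (Var k - Var (Suc k)) ` dprod ` graphs ?m ?D' (s - 1))"
            by (rule linear_span_image[OF linear_mult])
          also have "\<dots> \<subseteq> ?S"
          proof (rule cpoly.span_mono, safe)
            fix E assume E: "E \<in> graphs ?m ?D' (s - 1)"
            have "add_mset (k, Suc k) E \<in> graphs ?m D s"
            proof -
              have "vdeg (add_mset (k, Suc k) E) i \<le> D i" if "i < ?m" for i
              proof -
                have "vdeg E i \<le> ?D' i" using E that by (simp add: graphs_def)
                then show ?thesis using Q(1,2) by (auto split: if_splits)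
              qed
              then show ?thesis using E Q(3) Suc by (auto simp: graphs_def)
            qed
            then show "(Var k - Var (Suc k)) * dprod E \<in> dprod ` graphs ?m D s"
              by (metis (no_types) dprod_add_mset fst_conv image_eqI snd_conv)
          qed
          finally show ?thesis .
        qed
        then have "g + h0 \<in> ?S" using h0(1) by (rule cpoly.span_add)
        then show ?case by (simp add: g_def)
      qed
    qed
  qed
  then show ?thesis by blast
qed

lemma tinv_eq_span: "tinv m D s = cpoly.span (dprod ` graphs m D s)"
  using tinv_subset_span span_dprod_subset by (rule subset_antisym)

subsection \<open>The dimension of the space of translation invariant polynomials\<close>

definition box_monomials :: "nat \<Rightarrow> nat \<Rightarrow> nat \<Rightarrow> monomial set" where
  "box_monomials m t s = {\<mu>. keys \<mu> \<subseteq> {..<m} \<and> (\<forall>i. lookup \<mu> i \<le> t) \<and> wt (\<lambda>_. 1) \<mu> = s}"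

definition box_polys :: "nat \<Rightarrow> nat \<Rightarrow> nat \<Rightarrow> cpoly set" where
  "box_polys m t s = {h. keys h \<subseteq> box_monomials m t s}"

definition lower :: "nat \<Rightarrow> cpoly \<Rightarrow> cpoly" where
  "lower m h = (\<Sum>i<m. partial_deriv i h)"

text \<open>Polynomials of degree at most \<open>t\<close> in one variable form the irreducible
  \<open>sl\<^sub>2\<close>-module of dimension \<open>t + 1\<close>, with raising operator
  \<open>t u - u\<^sup>2 d/du\<close>; this is the action on the \<open>m\<close>-fold tensor power.
  In one variable \<open>u ^ k\<close> goes to \<open>(t - k) u ^ (k + 1)\<close>, so the bound
  \<open>t\<close> survives.\<close>

definition raise :: "nat \<Rightarrow> nat \<Rightarrow> cpoly \<Rightarrow> cpoly" where
  "raise m t h = (\<Sum>i<m. of_nat t * (Var i * h) - Var i * (Var i * partial_deriv i h))"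

lemma finite_box_monomials [simp]: "finite (box_monomials m t s)"
  by (rule finite_subset[OF _ finite_monomials[of m t]]) (auto simp: box_monomials_def)

lemma box_span: "box_polys m t s = cpoly.span (mon ` box_monomials m t s)"
  by (simp add: box_polys_def span_monomials)

lemma subspace_box: "cpoly.subspace (box_polys m t s)"
  by (simp add: box_span)

lemma dim_box: "cpoly.dim (box_polys m t s) = card (box_monomials m t s)"
  by (simp add: box_polys_def dim_keys_subset)

lemma boxI:
  assumes "\<And>\<mu>. lookup h \<mu> \<noteq> 0 \<Longrightarrow> \<mu> \<in> box_monomials m t s"
  shows "h \<in> box_polys m t s"
  using assms by (auto simp: box_polys_def in_keys_iff)

lemma boxD: "h \<in> box_polys m t s \<Longrightarrow> lookup h \<mu> \<noteq> 0 \<Longrightarrow> \<mu> \<in> box_monomials m t s"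
  by (auto simp: box_polys_def in_keys_iff)

lemma linear_lower: "Vector_Spaces.linear cscale cscale (lower m)"
  by unfold_locales (simp_all add: lower_def sum.distrib cscale_Cst sum_distrib_left)

lemma raise_Cst_mult: "raise m t (Cst c * f) = Cst c * raise m t f"
  by (simp add: raise_def sum.distrib[symmetric] sum_distrib_left algebra_simps)

lemma lower_add: "lower m (f + g) = lower m f + lower m g"
  and lower_Cst_mult: "lower m (Cst c * f) = Cst c * lower m f"
  by (simp_all add: lower_def sum.distrib[symmetric] sum_distrib_left algebra_simps)

lemma lower_diff: "lower m (f - g) = lower m f - lower m g"
  using lower_add[of m "f - g" g] by simp

lemma lower_box:
  assumes "h \<in> box_polys m t (Suc s)"
  shows "lower m h \<in> box_polys m t s"
  unfolding lower_def
proof (intro cpoly.subspace_sum[OF subspace_box] boxI)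
  fix i \<mu> assume "lookup (partial_deriv i h) \<mu> \<noteq> 0"
  then have "\<mu> + single i 1 \<in> box_monomials m t (Suc s)"
    using assms by (intro boxD[OF assms]) (auto simp: lookup_partial_deriv)
  then show "\<mu> \<in> box_monomials m t s"
    by (auto simp: box_monomials_def in_keys_iff lookup_add subset_iff) (meson le_trans le_add1)
qed

lemma lower_box_0:
  assumes "h \<in> box_polys m t 0"
  shows "lower m h = 0"
  unfolding lower_def
proof (rule sum.neutral, intro ballI poly_mapping_eqI)
  fix i \<mu>
  have "\<mu> + single i 1 \<notin> box_monomials m t 0" by (simp add: box_monomials_def)
  then show "lookup (partial_deriv i h) \<mu> = lookup 0 \<mu>"
    using boxD[OF assms] by (auto simp: lookup_partial_deriv)
qed

lemma lookup_Var_mult_partial_deriv: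
  "lookup (Var i * partial_deriv i h) \<mu> = of_nat (lookup \<mu> i) * lookup h \<mu>"
proof (cases "lookup \<mu> i = 0")
  case False
  then have "\<mu> - single i 1 + single i 1 = \<mu>"
    using monomial_minus_single[of i \<mu>] by (simp add: in_keys_iff)
  moreover have "lookup (\<mu> - single i 1) i + 1 = lookup \<mu> i"
    using False by (simp add: lookup_minus)
  ultimately show ?thesis
    using False unfolding lookup_Var_mult lookup_partial_deriv by (simp del: One_nat_def)
qed (simp add: lookup_Var_mult)

lemma raise_box:
  assumes "h \<in> box_polys m t s"
  shows "raise m t h \<in> box_polys m t (Suc s)"
  unfolding raise_def
proof (intro cpoly.subspace_sum[OF subspace_box] boxI)
  fix i \<mu> assume i: "i \<in> {..<m}"
    and *: "lookup (of_nat t * (Var i * h) - Var i * (Var i * partial_deriv i h)) \<mu> \<noteq> 0"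
  have "lookup (Cst (of_nat t) * (Var i * h) - Var i * (Var i * partial_deriv i h)) \<mu>
     = (if lookup \<mu> i = 0 then 0 else
         (of_nat t - of_nat (lookup (\<mu> - single i 1) i)) * lookup h (\<mu> - single i 1))"
    unfolding lookup_minus lookup_Cst_mult lookup_Var_mult[of i h] lookup_Var_mult[of i "Var i * _"]
      lookup_Var_mult_partial_deriv
    by (simp add: left_diff_distrib)
  with * have nz: "lookup \<mu> i \<noteq> 0" "lookup (\<mu> - single i 1) i \<noteq> t" "lookup h (\<mu> - single i 1) \<noteq> 0"
    by (auto split: if_splits)
  define \<nu> where "\<nu> = \<mu> - single i 1"
  have \<mu>: "\<mu> = \<nu> + single i 1"
    unfolding \<nu>_def using nz(1) by (intro monomial_minus_single) (simp add: in_keys_iff)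
  have "\<nu> \<in> box_monomials m t s" "lookup \<nu> i \<noteq> t"
    using nz boxD[OF assms] by (auto simp: \<nu>_def)
  moreover from this have "lookup \<nu> i < t" by (auto simp: box_monomials_def less_le)
  ultimately show "\<mu> \<in> box_monomials m t (Suc s)"
    using i Poly_Mapping.keys_add[of \<nu> "single i 1"] unfolding \<mu>
    by (auto simp: box_monomials_def lookup_add lookup_single when_def split: if_splits)
qed

lemma euler:
  assumes "h \<in> box_polys m t s"
  shows "(\<Sum>i<m. Var i * partial_deriv i h) = of_nat s * h"
proof (rule poly_mapping_eqI)
  fix \<mu>
  have "lookup (\<Sum>i<m. Var i * partial_deriv i h) \<mu> = of_nat (\<Sum>i<m. lookup \<mu> i) * lookup h \<mu>"
    by (simp add: lookup_sum lookup_Var_mult_partial_deriv sum_distrib_right)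
  also have "\<dots> = of_nat s * lookup h \<mu>"
  proof (cases "lookup h \<mu> = 0")
    case False
    then have "\<mu> \<in> box_monomials m t s" using boxD[OF assms] by blast
    then have "(\<Sum>i<m. lookup \<mu> i) = s"
      using wt_superset[of "{..<m}" \<mu> "\<lambda>_. 1"] by (simp add: box_monomials_def)
    then show ?thesis by simp
  qed simp
  also have "\<dots> = lookup (Cst (of_nat s) * h) \<mu>" by (simp only: lookup_Cst_mult)
  finally show "lookup (\<Sum>i<m. Var i * partial_deriv i h) \<mu> = lookup (of_nat s * h) \<mu>" by simp
qed

lemma partial_deriv_of_nat [simp]: "partial_deriv i (of_nat n) = 0"
  using partial_deriv_Cst[of i "of_nat n"] by simp

text \<open>The commutator is the weight \<open>m t - 2 s\<close>. Only the terms with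
  \<open>j = i\<close> contribute; each gives \<open>t - 2 u\<^sub>i \<partial>\<^sub>i\<close>, and
  Euler's identity evaluates their sum. The bound on \<open>s\<close> makes the natural number
  subtraction exact.\<close>

lemma lower_raise:
  assumes "h \<in> box_polys m t s" "2 * s \<le> m * t"
  shows "lower m (raise m t h) = raise m t (lower m h) + of_nat (m * t - 2 * s) * h"
proof -
  have D: "partial_deriv j (of_nat t * (Var i * h) - Var i * (Var i * partial_deriv i h)) =
      (of_nat t * (Var i * partial_deriv j h) - Var i * (Var i * partial_deriv i (partial_deriv j h)))
      + (if j = i then of_nat t * h - 2 * (Var i * partial_deriv i h) else 0)" for i j
    by (cases "j = i") (simp_all add: partial_deriv_commute[of j i] algebra_simps)
  have "lower m (raise m t h) = (\<Sum>i<m. \<Sum>j<m. partial_deriv j (of_nat t * (Var i * h) - Var i * (Var i * partial_deriv i h)))"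
    unfolding lower_def raise_def partial_deriv_sum by (rule sum.swap)
  also have "\<dots> = (\<Sum>i<m. (\<Sum>j<m. of_nat t * (Var i * partial_deriv j h) - Var i * (Var i * partial_deriv i (partial_deriv j h)))
      + (of_nat t * h - 2 * (Var i * partial_deriv i h)))"
    by (intro sum.cong refl) (simp only: D sum.distrib, simp)
  also have "\<dots> = raise m t (lower m h) + (of_nat m * of_nat t * h - 2 * (\<Sum>i<m. Var i * partial_deriv i h))"
    by (simp add: sum.distrib raise_def lower_def sum_subtractf sum_distrib_left partial_deriv_sum mult.assoc)
  also have "\<dots> = raise m t (lower m h) + (of_nat (m * t) - of_nat (2 * s)) * h"
    by (simp add: euler[OF assms(1)] algebra_simps)
  finally show ?thesis using assms(2) by (simp add: of_nat_diff)
qed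

text \<open>The pair \<open>lower\<close>, \<open>raise\<close> spans a copy of \<open>sl\<^sub>2\<close>; the induction trades surjectivity of
  \<open>lower \<circ> raise + c\<close> in degree \<open>s\<close> for surjectivity with a larger shift in degree \<open>s - 1\<close>.\<close>

lemma lower_raise_shift_surj:
  assumes "v \<in> box_polys m t s" "2 * s < m * t"
  shows "\<exists>w\<in>box_polys m t s. lower m (raise m t w) + of_nat c * w = v"
  using assms
proof (induction s arbitrary: v c)
  case (0 v)
  let ?l = "m * t + c"
  let ?w = "Cst (1 / of_nat ?l) * v"
  have w: "?w \<in> box_polys m t 0"
    using 0 subspace_box cpoly.subspace_scale by (metis cscale_Cst)
  have "lower m (raise m t ?w) + of_nat c * ?w = (of_nat (m * t) + of_nat c) * ?w"
    using lower_raise[OF w] lower_box_0[OF w] by (simp add: raise_def algebra_simps)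
  also have "\<dots> = Cst (of_nat ?l * (1 / of_nat ?l)) * v"
    by (simp only: Cst_mult of_nat_add Cst_add Cst_of_nat mult.assoc)
  also have "\<dots> = v" using 0 by (simp del: of_nat_add of_nat_mult)
  finally show ?case using w by blast
next
  case (Suc s)
  define l where "l = m * t - 2 * Suc s + c"
  have l: "l > 0" using Suc.prems(2) by (simp add: l_def)
  have "lower m v \<in> box_polys m t s" using Suc.prems(1) by (rule lower_box)
  then obtain w' where w': "w' \<in> box_polys m t s" "lower m (raise m t w') + of_nat l * w' = lower m v"
    using Suc.IH[of "lower m v" l] Suc.prems(2) by auto
  let ?u = "v - raise m t w'"
  let ?w = "Cst (1 / of_nat l) * ?u"
  have "?u \<in> box_polys m t (Suc s)"
    using Suc.prems(1) raise_box[OF w'(1)] subspace_box cpoly.subspace_diff by blast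
  then have w: "?w \<in> box_polys m t (Suc s)"
    using subspace_box cpoly.subspace_scale by (metis cscale_Cst)
  have "lower m (raise m t ?w) + of_nat c * ?w = raise m t (lower m ?w) + of_nat l * ?w"
    using lower_raise[OF w] Suc.prems(2) by (simp add: l_def algebra_simps)
  also have "\<dots> = Cst (1 / of_nat l) * (raise m t (lower m ?u) + of_nat l * ?u)"
    by (simp only: lower_Cst_mult raise_Cst_mult distrib_left mult.left_commute)
  also have "lower m ?u = of_nat l * w'"
    using w'(2) by (simp add: lower_diff algebra_simps)
  also have "raise m t (of_nat l * w') + of_nat l * ?u = of_nat l * v"
    using raise_Cst_mult[of m t "of_nat l" w'] by (simp add: algebra_simps)
  also have "Cst (1 / of_nat l) * (of_nat l * v) = Cst (1 / of_nat l * of_nat l) * v"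
    unfolding Cst_mult by (simp add: mult.assoc)
  also have "\<dots> = v" using l by simp
  finally show ?case using w by blast
qed

text \<open>A preimage of \<open>v\<close> is \<open>raise m t w\<close>, with \<open>w\<close> from
  the shift lemma for shift 0.\<close>

lemma lower_image_box:
  assumes "2 * s < m * t"
  shows "lower m ` box_polys m t (Suc s) = box_polys m t s"
proof
  show "lower m ` box_polys m t (Suc s) \<subseteq> box_polys m t s" using lower_box by blast
  show "box_polys m t s \<subseteq> lower m ` box_polys m t (Suc s)"
  proof
    fix v assume "v \<in> box_polys m t s"
    then obtain w where "w \<in> box_polys m t s" "lower m (raise m t w) = v"
      using lower_raise_shift_surj[of v m t s 0] assms by auto
    then show "v \<in> lower m ` box_polys m t (Suc s)" using raise_box by blast
  qed
qed

lemma has_field_derivative_translate: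
  assumes "h \<in> polys_in m"
  shows "((\<lambda>c. eval h (\<lambda>i. x i + c)) has_field_derivative eval (lower m h) (\<lambda>i. x i + c)) (at c)"
proof -
  let ?y = "\<lambda>i. if i < m then 1 else 0"
  have E: "eval f (\<lambda>i. x i + c * ?y i) = eval f (\<lambda>i. x i + c)" if "f \<in> polys_in m" for f c
    by (rule eval_cong_polys_in[OF that]) simp
  have P: "partial_deriv i h \<in> polys_in m" for i
    unfolding polys_in_def
  proof (intro CollectI ballI)
    fix \<mu> assume "\<mu> \<in> keys (partial_deriv i h)"
    then have "\<mu> + single i 1 \<in> keys h" by (auto simp: in_keys_iff lookup_partial_deriv)
    then have "keys (\<mu> + single i 1) \<subseteq> {..<m}" using assms by (auto simp: polys_in_def)
    moreover have "keys \<mu> \<subseteq> keys (\<mu> + single i 1)" by (auto simp: in_keys_iff lookup_add)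
    ultimately show "keys \<mu> \<subseteq> {..<m}" by blast
  qed
  have "(\<Sum>i<m. ?y i * eval (partial_deriv i h) (\<lambda>i. x i + c * ?y i)) = eval (lower m h) (\<lambda>i. x i + c)"
    unfolding lower_def eval_sum by (intro sum.cong refl) (simp only: E[OF P], simp)
  with has_field_derivative_eval_line[of "{..<m}" ?y h x c] show ?thesis
    by (simp only: E[OF assms]) simp
qed

text \<open>\<open>lower\<close> is the derivative in the direction \<open>(1, ..., 1)\<close>, and
  a function of one complex variable with zero derivative is constant.\<close>

lemma tinv_eq_kernel: "tinv m (\<lambda>_. t) s = {h \<in> box_polys m t s. lower m h = 0}"
proof (rule Set.set_eqI, rule iffI)
  fix h assume h: "h \<in> tinv m (\<lambda>_. t) s"
  then have hp: "h \<in> polys_in m" by (simp add: tinv_def)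
  have "h \<in> box_polys m t s"
  proof (rule boxI)
    fix \<mu> assume "lookup h \<mu> \<noteq> 0"
    then have \<mu>: "\<mu> \<in> keys h" by (simp add: in_keys_iff)
    then have k: "keys \<mu> \<subseteq> {..<m}" "wt (\<lambda>_. 1) \<mu> = s" using h by (auto simp: tinv_def polys_in_def graded_def)
    moreover have "lookup \<mu> i \<le> t" for i
    proof (cases "i < m")
      case False
      then have "lookup \<mu> i = 0" using k(1) by (metis in_keys_iff lessThan_iff subsetD)
      then show ?thesis by simp
    qed (use tinv_deg[OF h \<mu>] in blast)
    ultimately show "\<mu> \<in> box_monomials m t s" by (simp add: box_monomials_def)
  qed
  moreover have "eval (lower m h) x = 0" for x
  proof -
    have "(\<lambda>c. eval h (\<lambda>i. x i + c)) = (\<lambda>_. eval h x)" using h by (auto simp: tinv_def)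
    then have "((\<lambda>c. eval h (\<lambda>i. x i + c)) has_field_derivative 0) (at 0)" by simp
    from DERIV_unique[OF has_field_derivative_translate[OF hp] this] show ?thesis by simp
  qed
  ultimately show "h \<in> {h \<in> box_polys m t s. lower m h = 0}" using eval_eq_0_imp by blast
next
  fix h assume "h \<in> {h \<in> box_polys m t s. lower m h = 0}"
  then have h: "h \<in> box_polys m t s" "lower m h = 0" by auto
  then have \<mu>: "keys \<mu> \<subseteq> {..<m} \<and> (\<forall>i. lookup \<mu> i \<le> t) \<and> wt (\<lambda>_. 1) \<mu> = s" if "\<mu> \<in> keys h" for \<mu>
    using that by (auto simp: box_polys_def box_monomials_def)
  then have hp: "h \<in> polys_in m" by (auto simp: polys_in_def)
  have "eval h (\<lambda>i. x i + c) = eval h x" for x c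
  proof -
    have "((\<lambda>c. eval h (\<lambda>i. x i + c)) has_field_derivative 0) (at c within UNIV)" for c
      using has_field_derivative_translate[OF hp, of x c] h(2) by simp
    then obtain d where "\<And>c. eval h (\<lambda>i. x i + c) = d"
      using has_field_derivative_zero_constant[of UNIV "\<lambda>c. eval h (\<lambda>i. x i + c)"] by auto
    from this[of c] this[of 0] show ?thesis by simp
  qed
  moreover have "h \<in> graded (\<le>) (\<lambda>v. if v \<in> {i} then 1 else 0) t" for i
    unfolding graded_def wt_single_indicator using \<mu> by blast
  moreover have "h \<in> graded (=) (\<lambda>_. 1) s" using \<mu> by (auto simp: graded_def)
  ultimately show "h \<in> tinv m (\<lambda>_. t) s" using hp by (simp add: tinv_def)
qed

lemma dim_tinv:
  assumes "2 * s < m * t"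
  shows "cpoly.dim (tinv m (\<lambda>_. t) (Suc s)) + card (box_monomials m t s) = card (box_monomials m t (Suc s))"
  using rank_nullity[OF subspace_box _ _ linear_lower, of "mon ` box_monomials m t (Suc s)" m t "Suc s" m]
  by (simp add: lower_image_box[OF assms] dim_box tinv_eq_kernel box_span[symmetric] add.commute)

section \<open>Counting monomials in a box by generating functions\<close>

lemma card_box_monomials_0: "card (box_monomials 0 t s) = (if s = 0 then 1 else 0)"
proof -
  have "box_monomials 0 t s = (if s = 0 then {0} else {})"
    by (auto simp: box_monomials_def)
  then show ?thesis by simp
qed

lemma card_box_monomials_Suc:
  "card (box_monomials (Suc m) t s) = (\<Sum>k\<le>t. if k \<le> s then card (box_monomials m t (s - k)) else 0)"
proof -
  let ?A = "\<lambda>k. (\<lambda>\<mu>. \<mu> + single m k) ` box_monomials m t (s - k)"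
  have last0: "lookup \<mu> m = 0" if "\<mu> \<in> box_monomials m t r" for \<mu> r
    using that by (auto simp: box_monomials_def in_keys_iff subset_iff)
  have eq: "box_monomials (Suc m) t s = (\<Union>k\<in>{k. k \<le> t \<and> k \<le> s}. ?A k)"
  proof (rule Set.set_eqI, rule iffI)
    fix \<mu> assume \<mu>: "\<mu> \<in> box_monomials (Suc m) t s"
    define k where "k = lookup \<mu> m"
    define \<nu> where "\<nu> = \<mu> - single m k"
    have \<mu>\<nu>: "\<mu> = \<nu> + single m k"
      unfolding \<nu>_def k_def by (intro poly_mapping_eqI) (auto simp: lookup_add lookup_minus lookup_single when_def)
    have "wt (\<lambda>_. 1) \<nu> + k = s" using \<mu> by (simp add: box_monomials_def \<mu>\<nu>)
    moreover have "lookup \<nu> i \<le> t" for i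
    proof -
      have "lookup \<nu> i \<le> lookup \<mu> i" by (simp add: \<mu>\<nu> lookup_add)
      also have "\<dots> \<le> t" using \<mu> by (simp add: box_monomials_def)
      finally show ?thesis .
    qed
    moreover have "keys \<nu> \<subseteq> {..<m}"
    proof
      fix i assume i: "i \<in> keys \<nu>"
      then have "i \<noteq> m" by (auto simp: \<nu>_def k_def in_keys_iff lookup_minus)
      moreover have "i \<in> keys \<mu>" using i by (auto simp: \<mu>\<nu> in_keys_iff lookup_add)
      then have "i < Suc m" using \<mu> by (auto simp: box_monomials_def)
      ultimately show "i \<in> {..<m}" by simp
    qed
    ultimately have "\<nu> \<in> box_monomials m t (s - k)" "k \<le> s" by (auto simp: box_monomials_def)
    moreover have "k \<le> t" using \<mu> by (simp add: box_monomials_def k_def)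
    ultimately show "\<mu> \<in> (\<Union>k\<in>{k. k \<le> t \<and> k \<le> s}. ?A k)" using \<mu>\<nu> by blast
  next
    fix \<mu> assume "\<mu> \<in> (\<Union>k\<in>{k. k \<le> t \<and> k \<le> s}. ?A k)"
    then obtain k \<nu> where *: "k \<le> t" "k \<le> s" "\<nu> \<in> box_monomials m t (s - k)" "\<mu> = \<nu> + single m k" by blast
    then show "\<mu> \<in> box_monomials (Suc m) t s"
      using last0[OF *(3)] Poly_Mapping.keys_add[of \<nu> "single m k"]
      by (fastforce simp: box_monomials_def lookup_add lookup_single when_def split: if_splits)
  qed
  have disj: "?A k \<inter> ?A l = {}" if "k \<noteq> l" for k l
  proof (rule ccontr)
    assume "?A k \<inter> ?A l \<noteq> {}"
    then obtain \<mu> \<nu> where *: "\<mu> \<in> box_monomials m t (s - k)" "\<nu> \<in> box_monomials m t (s - l)"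
      "\<mu> + single m k = \<nu> + single m l" by blast
    have "lookup (\<mu> + single m k) m = lookup (\<nu> + single m l) m" by (simp only: *(3))
    then show False using last0[OF *(1)] last0[OF *(2)] that by (simp add: lookup_add)
  qed
  have "card (box_monomials (Suc m) t s) = (\<Sum>k\<in>{k. k \<le> t \<and> k \<le> s}. card (?A k))"
    unfolding eq by (rule card_UN_disjoint) (use disj in auto)
  also have "\<dots> = (\<Sum>k\<in>{k. k \<le> t \<and> k \<le> s}. card (box_monomials m t (s - k)))"
    by (intro sum.cong refl card_image) (simp add: inj_on_def)
  also have "\<dots> = (\<Sum>k\<le>t. if k \<le> s then card (box_monomials m t (s - k)) else 0)"
    by (subst sum.If_cases) (auto intro!: sum.cong)
  finally show ?thesis .
qed

definition box_fps :: "nat \<Rightarrow> nat \<Rightarrow> rat fps" where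
  "box_fps m t = Abs_fps (\<lambda>s. of_nat (card (box_monomials m t s)))"

lemma box_fps_eq: "box_fps m t = (\<Sum>k\<le>t. fps_X ^ k) ^ m"
proof (induction m)
  case 0
  show ?case by (rule fps_ext) (simp add: box_fps_def card_box_monomials_0)
next
  case (Suc m)
  have "box_fps (Suc m) t = (\<Sum>k\<le>t. fps_X ^ k) * box_fps m t"
  proof (rule fps_ext)
    fix s
    have "fps_nth ((\<Sum>k\<le>t. fps_X ^ k) * box_fps m t) s = (\<Sum>k\<le>t. fps_nth (fps_X ^ k * box_fps m t) s)"
      by (simp add: sum_distrib_right fps_sum_nth)
    also have "\<dots> = (\<Sum>k\<le>t. if k \<le> s then of_nat (card (box_monomials m t (s - k))) else 0)"
      by (intro sum.cong refl) (simp add: fps_X_power_mult_nth box_fps_def)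
    also have "\<dots> = fps_nth (box_fps (Suc m) t) s"
      unfolding box_fps_def fps_nth_Abs_fps card_box_monomials_Suc of_nat_sum by (intro sum.cong) auto
    finally show "fps_nth (box_fps (Suc m) t) s = fps_nth ((\<Sum>k\<le>t. fps_X ^ k) * box_fps m t) s" ..
  qed
  with Suc show ?case by simp
qed

lemma inverse_one_minus_X_power_nth:
  "fps_nth (inverse ((1 - fps_X :: rat fps) ^ Suc k)) n = of_nat ((n + k) choose k)"
  using one_minus_const_fps_X_neg_power'[of "Suc k" "1 :: rat"] binomial_symmetric[of k "n + k"]
  by (simp add: add.commute)

text \<open>The series \<open>box_fps m t\<close> is
  \<open>((1 - X ^ (t + 1)) / (1 - X)) ^ m\<close>. The extra factor \<open>1 - X\<close> forms
  differences of consecutive coefficients and cancels one factor of the denominator.\<close>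

lemma one_minus_X_mult_box_fps:
  assumes "m > 0"
  shows "(1 - fps_X) * box_fps m t = (1 - fps_X ^ Suc t) ^ m * inverse ((1 - fps_X) ^ (m - 1))"
proof -
  let ?Y = "(1 - fps_X :: rat fps) ^ (m - 1)"
  have "?Y * ((1 - fps_X) * box_fps m t) = (1 - fps_X) ^ m * box_fps m t"
    using assms by (metis mult.assoc power_minus_mult)
  also have "\<dots> = (1 - fps_X ^ Suc t) ^ m"
    unfolding box_fps_eq power_mult_distrib[symmetric] by (simp only: sum_gp_basic)
  finally have "inverse ?Y * ?Y * ((1 - fps_X) * box_fps m t) = (1 - fps_X ^ Suc t) ^ m * inverse ?Y"
    by (simp add: mult_ac)
  moreover have "inverse ?Y * ?Y = 1"
    by (rule inverse_mult_eq_1) (simp add: fps_power_zeroth)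
  ultimately show ?thesis by (simp only: mult_1_left)
qed

text \<open>The numerator is expanded by the binomial theorem and the denominator as a negative
  binomial series; the term \<open>j\<close> starts in degree \<open>j (t + 1)\<close>.\<close>

lemma card_box_monomials_diff:
  assumes "m \<ge> 2"
  shows "(of_nat (card (box_monomials m t (Suc s))) - of_nat (card (box_monomials m t s)) :: rat) =
    (\<Sum>j\<le>m. if j * Suc t \<le> Suc s then
       (-1) ^ j * of_nat (m choose j) * of_nat ((Suc s - j * Suc t + (m - 2)) choose (m - 2)) else 0)"
proof -
  let ?I = "inverse ((1 - fps_X :: rat fps) ^ (m - 1))"
  have "(of_nat (card (box_monomials m t (Suc s))) - of_nat (card (box_monomials m t s)) :: rat)
     = fps_nth ((1 - fps_X) * box_fps m t) (Suc s)"
    by (simp add: left_diff_distrib box_fps_def)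
  also have "(1 - fps_X) * box_fps m t = (\<Sum>j\<le>m. of_nat (m choose j) * (- (fps_X ^ Suc t)) ^ j) * ?I"
    using one_minus_X_mult_box_fps[of m t] assms binomial_ring[of "- (fps_X ^ Suc t)" "1 :: rat fps" m] by simp
  also have "\<dots> = (\<Sum>j\<le>m. fps_const ((-1) ^ j * of_nat (m choose j)) * (fps_X ^ (j * Suc t) * ?I))"
    unfolding sum_distrib_right
  proof (intro sum.cong refl)
    fix j
    have "(- (fps_X ^ Suc t)) ^ j = fps_const ((-1) ^ j) * (fps_X ^ (j * Suc t) :: rat fps)"
    proof -
      have "(fps_X ^ Suc t) ^ j = (fps_X ^ (j * Suc t) :: rat fps)"
        by (simp only: power_mult[symmetric] mult.commute)
      moreover have "fps_const ((-1) ^ j) = (-1 :: rat fps) ^ j"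
        by (simp add: fps_const_power[symmetric] fps_const_neg[symmetric] del: fps_const_power fps_const_neg)
      ultimately show ?thesis by (subst power_minus) (simp only:)
    qed
    then show "of_nat (m choose j) * (- (fps_X ^ Suc t)) ^ j * ?I
       = fps_const ((-1) ^ j * of_nat (m choose j)) * (fps_X ^ (j * Suc t) * ?I)"
      by (simp add: fps_of_nat[symmetric] fps_const_mult[symmetric] mult_ac del: fps_const_mult)
  qed
  also have "fps_nth \<dots> (Suc s) = (\<Sum>j\<le>m. (-1) ^ j * of_nat (m choose j) *
      (if j * Suc t \<le> Suc s then fps_nth ?I (Suc s - j * Suc t) else 0))"
    unfolding fps_sum_nth fps_mult_left_const_nth fps_X_power_mult_nth
    by (intro sum.cong refl) (simp add: not_le)
  also have "m - 1 = Suc (m - 2)" using assms by simp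
  finally show ?thesis
    by (simp only: inverse_one_minus_X_power_nth) (simp add: if_distrib mult.assoc cong: if_cong)
qed

theorem dim_tinv_formula:
  assumes "g \<ge> 1" "t \<ge> 1"
  shows "of_nat (cpoly.dim (tinv (2 * g + 1) (\<lambda>_. t) (g * t))) =
    (\<Sum>j<g. (-1) ^ j * of_nat ((2 * g + 1) choose j) *
       (of_nat ((t * (g - j) + (2 * g - 1 - j)) choose (2 * g - 1)) :: rat))"
proof -
  \<comment> \<open>\<open>lower\<close> is applied in degree \<open>g t = Suc s\<close>; its target
    degree satisfies \<open>2 s < (2 g + 1) t\<close>, so it is onto.\<close>
  define s where "s = g * t - 1"
  have s: "g * t = Suc s" using assms by (simp add: s_def)
  let ?m = "2 * g + 1"
  have "2 * s < ?m * t" using assms by (simp add: s_def algebra_simps)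
  then have "(of_nat (cpoly.dim (tinv ?m (\<lambda>_. t) (g * t))) :: rat) =
     of_nat (card (box_monomials ?m t (Suc s))) - of_nat (card (box_monomials ?m t s))"
    using dim_tinv[of s ?m t] unfolding s by (metis add_diff_cancel_right' of_nat_add)
  also have "\<dots> = (\<Sum>j\<le>?m. if j * Suc t \<le> g * t then
       (-1) ^ j * of_nat (?m choose j) * of_nat ((g * t - j * Suc t + (2 * g - 1)) choose (2 * g - 1)) else 0)"
  proof -
    have "?m - 2 = 2 * g - 1" "?m \<ge> 2" using assms by simp_all
    then show ?thesis unfolding s using card_box_monomials_diff[of ?m t s] by (simp only:)
  qed
  also have "\<dots> = (\<Sum>j<g. if j * Suc t \<le> g * t then
       (-1) ^ j * of_nat (?m choose j) * of_nat ((g * t - j * Suc t + (2 * g - 1)) choose (2 * g - 1)) else 0)"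
  proof (rule sum.mono_neutral_right)
    show "\<forall>j\<in>{..?m} - {..<g}. (if j * Suc t \<le> g * t then
       (-1) ^ j * of_nat (?m choose j) * of_nat ((g * t - j * Suc t + (2 * g - 1)) choose (2 * g - 1)) else 0) = (0 :: rat)"
    proof
      fix j assume "j \<in> {..?m} - {..<g}"
      \<comment> \<open>For \<open>j \<ge> g\<close> the term starts in degree
        \<open>g t + g\<close> or later, beyond \<open>g t\<close>.\<close>
      then have "g * Suc t \<le> j * Suc t" by (intro mult_right_mono) auto
      then have "\<not> j * Suc t \<le> g * t" using assms by simp
      then show "(if j * Suc t \<le> g * t then
       (-1) ^ j * of_nat (?m choose j) * of_nat ((g * t - j * Suc t + (2 * g - 1)) choose (2 * g - 1)) else 0) = (0 :: rat)" by simp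
    qed
  qed auto
  also have "\<dots> = (\<Sum>j<g. (-1) ^ j * of_nat (?m choose j) *
       of_nat ((t * (g - j) + (2 * g - 1 - j)) choose (2 * g - 1)))"
  proof (intro sum.cong refl)
    fix j assume "j \<in> {..<g}"
    then have j: "j < g" by simp
    have *: "t * (g - j) + t * j = g * t" using j by (metis add_mult_distrib2 le_add_diff_inverse2 less_imp_le mult.commute)
    show "(if j * Suc t \<le> g * t then
       (-1) ^ j * of_nat (?m choose j) * of_nat ((g * t - j * Suc t + (2 * g - 1)) choose (2 * g - 1)) else 0) =
      (-1) ^ j * of_nat (?m choose j) * (of_nat ((t * (g - j) + (2 * g - 1 - j)) choose (2 * g - 1)) :: rat)"
    proof (cases "j * Suc t \<le> g * t")
      case True
      have "j * Suc t = t * j + j" by (simp add: mult.commute)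
      then have "g * t - j * Suc t + (2 * g - 1) = t * (g - j) + (2 * g - 1 - j)"
        using * True j by linarith
      then show ?thesis using True by simp
    next
      case False
      have "j * Suc t = t * j + j" by (simp add: mult.commute)
      then have "t * (g - j) + (2 * g - 1 - j) < 2 * g - 1" using * False j by linarith
      then show ?thesis using False by (simp add: binomial_eq_0)
    qed
  qed
  finally show ?thesis .
qed

subsection \<open>Brackets and invariants\<close>

definition br :: "nat \<Rightarrow> nat \<Rightarrow> cpoly" where
  "br i j = Var (2 * i) * Var (2 * j + 1) - Var (2 * j) * Var (2 * i + 1)"

definition brprod :: "(nat \<times> nat) multiset \<Rightarrow> cpoly" where
  "brprod E = (\<Prod>e\<in>#E. br (fst e) (snd e))"

definition regs :: "nat \<Rightarrow> nat \<Rightarrow> (nat \<times> nat) multiset set" where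
  "regs n t = {E. set_mset E \<subseteq> {..<n} \<times> {..<n} \<and> (\<forall>i<n. vdeg E i = t)}"

lemma brprod_empty [simp]: "brprod {#} = 1"
  and brprod_add_mset [simp]: "brprod (add_mset e E) = br (fst e) (snd e) * brprod E"
  and brprod_union [simp]: "brprod (E + F) = brprod E * brprod F"
  by (simp_all add: brprod_def)

lemma eval_br: "eval (br i j) x = x (2 * i) * x (2 * j + 1) - x (2 * j) * x (2 * i + 1)"
  by (simp add: br_def)

lemma br_commute: "br j i = - br i j"
  by (simp add: br_def)

lemma br_nonzero: "i \<noteq> j \<Longrightarrow> br i j \<noteq> 0"
proof
  assume "i \<noteq> j" "br i j = 0"
  then have "eval (br i j) (\<lambda>v. if v = 2 * i \<or> v = 2 * j + 1 then 1 else 0) = 0" by simp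
  moreover have "2 * j \<noteq> Suc (2 * j)" "2 * i \<noteq> Suc (2 * i)" by simp_all
  ultimately show False using \<open>i \<noteq> j\<close> by (simp add: eval_br)
qed

lemma eval_br_diag_act:
  assumes "a * d - b * c = 1"
  shows "eval (br i j) (diag_act a b c d x) = eval (br i j) x"
proof -
  have "eval (br i j) (diag_act a b c d x) = (a * d - b * c) * eval (br i j) x"
    by (simp add: eval_br diag_act_def algebra_simps)
  with assms show ?thesis by simp
qed

lemma brprod_invariant:
  assumes "E \<in> regs n t"
  shows "brprod E \<in> invariant_sections n t"
proof -
  have *: "brprod E \<in> polys_in (n * 2) \<and>
     (\<forall>i. brprod E \<in> graded (=) (\<lambda>v. if v div 2 = i then 1 else 0) (vdeg E i)) \<and>
     (\<forall>a b c d x. a * d - b * c = 1 \<longrightarrow> eval (brprod E) (diag_act a b c d x) = eval (brprod E) x)"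
    if "set_mset E \<subseteq> {..<n} \<times> {..<n}" for E
    using that
  proof (induction E)
    case empty
    show ?case by (auto simp: graded_1 polys_in_graded)
  next
    case (add e E)
    have e: "fst e < n" "snd e < n" using add.prems by auto
    have "br (fst e) (snd e) \<in> polys_in (n * 2)"
      unfolding br_def using e by (intro polys_in_diff polys_in_mult polys_in_Var) auto
    moreover have "br (fst e) (snd e) \<in> graded (=) (\<lambda>v. if v div 2 = i then 1 else 0)
      ((if fst e = i then 1 else 0) + (if snd e = i then 1 else 0))" for i
    proof -
      let ?w = "\<lambda>v. if v div 2 = i then 1 else 0 :: nat"
      have V: "Var (2 * k) \<in> graded (=) ?w (if k = i then 1 else 0)"
        "Var (2 * k + 1) \<in> graded (=) ?w (if k = i then 1 else 0)" for k
        by (rule graded_Var, simp)+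
      show ?thesis unfolding br_def
        by (intro graded_diff graded_mult[OF _ V(1) V(2)], simp)
           (subst add.commute, intro graded_mult[OF _ V(1) V(2)], simp)
    qed
    ultimately show ?case
      using add by (simp add: polys_in_mult graded_mult eval_br_diag_act del: One_nat_def)
  qed
  have "brprod E \<in> graded (=) (\<lambda>v. if v div 2 = i then 1 else 0) t" if "i < n" for i
  proof -
    have "brprod E \<in> graded (=) (\<lambda>v. if v div 2 = i then 1 else 0) (vdeg E i)"
      using *[of E] assms unfolding regs_def by blast
    then show ?thesis using assms that by (simp add: regs_def)
  qed
  then show ?thesis using *[of E] assms
    by (simp add: invariant_sections_def multiforms_iff regs_def)
qed

lemma eval_multiforms_scale:
  assumes "k > 0" and F: "F \<in> multiforms m k D"
  shows "eval F (\<lambda>v. a (v div k) * x v) = (\<Prod>i<m. a i ^ D i) * eval F x"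
  unfolding eval_expand sum_distrib_left
proof (intro sum.cong refl)
  fix \<mu> assume \<mu>: "\<mu> \<in> keys F"
  have k: "keys \<mu> \<subseteq> {..<m * k}" using F \<mu> by (auto simp: multiforms_iff[OF assms(1)] polys_in_def)
  have "mono_val (\<lambda>v. a (v div k)) \<mu> = (\<Prod>i<m. \<Prod>v\<in>{v \<in> keys \<mu>. v div k = i}. a (v div k) ^ lookup \<mu> v)"
    unfolding mono_val_def
    by (rule prod.group[symmetric]) (use k in \<open>auto simp: assms(1) div_less_iff_less_mult\<close>)
  also have "\<dots> = (\<Prod>i<m. a i ^ D i)"
  proof (intro prod.cong refl)
    fix i assume i: "i \<in> {..<m}"
    have "(\<Prod>v\<in>{v \<in> keys \<mu>. v div k = i}. a (v div k) ^ lookup \<mu> v) = a i ^ (\<Sum>v\<in>{v \<in> keys \<mu>. v div k = i}. lookup \<mu> v)"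
      by (simp add: power_sum)
    also have "(\<Sum>v\<in>{v \<in> keys \<mu>. v div k = i}. lookup \<mu> v) = wt (\<lambda>v. if v div k = i then 1 else 0) \<mu>"
      unfolding wt_def by (subst sum.inter_filter) (auto intro!: sum.cong)
    also have "\<dots> = D i" using F \<mu> i by (auto simp: multiforms_iff[OF assms(1)] graded_def)
    finally show "(\<Prod>v\<in>{v \<in> keys \<mu>. v div k = i}. a (v div k) ^ lookup \<mu> v) = a i ^ D i" .
  qed
  finally show "lookup F \<mu> * mono_val (\<lambda>v. a (v div k) * x v) \<mu>
     = (\<Prod>i<m. a i ^ D i) * (lookup F \<mu> * mono_val x \<mu>)"
    by (simp add: mono_val_mult mult_ac)
qed

lemma invariant_sectionsD:
  assumes "F \<in> invariant_sections n t"
  shows "F \<in> polys_in (n * 2)" "F \<in> multiforms n 2 (\<lambda>_. t)"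
    "\<And>i. i < n \<Longrightarrow> F \<in> graded (=) (\<lambda>v. if v div 2 = i then 1 else 0) t"
    "\<And>a b c d x. a * d - b * c = 1 \<Longrightarrow> eval F (diag_act a b c d x) = eval F x"
  using assms by (auto simp: invariant_sections_def multiforms_iff)

lemma subspace_multiforms: "k > 0 \<Longrightarrow> cpoly.subspace (multiforms m k D)"
  using subspace_polys_in[of "m * k"] subspace_graded
  by (auto simp: multiforms_iff cpoly.subspace_def)

lemma subspace_invariant_sections: "cpoly.subspace (invariant_sections n t)"
  using subspace_multiforms[of 2 n "\<lambda>_. t"]
  by (auto simp: invariant_sections_def cpoly.subspace_def)

lemma invariant_sections_mult:
  assumes "F \<in> invariant_sections n s" "G \<in> invariant_sections n t"
  shows "F * G \<in> invariant_sections n (s + t)"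
  using invariant_sectionsD[OF assms(1)] invariant_sectionsD[OF assms(2)]
  by (simp add: invariant_sections_def multiforms_iff polys_in_mult graded_mult)

lemma one_invariant: "1 \<in> invariant_sections n 0"
  by (simp add: invariant_sections_def multiforms_iff graded_1 polys_in_graded)

lemma invariant_sections_0:
  assumes "F \<in> invariant_sections n 0"
  obtains c where "F = Cst c"
proof -
  have "F = Cst (eval F (\<lambda>_. 0))"
  proof (rule eval_eqI)
    fix x
    have "eval F (\<lambda>v. (\<lambda>_. 0) (v div 2) * x v) = (\<Prod>i<n. (\<lambda>_. 0) i ^ 0) * eval F x"
      by (rule eval_multiforms_scale) (use invariant_sectionsD(2)[OF assms] in simp_all)
    then show "eval F x = eval (Cst (eval F (\<lambda>_. 0))) x" by simp
  qed
  then show ?thesis using that by blast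
qed

text \<open>Normalises the points of \<open>(\<P>\<^sup>1)\<^sup>m\<^sup>+\<^sup>1\<close> to \<open>(u\<^sub>i : 1)\<close> and the last one to infinity.\<close>

definition dehom :: "nat \<Rightarrow> nat \<Rightarrow> cpoly" where
  "dehom m v = (if v < 2 * m then (if even v then Var (v div 2) else 1) else if v = 2 * m then 1 else 0)"

text \<open>Unipotent matrices act on the normal form as translations. The torus gives the degree:
  it multiplies all \<open>u\<^sub>i\<close> by one number, up to rescaling the representatives, and
  the rescaling factors combine to the exponent \<open>s\<close> because
  \<open>2 s + t = m t\<close>.\<close>

lemma invariant_subst_dehom:
  assumes F: "F \<in> invariant_sections (Suc m) t" and s: "2 * s + t = m * t"
  shows "subst (dehom m) F \<in> tinv m (\<lambda>_. t) s"
proof -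
  let ?f = "subst (dehom m) F"
  note FD = invariant_sectionsD[OF F]
  define y where "y x = (\<lambda>v. eval (dehom m v) x)" for x
  have y: "y x v = (if v < 2 * m then (if even v then x (v div 2) else 1) else if v = 2 * m then 1 else 0)" for x v
    by (simp add: y_def dehom_def)
  have ev: "eval ?f x = eval F (y x)" for x by (simp add: y_def)
  have "?f \<in> polys_in m"
    by (rule polys_in_subst) (auto simp: dehom_def polys_in_Var simp flip: Cst_0 Cst_1)
  moreover have "?f \<in> graded (\<le>) (\<lambda>v. if v \<in> {i} then 1 else 0) t" if "i < m" for i
  proof (rule graded_subst[where \<delta> = "\<lambda>v. if v div 2 = i then 1 else 0"])
    fix v show "dehom m v \<in> graded (\<le>) (\<lambda>v. if v \<in> {i} then 1 else 0) (if v div 2 = i then 1 else 0)"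
      by (auto simp: dehom_def intro!: graded_Var graded_1)
  next
    fix \<mu> a assume "\<mu> \<in> keys F" "a \<le> wt (\<lambda>v. if v div 2 = i then 1 else 0) \<mu>"
    then show "a \<le> t" using FD(3)[of i] that by (auto simp: graded_def)
  qed simp
  moreover have "eval ?f (\<lambda>i. x i + c) = eval ?f x" for x c
  proof -
    have "y (\<lambda>i. x i + c) = diag_act 1 c 0 1 (y x)"
    proof
      fix v show "y (\<lambda>i. x i + c) v = diag_act 1 c 0 1 (y x) v"
        by (cases "even v") (auto simp: y diag_act_def elim!: evenE oddE)
    qed
    then show ?thesis using FD(4)[of 1 1 c 0 "y x"] by (simp only: ev) simp
  qed
  moreover have "?f \<in> graded (=) (\<lambda>_. 1) s"
  proof (rule gradedI_scale[of 4])
    fix x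
    \<comment> \<open>The matrix \<open>diag (2, 1/2)\<close> turns \<open>(u : 1)\<close> into
      \<open>(2 u : 1/2)\<close>, and rescaling by 2 gives \<open>(4 u : 1)\<close>. The point at
      infinity becomes \<open>(2 : 0)\<close> and is rescaled by \<open>1/2\<close>.\<close>
    let ?d = "diag_act 2 0 0 (1 / 2) (y x)"
    let ?a = "\<lambda>i. if i < m then 2 else 1 / 2 :: complex"
    have "y (\<lambda>i. of_nat 4 ^ 1 * x i) = (\<lambda>v. ?a (v div 2) * ?d v)"
    proof
      fix v show "y (\<lambda>i. of_nat 4 ^ 1 * x i) v = ?a (v div 2) * ?d v"
      proof (cases "even v")
        case True
        then obtain i where "v = 2 * i" by (auto elim: evenE)
        then show ?thesis by (auto simp: y diag_act_def)
      next
        case False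
        then obtain i where "v = 2 * i + 1" by (auto elim: oddE)
        moreover from this have "v \<noteq> 2 * m" by presburger
        ultimately show ?thesis by (auto simp: y diag_act_def)
      qed
    qed
    then have "eval ?f (\<lambda>i. of_nat 4 ^ 1 * x i) = eval F (\<lambda>v. ?a (v div 2) * ?d v)" by (simp only: ev)
    also have "\<dots> = (\<Prod>i<Suc m. ?a i ^ t) * eval F ?d"
      by (rule eval_multiforms_scale) (use FD(2) in auto)
    also have "(\<Prod>i<Suc m. ?a i ^ t) = 2 ^ (m * t) * (1 / 2) ^ t"
      by (simp add: power_mult mult.commute[of m t])
    also have "\<dots> = 2 ^ (2 * s) * (2 ^ t * (1 / 2) ^ t)"
      unfolding s[symmetric] by (simp only: power_add mult.assoc)
    also have "\<dots> = of_nat 4 ^ s" by (simp add: power_mult power_mult_distrib[symmetric])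
    also have "eval F ?d = eval F (y x)" by (rule FD(4)) simp
    also have "\<dots> = eval ?f x" by (simp only: ev)
    finally show "eval ?f (\<lambda>i. of_nat 4 ^ 1 * x i) = of_nat 4 ^ s * eval ?f x" .
  qed simp
  ultimately show ?thesis by (simp add: tinv_def)
qed

text \<open>If the last point differs from all others and has nonzero first coordinate,
  \<open>SL(2)\<close> and rescaling bring the tuple to normal form. The other tuples lie on a
  hypersurface, and multiplying \<open>F\<close> by its equation makes the product vanish
  everywhere.\<close>

lemma subst_dehom_inj:
  assumes F: "F \<in> invariant_sections (Suc m) t" and 0: "subst (dehom m) F = 0"
  shows "F = 0"
proof -
  note FD = invariant_sectionsD[OF F]
  have "eval (F * (Var (2 * m) * (\<Prod>i<m. br m i))) x = 0" for x
  proof (cases "x (2 * m) = 0 \<or> (\<exists>i<m. eval (br m i) x = 0)")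
    case True
    then show ?thesis by (auto simp: eval_prod)
  next
    case False
    define \<beta> where "\<beta> i = eval (br m i) x" for i
    have nz: "x (2 * m) \<noteq> 0" "\<And>i. i < m \<Longrightarrow> \<beta> i \<noteq> 0" using False by (auto simp: \<beta>_def)
    let ?u = "x (2 * m)" and ?v = "x (2 * m + 1)"
    \<comment> \<open>The matrix has determinant 1, sends the last point \<open>(u, v)\<close> to
      \<open>(1, 0)\<close> and gives the \<open>i\<close>-th point the second coordinate
      \<open>\<beta> i\<close>.\<close>
    let ?d = "diag_act (1 / ?u) 0 (- ?v) ?u x"
    let ?z = "\<lambda>i. x (2 * i) / ?u / \<beta> i"
    have "eval F x = eval F ?d" using nz by (subst FD(4)) simp_all
    also have "\<dots> = eval F (\<lambda>v. (if v div 2 < m then \<beta> (v div 2) else 1) * eval (dehom m v) ?z)"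
    proof (rule eval_cong_polys_in[OF FD(1)])
      fix v assume v: "v < Suc m * 2"
      show "?d v = (if v div 2 < m then \<beta> (v div 2) else 1) * eval (dehom m v) ?z"
      proof (cases "even v")
        case True
        then obtain i where i: "v = 2 * i" by (auto elim: evenE)
        with v have "i < m \<or> i = m" by auto
        then show ?thesis using nz by (auto simp: i diag_act_def dehom_def)
      next
        case False
        then obtain i where i: "v = 2 * i + 1" by (auto elim: oddE)
        with v have "i < m \<or> i = m" by auto
        then show ?thesis using nz by (auto simp: i diag_act_def dehom_def \<beta>_def eval_br algebra_simps)
      qed
    qed
    also have "\<dots> = (\<Prod>i<Suc m. (if i < m then \<beta> i else 1) ^ t) * eval F (\<lambda>v. eval (dehom m v) ?z)"
      by (rule eval_multiforms_scale[of 2 F "Suc m" "\<lambda>_. t" "\<lambda>i. if i < m then \<beta> i else 1"]) (use FD(2) in auto)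
    also have "eval F (\<lambda>v. eval (dehom m v) ?z) = eval (subst (dehom m) F) ?z" by simp
    finally show ?thesis using 0 by simp
  qed
  then have "F * (Var (2 * m) * (\<Prod>i<m. br m i)) = 0" by (rule eval_eq_0_imp)
  moreover have "Var (2 * m) \<noteq> 0" by (rule Var_nonzero)
  moreover have "(\<Prod>i<m. br m i) \<noteq> 0" using br_nonzero by (auto simp: prod_zero_iff)
  ultimately show ?thesis by simp
qed

lemma handshake: "set_mset E \<subseteq> {..<m} \<times> {..<m} \<Longrightarrow> (\<Sum>i<m. vdeg E i) = 2 * size E"
  by (induction E) (auto simp: sum.distrib sum.delta)

lemma vdeg_replicate: "vdeg (replicate_mset k (a, b)) i = (if a = i then k else 0) + (if b = i then k else 0)"
  by (simp add: vdeg_def)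

lemma vdeg_sum: "vdeg (\<Sum>j\<in>J. F j) i = (\<Sum>j\<in>J. vdeg (F j) i)"
  by (induction J rule: infinite_finite_induct) simp_all

lemma brprod_sum: "brprod (\<Sum>j\<in>J. F j) = (\<Prod>j\<in>J. brprod (F j))"
  by (induction J rule: infinite_finite_induct) simp_all

lemma brprod_replicate: "brprod (replicate_mset k e) = br (fst e) (snd e) ^ k"
  by (induction k) simp_all

lemma subst_dehom_br:
  "i < m \<Longrightarrow> j < m \<Longrightarrow> subst (dehom m) (br i j) = Var i - Var j"
  "i < m \<Longrightarrow> subst (dehom m) (br m i) = 1"
  by (simp_all add: br_def dehom_def)

text \<open>Missing degree is filled by edges from the point at infinity \<open>m\<close>. Their
  brackets dehomogenise to 1, not -1, because \<open>m\<close> comes first. By the handshake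
  identity, \<open>2 s + t = m t\<close> says that \<open>m\<close> itself receives degree
  \<open>t\<close>.\<close>

lemma complete_graph:
  assumes E: "E \<in> graphs m (\<lambda>_. t) s" and s: "2 * s + t = m * t"
  shows "\<exists>F\<in>regs (Suc m) t. subst (dehom m) (brprod F) = dprod E"
proof
  let ?R = "\<Sum>j<m. replicate_mset (t - vdeg E j) (m, j)"
  have E': "set_mset E \<subseteq> {..<m} \<times> {..<m}" "\<And>i. i < m \<Longrightarrow> vdeg E i \<le> t" "size E = s"
    using E by (auto simp: graphs_def)
  have m0: "vdeg E m = 0"
  proof -
    have "m \<notin># image_mset fst E" "m \<notin># image_mset snd E" using E'(1) by auto
    then show ?thesis unfolding vdeg_def by (metis add_0 not_in_iff)
  qed
  have "vdeg (E + ?R) i = t" if "i < Suc m" for i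
  proof (cases "i = m")
    case True
    have "(\<Sum>j<m. t - vdeg E j) + (\<Sum>j<m. vdeg E j) = m * t"
      using E'(2) by (simp add: sum.distrib[symmetric])
    then have "(\<Sum>j<m. t - vdeg E j) = t" using handshake[OF E'(1)] E'(3) s by simp
    then show ?thesis by (simp add: True m0 vdeg_sum vdeg_replicate)
  next
    case False
    with that have "i < m" by simp
    then have "(\<Sum>j<m. vdeg (replicate_mset (t - vdeg E j) (m, j)) i) = t - vdeg E i"
      by (simp add: vdeg_replicate)
    then show ?thesis using E'(2)[OF \<open>i < m\<close>] by (simp add: vdeg_sum)
  qed
  moreover have "set_mset (E + ?R) \<subseteq> {..<Suc m} \<times> {..<Suc m}"
    using E'(1) by (fastforce simp: set_mset_sum split: if_splits)
  ultimately show "E + ?R \<in> regs (Suc m) t" by (simp add: regs_def)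
  have "subst (dehom m) (brprod F) = dprod F" if "set_mset F \<subseteq> {..<m} \<times> {..<m}" for F
    using that by (induction F) (auto simp: subst_dehom_br)
  moreover have "subst (dehom m) (brprod ?R) = 1"
  proof -
    have "subst (dehom m) (br m j ^ k) = 1" if "j < m" for j k
      by (induction k) (simp_all add: subst_dehom_br that)
    then have "subst (dehom m) (\<Prod>j\<in>J. br m j ^ (t - vdeg E j)) = 1" if "J \<subseteq> {..<m}" for J
      using that by (induction J rule: infinite_finite_induct) auto
    then show ?thesis by (simp add: brprod_sum brprod_replicate)
  qed
  ultimately show "subst (dehom m) (brprod (E + ?R)) = dprod E" using E'(1) by simp
qed

lemma tinv_subset_image:
  assumes s: "2 * s + t = m * t"
  shows "tinv m (\<lambda>_. t) s \<subseteq> subst (dehom m) ` cpoly.span (brprod ` regs (Suc m) t)"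
  unfolding tinv_eq_span linear_span_image[OF linear_subst]
  using complete_graph[OF _ s] by (intro cpoly.span_mono) force

text \<open>Bracket products already reach every polynomial on the affine side. Since
  \<open>subst (dehom m)\<close> is injective on invariants, an invariant equals the combination of
  brackets with the same image.\<close>

theorem invariant_sections_span:
  assumes s: "2 * s + t = m * t"
  shows "invariant_sections (Suc m) t = cpoly.span (brprod ` regs (Suc m) t)"
proof
  show *: "cpoly.span (brprod ` regs (Suc m) t) \<subseteq> invariant_sections (Suc m) t"
    by (intro cpoly.span_minimal subspace_invariant_sections) (auto intro: brprod_invariant)
  show "invariant_sections (Suc m) t \<subseteq> cpoly.span (brprod ` regs (Suc m) t)"
  proof
    fix F assume F: "F \<in> invariant_sections (Suc m) t"
    then obtain G where G: "G \<in> cpoly.span (brprod ` regs (Suc m) t)" "subst (dehom m) F = subst (dehom m) G"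
      using invariant_subst_dehom[OF F s] tinv_subset_image[OF s] by blast
    have "F - G \<in> invariant_sections (Suc m) t"
      using F G(1) * subspace_invariant_sections cpoly.subspace_diff by blast
    then have "F - G = 0" by (rule subst_dehom_inj) (simp add: G(2))
    then show "F \<in> cpoly.span (brprod ` regs (Suc m) t)" using G(1) by simp
  qed
qed

lemma subst_dehom_image:
  assumes s: "2 * s + t = m * t"
  shows "subst (dehom m) ` invariant_sections (Suc m) t = tinv m (\<lambda>_. t) s"
  using tinv_subset_image[OF s] invariant_subst_dehom[OF _ s] invariant_sections_span[OF s] by blast

lemma finite_dim_invariant_sections:
  obtains B where "finite B" "invariant_sections n t \<subseteq> cpoly.span B"
proof -
  obtain B where "finite B" "multiforms n 2 (\<lambda>_. t) \<subseteq> cpoly.span B"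
    by (rule finite_dim_multiforms[of 2 n "\<lambda>_. t"]) simp_all
  moreover have "invariant_sections n t \<subseteq> multiforms n 2 (\<lambda>_. t)"
    by (auto simp: invariant_sections_def)
  ultimately show ?thesis using that[of B] by blast
qed

lemma dim_invariant_sections:
  assumes s: "2 * s + t = m * t"
  shows "cpoly.dim (invariant_sections (Suc m) t) = cpoly.dim (tinv m (\<lambda>_. t) s)"
proof -
  obtain B where "finite B" "invariant_sections (Suc m) t \<subseteq> cpoly.span B"
    using finite_dim_invariant_sections .
  then have "cpoly.dim (subst (dehom m) ` invariant_sections (Suc m) t) = cpoly.dim (invariant_sections (Suc m) t)"
    by (rule dim_image_inj[OF subspace_invariant_sections _ _ linear_subst]) (use subst_dehom_inj in blast)
  then show ?thesis unfolding subst_dehom_image[OF s] by simp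
qed

subsection \<open>Hall's theorem and Kempe's theorem\<close>

text \<open>Rado's argument: as long as some \<open>A i\<close> has two elements, one of them can be removed.\<close>

theorem hall:
  fixes A :: "'a \<Rightarrow> 'b set"
  assumes "finite I" "\<And>i. i \<in> I \<Longrightarrow> finite (A i)"
    and "\<And>J. J \<subseteq> I \<Longrightarrow> card J \<le> card (\<Union>i\<in>J. A i)"
  shows "\<exists>f. inj_on f I \<and> (\<forall>i\<in>I. f i \<in> A i)"
  using assms(2,3)
proof (induction "\<Sum>i\<in>I. card (A i)" arbitrary: A rule: less_induct)
  case less
  show ?case
  proof (cases "\<exists>i\<in>I. card (A i) \<ge> 2")
    case False
    have one: "card (A i) = 1" if "i \<in> I" for i
      using less.prems(2)[of "{i}"] that False by force
    then have "\<exists>x. A i = {x}" if "i \<in> I" for i using that card_1_singletonE by metis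
    then obtain f where f: "\<And>i. i \<in> I \<Longrightarrow> A i = {f i}" by metis
    have "inj_on f I"
    proof (rule inj_onI)
      fix i j assume ij: "i \<in> I" "j \<in> I" "f i = f j"
      show "i = j"
      proof (rule ccontr)
        assume "i \<noteq> j"
        then have "2 \<le> card (\<Union>k\<in>{i, j}. A k)" using less.prems(2)[of "{i, j}"] ij by simp
        then show False using f ij by simp
      qed
    qed
    then show ?thesis using f by auto
  next
    case True
    then obtain i where "i \<in> I" "\<not> card (A i) \<le> Suc 0" by auto
    then obtain x y where i: "i \<in> I" "x \<in> A i" "y \<in> A i" "x \<noteq> y"
      using card_le_Suc0_iff_eq[OF less.prems(1)] by blast
    let ?B = "\<lambda>z. A(i := A i - {z})"
    have "\<exists>z\<in>{x, y}. \<forall>J\<subseteq>I. card J \<le> card (\<Union>j\<in>J. ?B z j)"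
    proof (rule ccontr)
      assume "\<not> ?thesis"
      then obtain J K where J: "J \<subseteq> I" "card (\<Union>j\<in>J. ?B x j) < card J"
        and K: "K \<subseteq> I" "card (\<Union>j\<in>K. ?B y j) < card K"
        by (auto simp: not_le)
      have fin: "finite (\<Union>j\<in>L. A j)" if "L \<subseteq> I" for L
        using that assms(1) less.prems(1) by (auto intro: finite_subset)
      have finI: "finite J" "finite K" using J K assms(1) finite_subset by auto
      have iJ: "i \<in> J"
      proof (rule ccontr)
        assume "i \<notin> J"
        then have "(\<Union>j\<in>J. ?B x j) = (\<Union>j\<in>J. A j)" by auto
        then show False using J less.prems(2)[of J] by simp
      qed
      have iK: "i \<in> K"
      proof (rule ccontr)
        assume "i \<notin> K"
        then have "(\<Union>j\<in>K. ?B y j) = (\<Union>j\<in>K. A j)" by auto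
        then show False using K less.prems(2)[of K] by simp
      qed
      let ?P = "\<Union>j\<in>J. ?B x j" and ?Q = "\<Union>j\<in>K. ?B y j"
      have finP: "finite ?P" by (rule finite_subset[OF _ fin[OF J(1)]]) (auto split: if_splits)
      have finQ: "finite ?Q" by (rule finite_subset[OF _ fin[OF K(1)]]) (auto split: if_splits)
      have un: "?P \<union> ?Q = (\<Union>j\<in>J \<union> K. A j)"
      proof
        show "?P \<union> ?Q \<subseteq> (\<Union>j\<in>J \<union> K. A j)" by (auto split: if_splits)
        have "A i \<subseteq> ?P \<union> ?Q" using iJ iK i by force
        moreover have "A j \<subseteq> ?P \<union> ?Q" if "j \<in> J \<union> K" "j \<noteq> i" for j using that by force
        ultimately show "(\<Union>j\<in>J \<union> K. A j) \<subseteq> ?P \<union> ?Q" by blast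
      qed
      have int: "(\<Union>j\<in>J \<inter> K - {i}. A j) \<subseteq> ?P \<inter> ?Q" by force
      \<comment> \<open>Submodularity: the union loses no element of \<open>A i\<close>, since
        \<open>x\<close> and \<open>y\<close> are removed on different sides, and the intersection
        gives up only the index \<open>i\<close>.\<close>
      have "card (J \<union> K) + (card (J \<inter> K) - 1) \<le> card (?P \<union> ?Q) + card (?P \<inter> ?Q)"
      proof (rule add_mono)
        show "card (J \<union> K) \<le> card (?P \<union> ?Q)" unfolding un by (rule less.prems(2)) (use J(1) K(1) in blast)
        have "card (J \<inter> K) - 1 = card (J \<inter> K - {i})" using iJ iK by simp
        also have "\<dots> \<le> card (\<Union>j\<in>J \<inter> K - {i}. A j)" by (rule less.prems(2)) (use J(1) in blast)
        also have "\<dots> \<le> card (?P \<inter> ?Q)" using int finP by (intro card_mono) auto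
        finally show "card (J \<inter> K) - 1 \<le> card (?P \<inter> ?Q)" .
      qed
      moreover have "card (?P \<union> ?Q) + card (?P \<inter> ?Q) = card ?P + card ?Q"
        using finP finQ card_Un_Int by metis
      moreover have "card (J \<union> K) + card (J \<inter> K) = card J + card K"
        using finI card_Un_Int by metis
      moreover have "card (J \<inter> K) > 0" using iJ iK finI by (auto simp: card_gt_0_iff)
      ultimately show False using J(2) K(2) by linarith
    qed
    then obtain z where z: "z \<in> {x, y}" "\<And>J. J \<subseteq> I \<Longrightarrow> card J \<le> card (\<Union>j\<in>J. ?B z j)" by blast
    have lt: "(\<Sum>j\<in>I. card (?B z j)) < (\<Sum>j\<in>I. card (A j))"
    proof (rule sum_strict_mono_ex1[OF assms(1)])
      have "card (A i - {z}) < card (A i)" using i z(1) less.prems(1)[OF i(1)] by (intro card_Diff1_less) auto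
      then show "\<exists>j\<in>I. card (?B z j) < card (A j)" using i(1) by force
      show "\<forall>j\<in>I. card (?B z j) \<le> card (A j)"
        using \<open>card (A i - {z}) < card (A i)\<close> by simp
    qed
    have "finite (?B z j)" if "j \<in> I" for j using less.prems(1)[OF that] by auto
    from less.hyps[OF lt this z(2)]
    obtain f where f: "inj_on f I" "\<forall>j\<in>I. f j \<in> ?B z j" by blast
    then have "\<forall>j\<in>I. f j \<in> A j" by (auto split: if_splits)
    with f(1) show ?thesis by blast
  qed
qed

section \<open>Perfect matchings in regular bipartite multigraphs\<close>

lemma sum_count_eq_size: "finite J \<Longrightarrow> (\<Sum>i\<in>J. count M i) = size (filter_mset (\<lambda>i. i \<in> J) M)"
proof (induction M)
  case (add x M)
  have "(\<Sum>i\<in>J. count (add_mset x M) i) = (\<Sum>i\<in>J. if i = x then 1 else 0) + (\<Sum>i\<in>J. count M i)"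
    unfolding sum.distrib[symmetric] by (intro sum.cong) auto
  then show ?case using add by simp
qed simp

text \<open>The bipartition is fixed in advance as even against odd vertices, \<open>g + 1\<close>
  on each side. The orientation from even to odd lets \<open>fst\<close> and \<open>snd\<close> name
  the sides.\<close>

definition good_edge :: "nat \<times> nat \<Rightarrow> bool" where
  "good_edge e \<longleftrightarrow> even (fst e) \<and> odd (snd e)"

lemma good_vdeg:
  assumes "\<And>e. e \<in># E \<Longrightarrow> good_edge e"
  shows "even i \<Longrightarrow> vdeg E i = count (image_mset fst E) i" "odd i \<Longrightarrow> vdeg E i = count (image_mset snd E) i"
proof -
  assume "even i"
  then have "i \<notin># image_mset snd E" using assms by (auto simp: good_edge_def)
  then show "vdeg E i = count (image_mset fst E) i" unfolding vdeg_def by (metis add_0_right not_in_iff)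
next
  assume "odd i"
  then have "i \<notin># image_mset fst E" using assms by (auto simp: good_edge_def)
  then show "vdeg E i = count (image_mset snd E) i" unfolding vdeg_def by (metis add_0 not_in_iff)
qed

lemma card_even_odd: "card {i. i < 2 * g + 2 \<and> even i} = g + 1" "card {i. i < 2 * g + 2 \<and> odd i} = g + 1"
proof -
  have "{i. i < 2 * g + 2 \<and> even i} = (\<lambda>k. 2 * k) ` {..<g + 1}"
    by (auto elim!: evenE intro!: image_eqI)
  then show "card {i. i < 2 * g + 2 \<and> even i} = g + 1" by (simp add: card_image inj_on_def)
  have "{i. i < 2 * g + 2 \<and> odd i} = (\<lambda>k. 2 * k + 1) ` {..<g + 1}"
    by (auto elim!: oddE intro!: image_eqI)
  then show "card {i. i < 2 * g + 2 \<and> odd i} = g + 1" by (simp add: card_image inj_on_def)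
qed

text \<open>The edges leaving \<open>J\<close> all end in its neighbourhood, and counting them by
  the common degree \<open>t + 1\<close> on both sides gives Hall's condition. Since the two halves
  have the same size, the injection is onto the odd vertices.\<close>

lemma perfect_matching:
  assumes E: "E \<in> regs (2 * g + 2) (Suc t)" and good: "\<And>e. e \<in># E \<Longrightarrow> good_edge e"
  shows "\<exists>M\<in>regs (2 * g + 2) 1. \<exists>E'\<in>regs (2 * g + 2) t. E = M + E'"
proof -
  let ?n = "2 * g + 2"
  let ?I = "{i. i < ?n \<and> even i}" and ?O = "{i. i < ?n \<and> odd i}"
  let ?A = "\<lambda>i. {j. (i, j) \<in># E}"
  have En: "set_mset E \<subseteq> {..<?n} \<times> {..<?n}" "\<And>i. i < ?n \<Longrightarrow> vdeg E i = Suc t"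
    using E by (auto simp: regs_def)
  have AO: "?A i \<subseteq> ?O" for i using En(1) good by (fastforce simp: good_edge_def)
  have "\<exists>f. inj_on f ?I \<and> (\<forall>i\<in>?I. f i \<in> ?A i)"
  proof (rule hall)
    fix i show "finite (?A i)" by (rule finite_subset[OF AO]) simp
  next
    fix J assume J: "J \<subseteq> ?I"
    then have finJ: "finite J" by (rule finite_subset) simp
    let ?N = "\<Union>i\<in>J. ?A i"
    have NO: "?N \<subseteq> ?O" using AO by blast
    then have finN: "finite ?N" by (rule finite_subset) simp
    have "card J * Suc t = (\<Sum>i\<in>J. vdeg E i)" using J En(2) by (subst sum.cong[of J J _ "\<lambda>_. Suc t"]) auto
    also have "\<dots> = (\<Sum>i\<in>J. count (image_mset fst E) i)"
      using J good_vdeg(1)[OF good] by (intro sum.cong) auto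
    also have "\<dots> = size (filter_mset (\<lambda>e. fst e \<in> J) E)"
      by (simp add: sum_count_eq_size[OF finJ] filter_mset_image_mset)
    also have "\<dots> \<le> size (filter_mset (\<lambda>e. snd e \<in> ?N) E)"
    proof (rule size_mset_mono, rule mset_subset_eqI)
      fix e show "count (filter_mset (\<lambda>e. fst e \<in> J) E) e \<le> count (filter_mset (\<lambda>e. snd e \<in> ?N) E) e"
        by (cases "e \<in># E"; cases e) (auto simp: not_in_iff)
    qed
    also have "\<dots> = (\<Sum>i\<in>?N. count (image_mset snd E) i)"
      unfolding sum_count_eq_size[OF finN] by (simp add: filter_mset_image_mset)
    also have "\<dots> = (\<Sum>i\<in>?N. vdeg E i)"
      using NO good_vdeg(2)[OF good] by (intro sum.cong) auto
    also have "\<dots> = card ?N * Suc t" using NO En(2) by (subst sum.cong[of ?N ?N _ "\<lambda>_. Suc t"]) auto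
    finally show "card J \<le> card ?N" by (simp only: mult_le_cancel2)
  qed simp
  then obtain f where f: "inj_on f ?I" "\<And>i. i \<in> ?I \<Longrightarrow> (i, f i) \<in># E" by auto
  have fO: "f ` ?I \<subseteq> ?O" using f(2) AO by blast
  moreover have "card (f ` ?I) = card ?O"
    by (simp only: card_image[OF f(1)] card_even_odd)
  ultimately have fO': "f ` ?I = ?O"
    by (intro card_subset_eq) auto
  let ?p = "\<lambda>i. (i, f i)"
  define M where "M = mset_set (?p ` ?I)"
  have "inj_on ?p ?I" by (auto simp: inj_on_def)
  then have M: "M = image_mset ?p (mset_set ?I)" unfolding M_def by (rule image_mset_mset_set[symmetric])
  have "M \<subseteq># E"
  proof (rule mset_subset_eqI)
    fix e show "count M e \<le> count E e"
      using f(2) unfolding M_def by (cases "e \<in> ?p ` ?I") (auto simp: Suc_le_eq)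
  qed
  then have EM: "E = M + (E - M)" by simp
  have vM: "vdeg M i = 1" if "i < ?n" for i
  proof -
    have "image_mset fst M = mset_set ?I" by (simp add: M image_mset.compositionality comp_def)
    moreover have "image_mset snd M = image_mset f (mset_set ?I)"
      by (simp add: M image_mset.compositionality comp_def)
    then have "image_mset snd M = mset_set ?O"
      by (simp only: image_mset_mset_set[OF f(1)] fO')
    ultimately show ?thesis using that by (cases "even i") (simp_all add: vdeg_def)
  qed
  have sub: "set_mset M \<subseteq> {..<?n} \<times> {..<?n}" "set_mset (E - M) \<subseteq> {..<?n} \<times> {..<?n}"
    using En(1) \<open>M \<subseteq># E\<close> by (auto dest: mset_subset_eqD in_diffD)
  have "vdeg (E - M) i = t" if "i < ?n" for i
  proof -
    have "vdeg E i = vdeg M i + vdeg (E - M) i" by (subst EM) (rule vdeg_union)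
    then show ?thesis using vM[OF that] En(2)[OF that] by simp
  qed
  then have "M \<in> regs ?n 1" "E - M \<in> regs ?n t" using vM sub by (auto simp: regs_def)
  then show ?thesis using EM by blast
qed

text \<open>An edge counts 2 if both ends are even, -2 if both are odd, and 0 otherwise. For a
  regular graph on \<open>2 g + 2\<close> vertices the left side is 0, so edges inside the even half
  and edges inside the odd half only occur together.\<close>

lemma sum_sign_vdeg:
  assumes "set_mset E \<subseteq> {..<n} \<times> {..<n}"
  shows "(\<Sum>i<n. (-1) ^ i * int (vdeg E i)) = (\<Sum>e\<in>#E. (-1) ^ fst e + (-1) ^ snd e)"
  using assms
proof (induction E)
  case (add e E)
  have "(\<Sum>i<n. (-1) ^ i * int (vdeg (add_mset e E) i)) = (\<Sum>i<n. if i = fst e then (-1) ^ i else 0)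
     + (\<Sum>i<n. if i = snd e then (-1) ^ i else 0) + (\<Sum>i<n. (-1) ^ i * int (vdeg E i))"
    unfolding sum.distrib[symmetric] by (intro sum.cong refl) (auto simp: algebra_simps)
  then show ?case using add by (simp add: mem_Times_iff)
qed simp

lemma sum_mset_eq_0_nonneg:
  fixes f :: "'a \<Rightarrow> int"
  assumes "(\<Sum>e\<in>#E. f e) = 0" "\<And>e. e \<in># E \<Longrightarrow> f e \<ge> 0" "e \<in># E"
  shows "f e = 0"
proof -
  obtain E' where E': "E = add_mset e E'" using assms(3) by (metis multi_member_split)
  have "\<And>x. x \<in># E' \<Longrightarrow> f x \<ge> 0" using assms(2) by (simp add: E')
  then have "(\<Sum>e\<in>#E'. f e) \<ge> 0" by (induction E') auto
  then show ?thesis using assms(1,2) E' by force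
qed

text \<open>Induction on the number of edges that are not good. A reversed edge is turned round at
  the cost of a sign. Otherwise there are edges \<open>(a, b)\<close> inside the even half and
  \<open>(c, d)\<close> inside the odd half, and the Pluecker relation
  \<open>[ab][cd] = [ac][bd] - [ad][bc]\<close> replaces both by good ones. Once all edges are good,
  a perfect matching splits off.\<close>

lemma brprod_regs_span:
  assumes "E \<in> regs (2 * g + 2) (Suc t)"
  shows "brprod E \<in> cpoly.span {a * b |a b. a \<in> brprod ` regs (2 * g + 2) 1 \<and> b \<in> brprod ` regs (2 * g + 2) t}"
    (is "_ \<in> cpoly.span ?S")
  using assms
proof (induction "size (filter_mset (\<lambda>e. \<not> good_edge e) E)" arbitrary: E rule: less_induct)
  case less
  let ?n = "2 * g + 2"
  show ?case
  proof (cases "\<forall>e\<in>#E. good_edge e")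
    case True
    then obtain M E' where "M \<in> regs ?n 1" "E' \<in> regs ?n t" "E = M + E'"
      using perfect_matching[OF less.prems] by blast
    then have "brprod E \<in> ?S" by auto
    then show ?thesis by (rule cpoly.span_base)
  next
    case False
    then obtain e where e: "e \<in># E" "\<not> good_edge e" by blast
    show ?thesis
    proof (cases "\<exists>e\<in>#E. odd (fst e) \<and> even (snd e)")
      case True
      then obtain a b E0 where E: "E = add_mset (a, b) E0" "odd a" "even b"
        by (metis multi_member_split prod.collapse)
      let ?E = "add_mset (b, a) E0"
      have "?E \<in> regs ?n (Suc t)" using less.prems by (auto simp: E regs_def add_ac)
      moreover have "size (filter_mset (\<lambda>e. \<not> good_edge e) ?E) < size (filter_mset (\<lambda>e. \<not> good_edge e) E)"
        using E by (simp add: good_edge_def)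
      ultimately have "brprod ?E \<in> cpoly.span ?S" by (intro less.hyps)
      then have "- brprod ?E \<in> cpoly.span ?S" by (rule cpoly.span_neg)
      moreover have "brprod E = - brprod ?E" using br_commute[of b a] by (simp add: E)
      ultimately show ?thesis by simp
    next
      case no_oe: False
      let ?v = "\<lambda>e. (-1) ^ fst e + (-1) ^ snd e :: int"
      have "(\<Sum>i<?n. (-1) ^ i * int (vdeg E i)) = (\<Sum>i<?n. (-1) ^ i * int (Suc t))"
        by (intro sum.cong refl) (use less.prems in \<open>simp add: regs_def\<close>)
      also have "\<dots> = (\<Sum>i<?n. (-1) ^ i) * int (Suc t)" by (simp add: sum_distrib_right)
      also have "(\<Sum>i<?n. (-1 :: int) ^ i) = 0" by (induction g) simp_all
      finally have sum0: "(\<Sum>e\<in>#E. ?v e) = 0"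
        using sum_sign_vdeg[of E ?n] less.prems by (simp add: regs_def)
      have "\<exists>e\<in>#E. even (fst e) \<and> even (snd e)"
      proof (rule ccontr)
        assume no: "\<not> ?thesis"
        then have "- ?v e' \<ge> 0" if "e' \<in># E" for e'
          using that no_oe by (cases "even (fst e')"; cases "even (snd e')") auto
        moreover have "(\<Sum>e\<in>#E. - ?v e) = - (\<Sum>e\<in>#E. ?v e)"
          by (induction E) simp_all
        ultimately have "- ?v e = 0" using sum_mset_eq_0_nonneg[of "\<lambda>e. - ?v e" E e] e(1) sum0 by simp
        then show False using e no no_oe by (auto simp: good_edge_def)
      qed
      moreover have "\<exists>e\<in>#E. odd (fst e) \<and> odd (snd e)"
      proof (rule ccontr)
        assume no: "\<not> ?thesis"
        then have "?v e' \<ge> 0" if "e' \<in># E" for e'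
          using that no_oe by (cases "even (fst e')"; cases "even (snd e')") auto
        then have "?v e = 0" using sum_mset_eq_0_nonneg[OF sum0] e(1) by blast
        then show False using e no no_oe by (auto simp: good_edge_def)
      qed
      ultimately obtain a b c d where ab: "(a, b) \<in># E" "even a" "even b" and cd: "(c, d) \<in># E" "odd c" "odd d"
        by auto
      obtain E1 where E1: "E = add_mset (a, b) E1" using ab(1) by (metis multi_member_split)
      then have "(c, d) \<in># E1" using cd ab by auto
      then obtain E0 where E0: "E1 = add_mset (c, d) E0" by (metis multi_member_split)
      note E = E1[unfolded E0]
      let ?E1 = "add_mset (a, c) (add_mset (b, d) E0)" and ?E2 = "add_mset (a, d) (add_mset (b, c) E0)"
      have "?E1 \<in> regs ?n (Suc t)" "?E2 \<in> regs ?n (Suc t)"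
        using less.prems by (auto simp: E regs_def add_ac)
      moreover have "size (filter_mset (\<lambda>e. \<not> good_edge e) ?E1) < size (filter_mset (\<lambda>e. \<not> good_edge e) E)"
        "size (filter_mset (\<lambda>e. \<not> good_edge e) ?E2) < size (filter_mset (\<lambda>e. \<not> good_edge e) E)"
        using ab cd by (simp_all add: E good_edge_def)
      ultimately have "brprod ?E1 \<in> cpoly.span ?S" "brprod ?E2 \<in> cpoly.span ?S"
        using less.hyps by blast+
      then have "brprod ?E1 - brprod ?E2 \<in> cpoly.span ?S" by (rule cpoly.span_diff)
      moreover have "brprod E = brprod ?E1 - brprod ?E2"
        by (simp add: E br_def algebra_simps)
      ultimately show ?thesis by simp
    qed
  qed
qed

theorem kempe:
  "invariant_sections (2 * g + 2) (Suc t) =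
     cpoly.span {a * b |a b. a \<in> invariant_sections (2 * g + 2) 1 \<and> b \<in> invariant_sections (2 * g + 2) t}"
    (is "?L = cpoly.span ?S")
proof
  show "cpoly.span ?S \<subseteq> ?L"
    using invariant_sections_mult[of _ "2 * g + 2" 1 _ t]
    by (intro cpoly.span_minimal subspace_invariant_sections) auto
  have "2 * (g * Suc t) + Suc t = (2 * g + 1) * Suc t" by simp
  from invariant_sections_span[OF this]
  have "?L = cpoly.span (brprod ` regs (2 * g + 2) (Suc t))" by simp
  also have "\<dots> \<subseteq> cpoly.span ?S"
  proof (intro cpoly.span_minimal cpoly.subspace_span subsetI)
    fix f assume "f \<in> brprod ` regs (2 * g + 2) (Suc t)"
    then have "f \<in> cpoly.span {a * b |a b. a \<in> brprod ` regs (2 * g + 2) 1 \<and> b \<in> brprod ` regs (2 * g + 2) t}"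
      using brprod_regs_span by blast
    also have "\<dots> \<subseteq> cpoly.span ?S"
      by (rule cpoly.span_mono) (use brprod_invariant in blast)
    finally show "f \<in> cpoly.span ?S" .
  qed
  finally show "?L \<subseteq> cpoly.span ?S" .
qed

subsection \<open>The Hilbert polynomial and its leading coefficient\<close>

text \<open>First differences of Eulerian numbers. They satisfy a recursion with nonnegative
  coefficients and an antisymmetry, hence are positive in the first half of the range.\<close>

definition euler_diff :: "nat \<Rightarrow> nat \<Rightarrow> int" where
  "euler_diff n k = (\<Sum>j\<le>k. (-1) ^ j * int (Suc n choose j) * int (k - j) ^ (n - 1))"

lemma choose_step: "int (Suc i) * int (N choose Suc i) = (int N - int i) * int (N choose i)"
proof (cases "i \<le> N")
  case True
  have "Suc i * (N choose Suc i) = (N - i) * (N choose i)"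
    using binomial_absorption[of i N] binomial_absorb_comp[of N i] by simp
  then have "int (Suc i * (N choose Suc i)) = int ((N - i) * (N choose i))" by (simp only:)
  then show ?thesis using True by (simp only: of_nat_mult of_nat_diff)
qed (simp add: binomial_eq_0)

text \<open>Holds term by term after the shift \<open>j = Suc i\<close>: Pascal's rule splits
  \<open>Suc (Suc n) choose Suc i\<close> into \<open>a + b\<close>, and absorption,
  \<open>(i + 1) b = (n + 1 - i) a\<close>, turns \<open>(a + b) (l - i)\<close> into the two
  contributions on the right.\<close>

lemma euler_diff_Suc:
  assumes "n \<ge> 2"
  shows "euler_diff (Suc n) (Suc l) =
    int (Suc l) * euler_diff n (Suc l) + (int n + 1 - int l) * euler_diff n l"
proof -
  have term_eq: "(-1) ^ Suc i * int (Suc (Suc n) choose Suc i) * int (Suc l - Suc i) ^ n =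
      int (Suc l) * ((-1) ^ Suc i * int (Suc n choose Suc i) * int (Suc l - Suc i) ^ (n - 1)) +
      (int n + 1 - int l) * ((-1) ^ i * int (Suc n choose i) * int (l - i) ^ (n - 1))"
    if "i \<le> l" for i
  proof -
    define a b w where "a = int (Suc n choose i)" and "b = int (Suc n choose Suc i)" and "w = int (l - i)"
    have w: "w = int l - int i" using that by (simp add: w_def of_nat_diff)
    have "int (Suc i) * b = (int (Suc n) - int i) * a"
      using choose_step[of i "Suc n"] by (simp only: a_def b_def)
    then have "(int i + 1) * b = (int n + 1 - int i) * a" by (simp add: algebra_simps)
    then have "(a + b) * w = int (Suc l) * b - (int n + 1 - int l) * a"
      unfolding w by (simp add: algebra_simps)
    moreover have "w ^ n = w * w ^ (n - 1)" using assms by (simp add: power_eq_if)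
    ultimately have "(a + b) * w ^ n = (int (Suc l) * b - (int n + 1 - int l) * a) * w ^ (n - 1)"
      by (simp add: mult.assoc[symmetric])
    note eq = this
    have c: "int (Suc (Suc n) choose Suc i) = a + b" by (simp add: a_def b_def)
    have "(-1) ^ Suc i * int (Suc (Suc n) choose Suc i) * w ^ n = - ((-1) ^ i * ((a + b) * w ^ n))"
      unfolding c by simp
    also have "\<dots> = int (Suc l) * ((-1) ^ Suc i * b * w ^ (n - 1)) + (int n + 1 - int l) * ((-1) ^ i * a * w ^ (n - 1))"
      unfolding eq by (simp add: algebra_simps)
    finally show ?thesis unfolding diff_Suc_Suc a_def b_def w_def .
  qed
  have n: "n = Suc (n - 1)" using assms by simp
  have "euler_diff (Suc n) (Suc l) = int (Suc l) ^ n +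
     (\<Sum>i\<le>l. (-1) ^ Suc i * int (Suc (Suc n) choose Suc i) * int (Suc l - Suc i) ^ n)"
    unfolding euler_diff_def by (subst sum.atMost_Suc_shift) simp
  also have "\<dots> = int (Suc l) ^ n + (\<Sum>i\<le>l.
      int (Suc l) * ((-1) ^ Suc i * int (Suc n choose Suc i) * int (Suc l - Suc i) ^ (n - 1)) +
      (int n + 1 - int l) * ((-1) ^ i * int (Suc n choose i) * int (l - i) ^ (n - 1)))"
    by (intro arg_cong2[of _ _ _ _ "(+)"] refl sum.cong) (use term_eq in auto)
  also have "\<dots> = int (Suc l) * (int (Suc l) ^ (n - 1) +
       (\<Sum>i\<le>l. (-1) ^ Suc i * int (Suc n choose Suc i) * int (Suc l - Suc i) ^ (n - 1)))
     + (int n + 1 - int l) * euler_diff n l"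
    unfolding euler_diff_def sum.distrib sum_distrib_left[symmetric] distrib_left
    by (subst (1) n) simp
  also have "int (Suc l) ^ (n - 1) +
       (\<Sum>i\<le>l. (-1) ^ Suc i * int (Suc n choose Suc i) * int (Suc l - Suc i) ^ (n - 1)) = euler_diff n (Suc l)"
    unfolding euler_diff_def sum.atMost_Suc_shift by simp
  finally show ?thesis .
qed

lemma euler_diff_0: "n \<ge> 2 \<Longrightarrow> euler_diff n 0 = 0"
  by (simp add: euler_diff_def)

lemma euler_diff_2: "euler_diff 2 1 = 1" "euler_diff 2 2 = -1" "k \<ge> 3 \<Longrightarrow> euler_diff 2 k = 0"
proof -
  show "euler_diff 2 1 = 1" "euler_diff 2 2 = -1"
    by (simp_all add: euler_diff_def numeral_eq_Suc)
  assume k: "k \<ge> 3"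
  have "euler_diff 2 k = (\<Sum>j\<le>3. (-1) ^ j * int (3 choose j) * int (k - j))"
    unfolding euler_diff_def using k by (intro sum.mono_neutral_cong_right) auto
  also have "\<dots> = 0" using k by (simp add: numeral_eq_Suc of_nat_diff)
  finally show "euler_diff 2 k = 0" .
qed

lemma euler_diff_facts:
  assumes "n \<ge> 2"
  shows "(\<forall>k\<ge>n + 1. euler_diff n k = 0) \<and>
    (\<forall>k\<le>n + 1. euler_diff n k + euler_diff n (n + 1 - k) = 0) \<and>
    (\<forall>k\<ge>1. 2 * k \<le> n \<longrightarrow> euler_diff n k > 0)"
  using assms
proof (induction n rule: dec_induct)
  case base
  have "euler_diff 2 k + euler_diff 2 (3 - k) = 0" if "k \<le> 3" for k
  proof -
    have "k = 0 \<or> k = 1 \<or> k = 2 \<or> k = 3" using that by presburger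
    then show ?thesis
      by (elim disjE) (simp_all add: euler_diff_0 euler_diff_2(1)[unfolded One_nat_def] euler_diff_2(2) euler_diff_2(3)[of 3])
  qed
  moreover have "euler_diff 2 k > 0" if "k \<ge> 1" "2 * k \<le> 2" for k
  proof -
    have "k = 1" using that by simp
    then show ?thesis using euler_diff_2(1) by simp
  qed
  ultimately show ?case using euler_diff_2(3) by simp
next
  case (step n)
  have n: "n \<ge> 2" using step by simp
  have van: "\<And>k. k \<ge> n + 1 \<Longrightarrow> euler_diff n k = 0"
    and anti: "\<And>k. k \<le> n + 1 \<Longrightarrow> euler_diff n k + euler_diff n (n + 1 - k) = 0"
    and pos: "\<And>k. k \<ge> 1 \<Longrightarrow> 2 * k \<le> n \<Longrightarrow> euler_diff n k > 0"
    using step.IH by blast+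
  have van': "euler_diff (Suc n) k = 0" if "k \<ge> Suc n + 1" for k
  proof -
    have "k = Suc (k - 1)" "k - 1 \<ge> n + 1" using that by auto
    then obtain l where "k = Suc l" "l \<ge> n + 1" by blast
    then show ?thesis using van[of l] van[of "Suc l"] euler_diff_Suc[OF n, of l] by simp
  qed
  moreover have "euler_diff (Suc n) k + euler_diff (Suc n) (Suc n + 1 - k) = 0" if k: "k \<le> Suc n + 1" for k
  proof -
    consider "k = 0" | "k = n + 2" | l l' where "k = Suc l" "Suc n + 1 - k = Suc l'" "l + l' = n"
      using k by (cases k; cases "Suc n + 1 - k") auto
    then show ?thesis
    proof cases
      case 3
      have "euler_diff n (Suc l) + euler_diff n l' = 0"
        using anti[of "Suc l"] 3 by (metis Suc_eq_plus1 add_diff_cancel_left' add_Suc add_le_mono1 le_add1)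
      moreover have "euler_diff n l + euler_diff n (Suc l') = 0"
      proof -
        have "n + 1 - l = Suc l'" using 3 by simp
        then show ?thesis using anti[of l] 3 by simp
      qed
      ultimately have *: "euler_diff n l' = - euler_diff n (Suc l)" "euler_diff n (Suc l') = - euler_diff n l"
        by linarith+
      have n': "int n = int l + int l'" using 3 by simp
      have "euler_diff (Suc n) (Suc l) + euler_diff (Suc n) (Suc l') = 0"
        by (simp only: euler_diff_Suc[OF n] * n') (simp add: algebra_simps)
      then show ?thesis by (simp only: 3(2)) (simp only: 3(1))
    qed (use euler_diff_0[of "Suc n"] van'[of "n + 2"] n in simp_all)
  qed
  moreover have "euler_diff (Suc n) k > 0" if k: "k \<ge> 1" "2 * k \<le> Suc n" for k
  proof -
    obtain l where l: "k = Suc l" using k(1) by (cases k) auto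
    show ?thesis
    proof (cases "2 * k \<le> n")
      case True
      have "euler_diff n l \<ge> 0"
        using pos[of l] euler_diff_0[OF n] True l by (cases "l = 0") auto
      moreover have "euler_diff n (Suc l) > 0" using pos[of "Suc l"] True l by simp
      moreover have "int n + 1 - int l \<ge> 0" using True l by simp
      ultimately show ?thesis unfolding l euler_diff_Suc[OF n]
        by (intro add_pos_nonneg mult_pos_pos mult_nonneg_nonneg) simp_all
    next
      case False
      then have nk: "Suc n = 2 * k" using k by simp
      then have "n + 1 - k = k" "k \<le> n + 1" by simp_all
      \<comment> \<open>The middle index is its own mirror image, so antisymmetry removes the first
        summand of the recursion and the second one is positive.\<close>
      then have "euler_diff n (Suc l) = 0" using anti[of k] l by simp
      moreover have "euler_diff n l > 0" using pos[of l] nk l n by simp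
      moreover have "int n + 1 - int l > 0" using nk l by simp
      ultimately show ?thesis unfolding l euler_diff_Suc[OF n] by simp
    qed
  qed
  ultimately show ?case by blast
qed

text \<open>This number is \<open>euler_diff (2 * g) g\<close>, at the last index for which
  positivity is available.\<close>

lemma degree_number_pos:
  assumes "g \<ge> 1"
  shows "(of_nat g ^ (2 * g - 1) + (\<Sum>r<g - 1. (-1) ^ (r + 1) * of_nat ((2 * g + 1) choose (r + 1)) *
            of_nat (g - r - 1) ^ (2 * g - 1)) :: rat) > 0"
proof -
  obtain h where h: "g = Suc h" using assms by (cases g) auto
  have "euler_diff (2 * g) g > 0"
    using euler_diff_facts[of "2 * g"] assms by auto
  moreover have "euler_diff (2 * g) g = (\<Sum>j<g. (-1) ^ j * int ((2 * g + 1) choose j) * int (g - j) ^ (2 * g - 1))"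
    unfolding euler_diff_def using assms by (simp add: lessThan_Suc_atMost[symmetric])
  ultimately have "(\<Sum>j<g. (-1) ^ j * of_nat ((2 * g + 1) choose j) * of_nat (g - j) ^ (2 * g - 1) :: rat) > 0"
    using of_int_0_less_iff[where 'a = rat, of "\<Sum>j<g. (-1) ^ j * int ((2 * g + 1) choose j) * int (g - j) ^ (2 * g - 1)"]
    by simp
  moreover have "(\<Sum>j<g. (-1) ^ j * of_nat ((2 * g + 1) choose j) * of_nat (g - j) ^ (2 * g - 1) :: rat) =
     of_nat g ^ (2 * g - 1) + (\<Sum>r<g - 1. (-1) ^ (r + 1) * of_nat ((2 * g + 1) choose (r + 1)) *
            of_nat (g - r - 1) ^ (2 * g - 1))"
    unfolding h sum.lessThan_Suc_shift by simp
  ultimately show ?thesis by simp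
qed

section \<open>The Hilbert polynomial\<close>

definition sigma_poly :: "nat \<Rightarrow> rat poly" where
  "sigma_poly g = binomial_poly [:of_nat (2 * g - 1), of_nat g:] (2 * g - 1) +
     (\<Sum>r<g - 1. (-1) ^ (r + 1) * of_nat ((2 * g + 1) choose (r + 1)) *
        binomial_poly [:of_nat (2 * g - 1 - r - 1), of_nat (g - r - 1):] (2 * g - 1))"

lemma poly_binomial_poly: "poly (binomial_poly a k) x = poly a x gchoose k"
  by (simp add: binomial_poly_def poly_prod gbinomial_prod_rev lessThan_atLeast0)

text \<open>The separate first binomial is the term \<open>j = 0\<close>, and the summand
  \<open>r\<close> is the term \<open>j = r + 1\<close>. At natural arguments the polynomial
  binomials are ordinary ones.\<close>

lemma poly_sigma_poly:
  assumes "g \<ge> 1"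
  shows "poly (sigma_poly g) (of_nat t) =
    (\<Sum>j<g. (-1) ^ j * of_nat ((2 * g + 1) choose j) *
       of_nat ((t * (g - j) + (2 * g - 1 - j)) choose (2 * g - 1)))"
proof -
  obtain h where h: "g = Suc h" using assms by (cases g) auto
  have P: "poly (binomial_poly [:of_nat b, of_nat a:] k) (of_nat t) = of_nat ((t * a + b) choose k)" for a b k
    by (simp add: poly_binomial_poly binomial_gbinomial add.commute)
  have "poly (sigma_poly g) (of_nat t) = of_nat ((t * g + (2 * g - 1)) choose (2 * g - 1)) +
    (\<Sum>r<g - 1. (-1) ^ (r + 1) * of_nat ((2 * g + 1) choose (r + 1)) *
       of_nat ((t * (g - r - 1) + (2 * g - 1 - r - 1)) choose (2 * g - 1)))"
    unfolding sigma_poly_def poly_add poly_sum poly_mult P by (simp del: of_nat_add)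
  then show ?thesis unfolding h sum.lessThan_Suc_shift by simp
qed

lemma binomial_poly_coeff:
  "degree (binomial_poly [:b, a:] k) \<le> k" "coeff (binomial_poly [:b, a:] k) k = a ^ k / fact k"
proof -
  have "degree (\<Prod>i<k. [:b, a:] - [:of_nat i:]) \<le> k \<and> coeff (\<Prod>i<k. [:b, a:] - [:of_nat i:]) k = a ^ k"
  proof (induction k)
    case (Suc k)
    let ?p = "\<Prod>i<k. [:b, a:] - [:of_nat i:]"
    have e: "(\<Prod>i<Suc k. [:b, a:] - [:of_nat i:]) = [:b - of_nat k, a:] * ?p" by (simp add: mult.commute)
    have "degree ([:b - of_nat k, a:] * ?p) \<le> degree [:b - of_nat k, a:] + degree ?p" by (rule degree_mult_le)
    also have "\<dots> \<le> 1 + k" using Suc by (intro add_mono) simp_all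
    finally have "degree ([:b - of_nat k, a:] * ?p) \<le> Suc k" by simp
    moreover have "coeff ([:b - of_nat k, a:] * ?p) (Suc k) = a ^ Suc k"
      using Suc coeff_eq_0[of ?p "Suc k"] by simp
    ultimately show ?case unfolding e by blast
  qed simp
  then show "degree (binomial_poly [:b, a:] k) \<le> k" "coeff (binomial_poly [:b, a:] k) k = a ^ k / fact k"
    by (simp_all add: binomial_poly_def)
qed

text \<open>Positivity of the coefficient at \<open>2 * g - 1\<close> shows that this is the degree
  of the polynomial; the factorial then cancels the denominator of the binomials.\<close>

lemma sigma_poly_lead:
  assumes "g \<ge> 1"
  shows "fact (degree (sigma_poly g)) * lead_coeff (sigma_poly g) = of_nat g ^ (2 * g - 1) +
     (\<Sum>r<g - 1. (-1) ^ (r + 1) * of_nat ((2 * g + 1) choose (r + 1)) * of_nat (g - r - 1) ^ (2 * g - 1))"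
    (is "_ = ?D")
proof -
  let ?k = "2 * g - 1"
  let ?q = "\<lambda>r. binomial_poly [:of_nat (2 * g - 1 - r - 1), of_nat (g - r - 1):] ?k"
  have S: "(-1) ^ n * of_nat c * (p :: rat poly) = Polynomial.smult ((-1) ^ n * of_nat c) p" for n c p
  proof -
    have "(-1 :: rat poly) ^ n = [:(-1) ^ n:]" by (induction n) (simp_all add: one_pCons)
    then show ?thesis by (simp add: of_nat_poly mult.commute)
  qed
  have *: "sigma_poly g = binomial_poly [:of_nat (2 * g - 1), of_nat g:] ?k +
     (\<Sum>r<g - 1. Polynomial.smult ((-1) ^ (r + 1) * of_nat ((2 * g + 1) choose (r + 1))) (?q r))"
    unfolding sigma_poly_def S ..
  have c: "coeff (sigma_poly g) ?k = ?D / fact ?k"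
    unfolding * coeff_add coeff_sum coeff_smult binomial_poly_coeff(2)
    by (simp add: add_divide_distrib sum_divide_distrib)
  have "degree (sigma_poly g) \<le> ?k"
    unfolding * using binomial_poly_coeff(1)
    by (intro degree_add_le degree_sum_le order.trans[OF degree_smult_le]) auto
  moreover have "coeff (sigma_poly g) ?k \<noteq> 0" using c degree_number_pos[OF assms] by simp
  ultimately have "degree (sigma_poly g) = ?k" by (meson le_antisym le_degree)
  then show ?thesis using c by simp
qed

subsection \<open>Multiplicities\<close>

lemma lookup_fold_partial_deriv:
  assumes "lookup (fold partial_deriv is h) \<mu> \<noteq> 0"
  shows "\<exists>\<nu>\<in>keys h. wt (\<lambda>_. 1) \<nu> = wt (\<lambda>_. 1) \<mu> + length is"
  using assms
proof (induction "is" arbitrary: h)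
  case Nil
  then show ?case by (auto simp: in_keys_iff)
next
  case (Cons i "is")
  then obtain \<nu> where "\<nu> \<in> keys (partial_deriv i h)" "wt (\<lambda>_. 1) \<nu> = wt (\<lambda>_. 1) \<mu> + length is"
    by auto
  then have "\<nu> + single i 1 \<in> keys h" "wt (\<lambda>_. 1) (\<nu> + single i 1) = wt (\<lambda>_. 1) \<mu> + length (i # is)"
    by (auto simp: in_keys_iff lookup_partial_deriv)
  then show ?case by blast
qed

text \<open>Differentiating once for each variable of \<open>\<mu>\<close>, with multiplicity,
  carries the coefficient at \<open>\<mu>\<close> to the constant term with a positive integer
  factor.\<close>

lemma fold_partial_deriv_monomial:
  assumes "keys \<mu> \<subseteq> {..<k}"
  shows "\<exists>is. set is \<subseteq> {..<k} \<and> length is = wt (\<lambda>_. 1) \<mu> \<and>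
     (\<forall>h. lookup h \<mu> \<noteq> 0 \<longrightarrow> lookup (fold partial_deriv is h) 0 \<noteq> 0)"
  using assms
proof (induction "wt (\<lambda>_. 1) \<mu>" arbitrary: \<mu>)
  case 0
  then have "\<mu> = 0" by (simp add: wt_eq_0_iff)
  then show ?case by (intro exI[of _ "[]"]) simp
next
  case (Suc n)
  then obtain i where i: "i \<in> keys \<mu>" by (metis Zero_not_Suc ex_in_conv keys_eq_empty wt_0)
  define \<nu> where "\<nu> = \<mu> - single i 1"
  have \<mu>: "\<mu> = \<nu> + single i 1" unfolding \<nu>_def by (rule monomial_minus_single[OF i])
  have "keys \<nu> \<subseteq> keys \<mu>" by (auto simp: \<mu> in_keys_iff lookup_add)
  then obtain "is" where "is": "set is \<subseteq> {..<k}" "length is = wt (\<lambda>_. 1) \<nu>"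
    "\<And>h. lookup h \<nu> \<noteq> 0 \<Longrightarrow> lookup (fold partial_deriv is h) 0 \<noteq> 0"
    using Suc.hyps(1)[of \<nu>] Suc.hyps(2) Suc.prems by (auto simp: \<mu>)
  have "lookup (partial_deriv i h) \<nu> \<noteq> 0" if "lookup h \<mu> \<noteq> 0" for h
    using that by (simp add: lookup_partial_deriv \<mu> del: of_nat_Suc of_nat_add)
  then show ?case using "is" i Suc.prems by (intro exI[of _ "i # is"]) (auto simp: \<mu>)
qed

abbreviation translate :: "(nat \<Rightarrow> complex) \<Rightarrow> cpoly \<Rightarrow> cpoly" where
  "translate p \<equiv> subst (\<lambda>i. Var i + Cst (p i))"

lemma eval_fold_partial_deriv:
  "eval (fold partial_deriv is f) p = lookup (fold partial_deriv is (translate p f)) 0"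
proof -
  have "fold partial_deriv is (translate p f) = translate p (fold partial_deriv is f)"
    by (induction "is" arbitrary: f) (simp_all add: partial_deriv_subst_translate)
  then show ?thesis unfolding eval_at_0[symmetric] by simp
qed

lemma polys_in_add: "f \<in> polys_in m \<Longrightarrow> g \<in> polys_in m \<Longrightarrow> f + g \<in> polys_in m"
  by (rule cpoly.subspace_add[OF subspace_polys_in])

lemma translate_polys_in: "f \<in> polys_in k \<Longrightarrow> translate p f \<in> polys_in k"
  by (erule polys_in_subst_lessThan) (auto intro!: polys_in_add polys_in_Var)

text \<open>Derivatives of \<open>f\<close> at \<open>p\<close> are derivatives at 0 of the Taylor
  expansion \<open>translate p f\<close>, hence multiples of its coefficients. So multiplicity is
  the lowest degree in this expansion.\<close>

lemma has_mult_ge_iff: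
  assumes "f \<in> polys_in k"
  shows "has_mult_ge k f p m \<longleftrightarrow> translate p f \<in> graded (\<lambda>a b. b \<le> a) (\<lambda>_. 1) m"
proof
  assume L: "has_mult_ge k f p m"
  show "translate p f \<in> graded (\<lambda>a b. b \<le> a) (\<lambda>_. 1) m"
    unfolding graded_def
  proof (intro CollectI ballI)
    fix \<mu> assume \<mu>: "\<mu> \<in> keys (translate p f)"
    then have "keys \<mu> \<subseteq> {..<k}" using translate_polys_in[OF assms, of p] by (auto simp: polys_in_def)
    then obtain "is" where "is": "set is \<subseteq> {..<k}" "length is = wt (\<lambda>_. 1) \<mu>"
      "lookup (fold partial_deriv is (translate p f)) 0 \<noteq> 0"
      using fold_partial_deriv_monomial[of \<mu> k] \<mu> by (auto simp: in_keys_iff)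
    then have "\<not> length is < m" using L unfolding has_mult_ge_def eval_fold_partial_deriv by blast
    then show "m \<le> wt (\<lambda>_. 1) \<mu>" using "is" by simp
  qed
next
  assume R: "translate p f \<in> graded (\<lambda>a b. b \<le> a) (\<lambda>_. 1) m"
  show "has_mult_ge k f p m"
    unfolding has_mult_ge_def eval_fold_partial_deriv
  proof (intro allI impI, rule ccontr)
    fix "is" assume "length is < m" "lookup (fold partial_deriv is (translate p f)) 0 \<noteq> 0"
    with lookup_fold_partial_deriv[of "is" "translate p f" 0] R show False
      by (auto simp: graded_def)
  qed
qed

text \<open>By homogeneity \<open>f (x + s p) = s ^ d f (x / s + p)\<close>. The Taylor expansion at
  \<open>p\<close> has terms in degrees \<open>d\<close> and \<open>d - 1\<close> only, which
  contribute \<open>s ^ 0\<close> and \<open>s ^ 1\<close>.\<close>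

lemma eval_line_affine:
  assumes f: "f \<in> forms k d" and p: "has_mult_ge k f p (d - 1)" and d: "d \<ge> 1"
  shows "\<exists>A B. \<forall>s. s \<noteq> 0 \<longrightarrow> eval f (\<lambda>i. x i + s * p i) = A + B * s"
proof -
  have fk: "f \<in> polys_in k" "f \<in> graded (=) (\<lambda>_. 1) d" using f by (auto simp: forms_iff)
  let ?h = "translate p f"
  have "?h \<in> graded (\<lambda>a b. b \<le> a) (\<lambda>_. 1) (d - 1)" using p has_mult_ge_iff[OF fk(1)] by blast
  moreover have "?h \<in> graded (\<le>) (\<lambda>_. 1) d"
  proof (rule graded_subst[where \<delta> = "\<lambda>_. 1"])
    show "Var i + Cst (p i) \<in> graded (\<le>) (\<lambda>_. 1) 1" for i
      by (intro graded_add graded_Var graded_Cst) simp_all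
  qed (use fk(2) in \<open>auto simp: graded_def\<close>)
  ultimately have wt: "wt (\<lambda>_. 1) \<mu> = d \<or> wt (\<lambda>_. 1) \<mu> = d - 1" if "\<mu> \<in> keys ?h" for \<mu>
    using that by (fastforce simp: graded_def)
  let ?K1 = "{\<mu> \<in> keys ?h. wt (\<lambda>_. 1) \<mu> = d}" and ?K2 = "{\<mu> \<in> keys ?h. wt (\<lambda>_. 1) \<mu> = d - 1}"
  let ?c = "\<lambda>\<mu>. lookup ?h \<mu> * mono_val x \<mu>"
  have "eval f (\<lambda>i. x i + s * p i) = (\<Sum>\<mu>\<in>?K1. ?c \<mu>) + (\<Sum>\<mu>\<in>?K2. ?c \<mu>) * s" if s: "s \<noteq> 0" for s
  proof -
    have "eval f (\<lambda>i. x i + s * p i) = eval f (\<lambda>i. s * (1 / s * x i + p i))"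
      using s by (intro arg_cong[of _ _ "eval f"] ext) (simp add: field_simps)
    also have "\<dots> = s ^ d * eval ?h (\<lambda>i. (1 / s) ^ 1 * x i)"
      unfolding eval_forms_scale[OF f] by simp
    also have "\<dots> = (\<Sum>\<mu>\<in>keys ?h. s ^ d * (1 / s) ^ wt (\<lambda>_. 1) \<mu> * ?c \<mu>)"
      unfolding eval_expand mono_val_mult mono_val_power by (simp only: sum_distrib_left mult_ac)
    also have "\<dots> = (\<Sum>\<mu>\<in>?K1 \<union> ?K2. s ^ d * (1 / s) ^ wt (\<lambda>_. 1) \<mu> * ?c \<mu>)"
      by (rule sum.cong) (use wt in auto)
    also have "\<dots> = (\<Sum>\<mu>\<in>?K1. s ^ d * (1 / s) ^ wt (\<lambda>_. 1) \<mu> * ?c \<mu>) + (\<Sum>\<mu>\<in>?K2. s ^ d * (1 / s) ^ wt (\<lambda>_. 1) \<mu> * ?c \<mu>)"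
      by (rule sum.union_disjoint) (use d in auto)
    also have "(\<Sum>\<mu>\<in>?K1. s ^ d * (1 / s) ^ wt (\<lambda>_. 1) \<mu> * ?c \<mu>) = (\<Sum>\<mu>\<in>?K1. ?c \<mu>)"
      using s by (intro sum.cong) (auto simp: power_divide)
    also have "(\<Sum>\<mu>\<in>?K2. s ^ d * (1 / s) ^ wt (\<lambda>_. 1) \<mu> * ?c \<mu>) = (\<Sum>\<mu>\<in>?K2. ?c \<mu> * s)"
    proof (intro sum.cong refl)
      fix \<mu> assume "\<mu> \<in> ?K2"
      moreover have "s ^ d = s * s ^ (d - 1)" using d by (simp add: power_eq_if)
      ultimately show "s ^ d * (1 / s) ^ wt (\<lambda>_. 1) \<mu> * ?c \<mu> = ?c \<mu> * s"
        using s by (simp add: power_divide)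
    qed
    finally show ?thesis by (simp add: sum_distrib_right)
  qed
  then show ?thesis by blast
qed

text \<open>The second derivative in the variable \<open>i\<close> vanishes wherever this variable
  is not 0. Multiplying it by \<open>Var i\<close> covers the remaining points, and the ring is a
  domain.\<close>

lemma degree_le_1_of_affine:
  assumes "\<And>x. \<exists>A B. \<forall>s. s \<noteq> 0 \<longrightarrow> eval h (x(i := s)) = A + B * s"
  shows "h \<in> graded (\<le>) (\<lambda>v. if v \<in> {i} then 1 else 0) 1"
proof -
  let ?q = "partial_deriv i (partial_deriv i h)"
  have "eval (Var i * ?q) x = 0" for x
  proof (cases "x i = 0")
    case False
    obtain A B where AB: "\<And>s. s \<noteq> 0 \<Longrightarrow> eval h (x(i := s)) = A + B * s" using assms by blast
    have op: "open (UNIV - {0 :: complex})" by (intro open_Diff) auto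
    have D1: "eval (partial_deriv i h) (x(i := s)) = B" if "s \<noteq> 0" for s
    proof -
      have "((\<lambda>s. A + B * s) has_field_derivative B) (at s)" by (auto intro!: derivative_eq_intros)
      then have "((\<lambda>s. eval h (x(i := s))) has_field_derivative B) (at s)"
        by (rule has_field_derivative_transform_within_open[OF _ op]) (use that AB in auto)
      then show ?thesis using DERIV_unique has_field_derivative_eval_coordinate by blast
    qed
    have "((\<lambda>s. B) has_field_derivative 0) (at (x i))" by simp
    then have "((\<lambda>s. eval (partial_deriv i h) (x(i := s))) has_field_derivative 0) (at (x i))"
      by (rule has_field_derivative_transform_within_open[OF _ op]) (use False D1 in auto)
    from DERIV_unique[OF has_field_derivative_eval_coordinate this] show ?thesis by simp
  qed simp
  then have "Var i * ?q = 0" by (rule eval_eq_0_imp)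
  moreover have "Var i \<noteq> 0" by (rule Var_nonzero)
  ultimately have q: "?q = 0" by simp
  have "lookup \<mu> i \<le> 1" if \<mu>: "\<mu> \<in> keys h" for \<mu>
  proof (cases "lookup \<mu> i = 0")
    case False
    define \<nu> where "\<nu> = \<mu> - single i 1"
    have \<mu>\<nu>: "\<mu> = \<nu> + single i 1"
      unfolding \<nu>_def using False by (intro monomial_minus_single) (simp add: in_keys_iff)
    have "\<nu> \<in> keys (partial_deriv i h)"
      using \<mu> unfolding \<mu>\<nu> by (simp add: in_keys_iff lookup_partial_deriv del: of_nat_Suc of_nat_add)
    then have "lookup \<nu> i = 0" using partial_deriv_eq_0_imp[OF q] by blast
    then show ?thesis by (simp add: \<mu>\<nu> lookup_add)
  qed simp
  then show ?thesis unfolding graded_def wt_single_indicator by blast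
qed

subsection \<open>The linear system\<close>

text \<open>The points \<open>c 0 \<cdot> p 0, c 1 \<cdot> p 1, \<dots>\<close> are a basis with dual basis given by the rows of \<open>B\<close>, and
  \<open>p (2 * g)\<close> is the sum of the basis vectors.\<close>

locale projective_frame =
  fixes g :: nat and p :: "nat \<Rightarrow> nat \<Rightarrow> complex" and B :: "nat \<Rightarrow> nat \<Rightarrow> complex" and c :: "nat \<Rightarrow> complex"
  assumes g: "g \<ge> 1" and c: "\<And>i. i < 2 * g \<Longrightarrow> c i \<noteq> 0"
    and dual: "\<And>i k. i < 2 * g \<Longrightarrow> k < 2 * g \<Longrightarrow> (\<Sum>j<2 * g. B i j * p k j) = (if i = k then 1 / c k else 0)"
    and unit: "\<And>i. i < 2 * g \<Longrightarrow> (\<Sum>j<2 * g. B i j * p (2 * g) j) = 1"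
    and expand: "\<And>x j. j < 2 * g \<Longrightarrow> (\<Sum>i<2 * g. (\<Sum>l<2 * g. B i l * x l) * c i * p i j) = x j"
begin

text \<open>Coordinates in the basis \<open>c i p i\<close>, inverse to \<open>comb\<close>. The
  value 0 at index \<open>2 * g\<close> fixes the remaining translation of the affine line.\<close>

definition lform :: "nat \<Rightarrow> cpoly" where
  "lform i = (if i < 2 * g then (\<Sum>j<2 * g. Cst (B i j) * Var j) else 0)"

definition comb :: "(nat \<Rightarrow> complex) \<Rightarrow> nat \<Rightarrow> complex" where
  "comb u j = (\<Sum>i<2 * g. u i * c i * p i j)"

lemma eval_lform: "i < 2 * g \<Longrightarrow> eval (lform i) x = (\<Sum>j<2 * g. B i j * x j)"
  by (simp add: lform_def eval_sum)

lemma comb_lform: "j < 2 * g \<Longrightarrow> comb (\<lambda>i. eval (lform i) x) j = x j"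
  unfolding comb_def using expand[of j x] by (simp add: eval_lform)

lemma lform_comb: "i < 2 * g \<Longrightarrow> eval (lform i) (comb u) = u i"
proof -
  assume i: "i < 2 * g"
  have "eval (lform i) (comb u) = (\<Sum>j<2 * g. \<Sum>k<2 * g. B i j * (u k * c k * p k j))"
    by (simp add: eval_lform i comb_def sum_distrib_left)
  also have "\<dots> = (\<Sum>k<2 * g. u k * c k * (\<Sum>j<2 * g. B i j * p k j))"
    by (subst sum.swap) (simp add: sum_distrib_left mult_ac)
  also have "\<dots> = (\<Sum>k<2 * g. if k = i then u i else 0)"
    using dual i c by (intro sum.cong refl) auto
  finally show ?thesis using i by simp
qed

lemma p_last: "j < 2 * g \<Longrightarrow> comb (\<lambda>_. 1) j = p (2 * g) j"
  using comb_lform[of j "p (2 * g)"] unfolding comb_def by (simp add: eval_lform unit)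

lemma lform_polys_in: "lform i \<in> polys_in (2 * g)"
  unfolding lform_def
  by (auto intro!: cpoly.subspace_sum[OF subspace_polys_in] polys_in_mult polys_in_Var simp: cpoly.subspace_0[OF subspace_polys_in])

lemma lform_graded: "lform i \<in> graded (=) (\<lambda>_. 1) 1"
  unfolding lform_def by (auto intro!: graded_sum graded_Cst_mult graded_Var)

text \<open>The affine chart of the quotient: \<open>x\<close> goes to the points \<open>(l\<^sub>i(x) : 1)\<close>, \<open>(0 : 1)\<close> and infinity.\<close>

definition \<theta> :: "cpoly \<Rightarrow> cpoly" where
  "\<theta> F = subst lform (subst (dehom (2 * g + 1)) F)"

lemma \<theta>_simps [simp]: "\<theta> (F + G) = \<theta> F + \<theta> G" "\<theta> (F * G) = \<theta> F * \<theta> G" "\<theta> (Cst a) = Cst a"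
  "\<theta> (cscale a F) = cscale a (\<theta> F)" "\<theta> 1 = 1" "\<theta> 0 = 0" "\<theta> (F - G) = \<theta> F - \<theta> G"
  by (simp_all add: \<theta>_def)

lemma \<theta>_subst: "\<theta> (subst \<sigma> G) = subst (\<lambda>i. \<theta> (\<sigma> i)) G"
  by (simp add: \<theta>_def subst_subst)

lemma linear_\<theta>: "Vector_Spaces.linear cscale cscale \<theta>"
  by unfold_locales simp_all

text \<open>A translation brings the last variable to 0, and every argument of this kind is reached
  by \<open>lform\<close>.\<close>

lemma subst_lform_inj:
  assumes h: "h \<in> tinv (2 * g + 1) D s" and 0: "subst lform h = 0"
  shows "h = 0"
proof (rule eval_eq_0_imp)
  fix u :: "nat \<Rightarrow> complex"
  let ?w = "\<lambda>i. u i + - u (2 * g)"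
  have "\<forall>x c. eval h (\<lambda>i. x i + c) = eval h x" using h unfolding tinv_def by blast
  then have "eval h u = eval h ?w" by (rule allE[of _ u]) (erule allE[of _ "- u (2 * g)"], simp only:)
  also have "\<dots> = eval h (\<lambda>i. eval (lform i) (comb ?w))"
  proof (rule eval_cong_polys_in)
    show "h \<in> polys_in (2 * g + 1)" using h by (simp add: tinv_def)
    fix i assume "i < 2 * g + 1"
    then consider "i < 2 * g" | "i = 2 * g" by linarith
    then show "?w i = eval (lform i) (comb ?w)"
      by cases (simp_all add: lform_comb, simp add: lform_def)
  qed
  also have "\<dots> = eval (subst lform h) (comb ?w)" by simp
  finally show "eval h u = 0" using 0 by simp
qed

lemma edge_count: "2 * (g * t) + t = (2 * g + 1) * t"
  by simp

lemma \<theta>_inj: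
  assumes F: "F \<in> invariant_sections (2 * g + 2) t" and "\<theta> F = 0"
  shows "F = 0"
proof -
  have F': "F \<in> invariant_sections (Suc (2 * g + 1)) t" using F by simp
  show ?thesis
    by (rule subst_dehom_inj[OF F'], rule subst_lform_inj[OF invariant_subst_dehom[OF F' edge_count]])
       (use assms(2) in \<open>simp add: \<theta>_def\<close>)
qed

text \<open>At \<open>p k\<close> with \<open>k < 2 * g\<close> all forms other than the
  \<open>k\<close>-th vanish; at \<open>p (2 * g)\<close> the first \<open>2 * g\<close> of them
  share the value 1.\<close>

lemma lform_vanish:
  assumes "a < 2 * g + 1" "b < 2 * g + 1" "k < 2 * g + 1" "a \<noteq> k" "b \<noteq> k"
  shows "eval (lform a - lform b) (p k) = 0"
proof (cases "k = 2 * g")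
  case True
  then have "a < 2 * g" "b < 2 * g" using assms by auto
  then show ?thesis using True by (simp add: eval_lform unit)
next
  case False
  then have k: "k < 2 * g" using assms by simp
  have "eval (lform i) (p k) = 0" if "i < 2 * g + 1" "i \<noteq> k" for i
  proof (cases "i < 2 * g")
    case True
    then show ?thesis using that k by (simp add: eval_lform dual)
  qed (simp add: lform_def)
  then show ?thesis using assms by simp
qed

text \<open>An edge avoiding \<open>k\<close> gives a factor that vanishes at \<open>p k\<close>,
  and at most one of the \<open>g\<close> edges meets \<open>k\<close>.\<close>

lemma subst_lform_dprod_mult:
  assumes E: "E \<in> graphs (2 * g + 1) (\<lambda>_. 1) g" and k: "k < 2 * g + 1"
  shows "has_mult_ge (2 * g) (subst lform (dprod E)) (p k) (g - 1)"
proof -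
  let ?Q = "\<lambda>a b. b \<le> (a :: nat)"
  let ?F = "filter_mset (\<lambda>e. fst e \<noteq> k \<and> snd e \<noteq> k)"
  have "translate (p k) (subst lform (dprod E)) \<in> graded ?Q (\<lambda>_. 1) (size (?F E))"
    if "set_mset E \<subseteq> {..<2 * g + 1} \<times> {..<2 * g + 1}" for E
    using that
  proof (induction E)
    case empty
    then show ?case by (simp add: graded_1)
  next
    case (add e E)
    let ?l = "lform (fst e) - lform (snd e)"
    have "translate (p k) ?l \<in> graded ?Q (\<lambda>_. 1) (if fst e \<noteq> k \<and> snd e \<noteq> k then 1 else 0)"
    proof (cases "fst e \<noteq> k \<and> snd e \<noteq> k")
      case True
      have "eval ?l (p k) = 0" using True k add.prems by (intro lform_vanish) auto
      then have "lookup (translate (p k) ?l) 0 = 0" by (simp flip: eval_at_0)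
      have "wt (\<lambda>_. 1) \<mu> \<ge> 1" if "\<mu> \<in> keys (translate (p k) ?l)" for \<mu>
      proof (rule ccontr)
        assume "\<not> 1 \<le> wt (\<lambda>_. 1) \<mu>"
        then have "keys \<mu> = {}" using wt_eq_0_iff[of "\<lambda>_. 1" \<mu>] by auto
        then have "\<mu> = 0" by simp
        with that \<open>lookup (translate (p k) ?l) 0 = 0\<close> show False by (simp add: in_keys_iff)
      qed
      then show ?thesis using True by (auto simp: graded_def)
    next
      case False
      then show ?thesis by (simp only: if_False) (simp add: graded_def)
    qed
    from graded_mult[OF _ this add.IH] add.prems
    have "translate (p k) (subst lform (dprod (add_mset e E))) \<in> graded ?Q (\<lambda>_. 1)
        ((if fst e \<noteq> k \<and> snd e \<noteq> k then 1 else 0) + size (?F E))" by simp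
    moreover have "size (?F (add_mset e E)) = (if fst e \<noteq> k \<and> snd e \<noteq> k then 1 else 0) + size (?F E)"
      by simp
    ultimately show ?case by (simp only:)
  qed
  moreover have "set_mset E \<subseteq> {..<2 * g + 1} \<times> {..<2 * g + 1}" using E by (simp add: graphs_def)
  moreover have "g - 1 \<le> size (?F E)"
  proof -
    have "size E \<le> size (?F E) + vdeg E k" by (induction E) auto
    then show ?thesis using E k by (fastforce simp: graphs_def)
  qed
  ultimately have "translate (p k) (subst lform (dprod E)) \<in> graded ?Q (\<lambda>_. 1) (g - 1)"
    by (auto simp: graded_def intro: order_trans)
  moreover have "subst lform (dprod E) \<in> polys_in (2 * g)"
    by (rule polys_in_subst) (rule lform_polys_in)
  ultimately show ?thesis using has_mult_ge_iff by blast
qed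

lemma subspace_lin_system: "cpoly.subspace (lin_system g p)"
proof -
  have "lin_system g p = forms (2 * g) g \<inter> (\<Inter>i\<in>{..<2 * g + 1}. {f \<in> polys_in (2 * g). translate (p i) f \<in> graded (\<lambda>a b. b \<le> a) (\<lambda>_. 1) (g - 1)})"
    unfolding lin_system_def using has_mult_ge_iff by (auto simp: forms_iff)
  moreover have "cpoly.subspace {f \<in> polys_in (2 * g). translate (p i) f \<in> graded (\<lambda>a b. b \<le> a) (\<lambda>_. 1) (g - 1)}" for i
    using subspace_polys_in[of "2 * g"] subspace_graded[of "\<lambda>a b. b \<le> a" "\<lambda>_. 1" "g - 1"]
    by (auto simp: cpoly.subspace_def)
  ultimately show ?thesis
    using subspace_forms by (metis (no_types, lifting) cpoly.subspace_Int cpoly.subspace_inter)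
qed

text \<open>Graph monomials lie in the linear system by counting factors. Conversely a form
  \<open>f\<close> is pulled back along \<open>u \<mapsto> comb (u - u (2 * g))\<close>, which is
  translation invariant. Changing a single \<open>u i\<close> moves the argument of \<open>f\<close>
  in the direction \<open>p i\<close>, so the multiplicity at \<open>p i\<close> bounds the degree
  in this variable by 1.\<close>

lemma \<theta>_image: "\<theta> ` invariant_sections (2 * g + 2) 1 = lin_system g p"
proof
  have S: "2 * g + 1 = (2 * g + 1) * (1 :: nat)" by simp
  have im: "subst (dehom (2 * g + 1)) ` invariant_sections (2 * g + 2) 1 = tinv (2 * g + 1) (\<lambda>_. 1) g"
    using subst_dehom_image[OF S] by simp
  have \<theta>: "\<theta> ` invariant_sections (2 * g + 2) 1 = subst lform ` tinv (2 * g + 1) (\<lambda>_. 1) g"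
    unfolding im[symmetric] by (simp add: \<theta>_def image_image)
  show "\<theta> ` invariant_sections (2 * g + 2) 1 \<subseteq> lin_system g p"
    unfolding \<theta> tinv_eq_span linear_span_image[OF linear_subst]
  proof (intro cpoly.span_minimal subspace_lin_system, safe)
    fix E assume E: "E \<in> graphs (2 * g + 1) (\<lambda>_. 1) g"
    have "dprod E \<in> graded (=) (\<lambda>_. 1) g" using dprod_graphs[OF E] by (simp add: tinv_def)
    then have "subst lform (dprod E) \<in> graded (=) (\<lambda>_. 1) g"
      by (intro graded_subst[OF _ lform_graded]) (auto simp: graded_def)
    moreover have "subst lform (dprod E) \<in> polys_in (2 * g)"
      by (rule polys_in_subst) (rule lform_polys_in)
    ultimately show "subst lform (dprod E) \<in> lin_system g p"
      using subst_lform_dprod_mult[OF E] by (simp add: lin_system_def forms_iff)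
  qed
  show "lin_system g p \<subseteq> \<theta> ` invariant_sections (2 * g + 2) 1"
  proof
    fix f assume "f \<in> lin_system g p"
    then have f: "f \<in> forms (2 * g) g" and mult: "\<And>i. i < 2 * g + 1 \<Longrightarrow> has_mult_ge (2 * g) f (p i) (g - 1)"
      by (auto simp: lin_system_def)
    have fk: "f \<in> polys_in (2 * g)" "f \<in> graded (=) (\<lambda>_. 1) g" using f by (auto simp: forms_iff)
    let ?m = "2 * g + 1"
    let ?\<sigma> = "\<lambda>j. \<Sum>i<2 * g. Cst (c i * p i j) * (Var i - Var (2 * g))"
    define h where "h = subst ?\<sigma> f"
    have eh: "eval h u = eval f (comb (\<lambda>i. u i - u (2 * g)))" for u
    proof -
      have "eval (?\<sigma> j) u = comb (\<lambda>i. u i - u (2 * g)) j" for j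
        by (simp add: eval_sum comb_def mult_ac)
      then show ?thesis by (simp add: h_def)
    qed
    have "h \<in> polys_in ?m"
      unfolding h_def
      by (intro polys_in_subst cpoly.subspace_sum[OF subspace_polys_in] polys_in_mult polys_in_diff polys_in_Var) auto
    moreover have "h \<in> graded (=) (\<lambda>_. 1) g"
      unfolding h_def
    proof (rule graded_subst[where \<delta> = "\<lambda>_. 1"])
      show "?\<sigma> j \<in> graded (=) (\<lambda>_. 1) 1" for j
        by (intro graded_sum graded_Cst_mult graded_diff graded_Var) simp_all
    qed (use fk(2) in \<open>auto simp: graded_def\<close>)
    moreover have "eval h (\<lambda>i. u i + a) = eval h u" for u a by (simp add: eh)
    moreover have "h \<in> graded (\<le>) (\<lambda>v. if v \<in> {i} then 1 else 0) 1" if i_less: "i < ?m" for i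
    proof (rule degree_le_1_of_affine)
      fix u :: "nat \<Rightarrow> complex"
      let ?u0 = "u(i := 0)"
      let ?y = "comb (\<lambda>k. ?u0 k - ?u0 (2 * g))"
      \<comment> \<open>Increasing \<open>u (2 * g)\<close> subtracts the sum of all basis vectors,
        which is \<open>p (2 * g)\<close>; hence the factor -1.\<close>
      let ?a = "if i < 2 * g then c i else - 1"
      obtain A A' where A: "\<And>s. s \<noteq> 0 \<Longrightarrow> eval f (\<lambda>j. ?y j + s * p i j) = A + A' * s"
        using eval_line_affine[OF f mult[OF i_less] g] by blast
      have "eval h (u(i := s)) = A + (A' * ?a) * s" if "s \<noteq> 0" for s
      proof -
        have "eval h (u(i := s)) = eval f (\<lambda>j. ?y j + (s * ?a) * p i j)"
          unfolding eh
        proof (rule eval_cong_polys_in[OF fk(1)])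
          fix j assume j: "j < 2 * g"
          show "comb (\<lambda>k. (u(i := s)) k - (u(i := s)) (2 * g)) j = ?y j + s * ?a * p i j"
          proof (cases "i < 2 * g")
            case True
            have "comb (\<lambda>k. (u(i := s)) k - (u(i := s)) (2 * g)) j
              = (\<Sum>k<2 * g. (?u0 k - ?u0 (2 * g)) * c k * p k j + (if k = i then s * c i * p i j else 0))"
              unfolding comb_def using True by (intro sum.cong refl) (auto simp: algebra_simps)
            then show ?thesis using True by (simp add: sum.distrib comb_def)
          next
            case False
            then have i: "i = 2 * g" using \<open>i < ?m\<close> by simp
            have "comb (\<lambda>k. (u(i := s)) k - (u(i := s)) (2 * g)) j
              = (\<Sum>k<2 * g. (?u0 k - ?u0 (2 * g)) * c k * p k j - s * (1 * c k * p k j))"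
              unfolding comb_def using i by (intro sum.cong refl) (auto simp: algebra_simps)
            also have "\<dots> = ?y j - s * comb (\<lambda>_. 1) j"
              unfolding comb_def sum_subtractf sum_distrib_left ..
            finally show ?thesis using i p_last[OF j] by simp
          qed
        qed
        also have "\<dots> = A + A' * (s * ?a)" by (rule A) (use c that in auto)
        finally show ?thesis by simp
      qed
      then show "\<exists>A B. \<forall>s. s \<noteq> 0 \<longrightarrow> eval h (u(i := s)) = A + B * s" by blast
    qed
    ultimately have "h \<in> tinv ?m (\<lambda>_. 1) g" by (simp add: tinv_def)
    moreover have "subst lform h = f"
    proof (rule eval_eqI)
      fix x
      have "eval (subst lform h) x = eval f (comb (\<lambda>i. eval (lform i) x - eval (lform (2 * g)) x))"
        by (simp add: eh)
      also have "\<dots> = eval f x"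
        by (rule eval_cong_polys_in[OF fk(1)]) (use comb_lform[of _ x] in \<open>simp add: lform_def[of "2 * g"]\<close>)
      finally show "eval (subst lform h) x = eval f x" .
    qed
    ultimately show "f \<in> \<theta> ` invariant_sections (2 * g + 2) 1" unfolding \<theta> by blast
  qed
qed

lemma dim_lin_system: "cpoly.dim (lin_system g p) = cpoly.dim (invariant_sections (2 * g + 2) 1)"
proof -
  obtain B where "finite B" "invariant_sections (2 * g + 2) 1 \<subseteq> cpoly.span B"
    using finite_dim_invariant_sections .
  then have "cpoly.dim (\<theta> ` invariant_sections (2 * g + 2) 1) = cpoly.dim (invariant_sections (2 * g + 2) 1)"
    by (rule dim_image_inj[OF subspace_invariant_sections _ _ linear_\<theta>]) (use \<theta>_inj in blast)
  then show ?thesis by (simp only: \<theta>_image)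
qed

end

subsection \<open>The image of the linear system\<close>

text \<open>Equality of points, open sets and regular functions are all defined through homogeneous
  functions, so it is enough that these pull back with the same degree.\<close>

lemma morphism_of_pullback:
  assumes pts: "\<phi> ` points M \<subseteq> points N"
    and pb: "\<And>d b. b \<in> hfuns N d \<Longrightarrow> \<exists>a\<in>hfuns M d. \<forall>x\<in>points M. b (\<phi> x) = a x"
  shows "morphism M N \<phi>"
proof -
  have same: "same_point N (\<phi> x) (\<phi> y)"
    if xy: "x \<in> points M" "y \<in> points M" "same_point M x y" for x y
  proof -
    obtain c where c: "c \<noteq> 0" "\<And>d a. a \<in> hfuns M d \<Longrightarrow> a y = c ^ d * a x"
      using xy(3) by (auto simp: same_point_def)
    have "b (\<phi> y) = c ^ d * b (\<phi> x)" if b: "b \<in> hfuns N d" for d b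
    proof -
      obtain a where "a \<in> hfuns M d" "\<forall>x\<in>points M. b (\<phi> x) = a x" using pb[OF b] by blast
      then show ?thesis using c(2)[of a d] xy(1,2) by simp
    qed
    then show ?thesis using c(1) unfolding same_point_def by blast
  qed
  have opn: "zariski_open M (points M \<inter> \<phi> -` U)" if U: "zariski_open N U" for U
  proof -
    obtain T where T: "T \<subseteq> (\<Union>d. hfuns N d)" "U = {x \<in> points N. \<exists>a\<in>T. a x \<noteq> 0}"
      using U by (auto simp: zariski_open_def)
    let ?T = "{a. \<exists>d. a \<in> hfuns M d \<and> (\<exists>b\<in>T. \<forall>x\<in>points M. b (\<phi> x) = a x)}"
    have "points M \<inter> \<phi> -` U = {x \<in> points M. \<exists>a\<in>?T. a x \<noteq> 0}"
    proof (rule Set.set_eqI, rule iffI)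
      fix x assume x: "x \<in> points M \<inter> \<phi> -` U"
      then obtain b where b: "b \<in> T" "b (\<phi> x) \<noteq> 0" using T(2) by auto
      then obtain d where "b \<in> hfuns N d" using T(1) by blast
      then obtain a where "a \<in> hfuns M d" "\<forall>x\<in>points M. b (\<phi> x) = a x" using pb by blast
      then show "x \<in> {x \<in> points M. \<exists>a\<in>?T. a x \<noteq> 0}" using x b by auto
    next
      fix x assume "x \<in> {x \<in> points M. \<exists>a\<in>?T. a x \<noteq> 0}"
      then obtain a b where "x \<in> points M" "a x \<noteq> 0" "b \<in> T" "b (\<phi> x) = a x" by blast
      moreover from this have "b (\<phi> x) \<noteq> 0" by simp
      ultimately have "\<phi> x \<in> points N" "\<exists>b\<in>T. b (\<phi> x) \<noteq> 0" using pts by blast+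
      then show "x \<in> points M \<inter> \<phi> -` U" using T(2) \<open>x \<in> points M\<close> by simp
    qed
    then show ?thesis unfolding zariski_open_def by (intro exI[of _ ?T]) auto
  qed
  have reg: "regular_on M (points M \<inter> \<phi> -` U) (u \<circ> \<phi>)" if "regular_on N U u" for U u
    unfolding regular_on_def
  proof
    fix x assume x: "x \<in> points M \<inter> \<phi> -` U"
    then obtain W d a b where W: "zariski_open N W" "\<phi> x \<in> W" "a \<in> hfuns N d" "b \<in> hfuns N d"
      "\<forall>y\<in>W \<inter> U. b y \<noteq> 0 \<and> u y = a y / b y"
      using \<open>regular_on N U u\<close> unfolding regular_on_def by blast
    obtain a' b' where ab: "a' \<in> hfuns M d" "\<forall>x\<in>points M. a (\<phi> x) = a' x"
      "b' \<in> hfuns M d" "\<forall>x\<in>points M. b (\<phi> x) = b' x"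
      using pb W(3,4) by metis
    have *: "\<forall>y\<in>(points M \<inter> \<phi> -` W) \<inter> (points M \<inter> \<phi> -` U). b' y \<noteq> 0 \<and> (u \<circ> \<phi>) y = a' y / b' y"
    proof
      fix y assume y: "y \<in> (points M \<inter> \<phi> -` W) \<inter> (points M \<inter> \<phi> -` U)"
      then have "b (\<phi> y) \<noteq> 0 \<and> u (\<phi> y) = a (\<phi> y) / b (\<phi> y)" using W(5) by blast
      moreover have "a (\<phi> y) = a' y" "b (\<phi> y) = b' y" using ab y by blast+
      ultimately show "b' y \<noteq> 0 \<and> (u \<circ> \<phi>) y = a' y / b' y" by simp
    qed
    show "\<exists>W d. zariski_open M W \<and> x \<in> W \<and> (\<exists>a\<in>hfuns M d. \<exists>b\<in>hfuns M d.
        \<forall>y\<in>W \<inter> (points M \<inter> \<phi> -` U). b y \<noteq> 0 \<and> (u \<circ> \<phi>) y = a y / b y)"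
      by (intro exI[of _ "points M \<inter> \<phi> -` W"] exI[of _ d] conjI bexI[of _ a'] bexI[of _ b'])
         (use opn[OF W(1)] W(2) x ab * in blast)+
  qed
  show ?thesis unfolding morphism_def using pts same opn reg by blast
qed

lemma one_forms: "1 \<in> forms n 0"
  by (simp add: forms_iff graded_1 polys_in_graded)

lemma Var_forms: "j < n \<Longrightarrow> Var j \<in> forms n 1"
  by (simp add: forms_iff graded_Var polys_in_Var)

lemma forms_mult: "G \<in> forms n s \<Longrightarrow> H \<in> forms n t \<Longrightarrow> G * H \<in> forms n (s + t)"
  by (simp add: forms_iff graded_mult polys_in_mult)

text \<open>Each monomial shows its degree in the first point. Needed for preimages that are chosen
  without fixing their degree.\<close>

lemma invariant_sections_disjoint:
  assumes "F \<in> invariant_sections n s" "F \<in> invariant_sections n t" "s \<noteq> t" "n > 0"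
  shows "F = 0"
proof (rule ccontr)
  assume "F \<noteq> 0"
  then obtain \<mu> where "\<mu> \<in> keys F" by (metis ex_in_conv keys_eq_empty)
  then show False
    using invariant_sectionsD(3)[OF assms(1), of 0] invariant_sectionsD(3)[OF assms(2), of 0] assms(3,4)
    by (auto simp: graded_def)
qed

lemma invariant_sections_1_nonzero: "\<exists>F\<in>invariant_sections (2 * g + 2) 1. F \<noteq> 0"
proof
  let ?M = "image_mset (\<lambda>i. (2 * i, 2 * i + 1)) (mset_set {..<g + 1})"
  have "vdeg ?M k = 1" if "k < 2 * g + 2" for k
  proof -
    have "image_mset fst ?M = mset_set ((\<lambda>i. 2 * i) ` {..<g + 1})"
      "image_mset snd ?M = mset_set ((\<lambda>i. 2 * i + 1) ` {..<g + 1})"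
      by (simp_all add: image_mset.compositionality comp_def image_mset_mset_set[symmetric] inj_on_def)
    moreover have "k \<in> (\<lambda>i. 2 * i) ` {..<g + 1} \<longleftrightarrow> even k"
      using that by (auto elim!: evenE)
    moreover have "k \<in> (\<lambda>i. 2 * i + 1) ` {..<g + 1} \<longleftrightarrow> odd k"
      using that by (auto elim!: oddE)
    ultimately show ?thesis by (simp add: vdeg_def count_mset_set')
  qed
  then have "?M \<in> regs (2 * g + 2) 1" by (auto simp: regs_def)
  then show "brprod ?M \<in> invariant_sections (2 * g + 2) 1" by (rule brprod_invariant)
  have "br (2 * i) (2 * i + 1) \<noteq> 0" for i by (rule br_nonzero) simp
  then show "brprod ?M \<noteq> 0"
    by (auto simp: brprod_def prod_mset_zero_iff image_mset.compositionality comp_def)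
qed

locale linear_system_basis = projective_frame +
  fixes n :: nat and s :: "nat \<Rightarrow> cpoly"
  assumes basis: "is_basis n s (lin_system g p)"
begin

abbreviation "R t \<equiv> invariant_sections (2 * g + 2) t"

text \<open>Lifts of the basis to invariants of degree one; \<open>subst r\<close> presents the ring
  of invariants by forms in \<open>n\<close> variables.\<close>

definition r :: "nat \<Rightarrow> cpoly" where
  "r j = (if j < n then (SOME F. F \<in> R 1 \<and> \<theta> F = s j) else 0)"

lemma s_lin_system: "j < n \<Longrightarrow> s j \<in> lin_system g p"
  using basis cpoly.span_base[of "s j" "s ` {..<n}"] by (auto simp: is_basis_def)

lemma r: "j < n \<Longrightarrow> r j \<in> R 1" "j < n \<Longrightarrow> \<theta> (r j) = s j"
proof -
  assume j: "j < n"
  then have "\<exists>F. F \<in> R 1 \<and> \<theta> F = s j" using s_lin_system[OF j] \<theta>_image by (metis imageE)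
  from someI_ex[OF this] j show "r j \<in> R 1" "\<theta> (r j) = s j" by (simp_all add: r_def)
qed

lemma r_R: "r j \<in> R 1"
  using r(1)[of j] cpoly.subspace_0[OF subspace_invariant_sections] by (cases "j < n") (auto simp: r_def)

lemma r_power: "r j ^ k \<in> R k"
proof (induction k)
  case (Suc k)
  then show ?case using invariant_sections_mult[OF r_R Suc] by simp
qed (simp add: one_invariant)

lemma prod_R: "(\<And>i. i \<in> I \<Longrightarrow> F i \<in> R (d i)) \<Longrightarrow> (\<Prod>i\<in>I. F i) \<in> R (\<Sum>i\<in>I. d i)"
  by (induction I rule: infinite_finite_induct) (auto intro!: invariant_sections_mult simp: one_invariant)

lemma mono_val_r: "mono_val r \<mu> \<in> R (wt (\<lambda>_. 1) \<mu>)"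
  unfolding mono_val_def wt_def by (intro prod_R) (simp only: mult_1 r_power)

lemma subst_r: "G \<in> forms n t \<Longrightarrow> subst r G \<in> R t"
  unfolding subst_expand
proof (intro cpoly.subspace_sum[OF subspace_invariant_sections])
  fix \<mu> assume "G \<in> forms n t" "\<mu> \<in> keys G"
  then have "wt (\<lambda>_. 1) \<mu> = t" by (auto simp: forms_iff graded_def)
  then have "mono_val r \<mu> \<in> R t" using mono_val_r[of \<mu>] by simp
  then show "Cst (lookup G \<mu>) * mono_val r \<mu> \<in> R t"
    using cpoly.subspace_scale[OF subspace_invariant_sections] by (simp add: cscale_Cst)
qed

lemma subspace_subst_r_forms: "cpoly.subspace (subst r ` forms n t)"
proof -
  have "forms n t = cpoly.span (forms n t)" using subspace_forms cpoly.span_eq_iff by metis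
  then have "subst r ` forms n t = cpoly.span (subst r ` forms n t)"
    using linear_span_image[OF linear_subst] by metis
  then show ?thesis using cpoly.subspace_span by metis
qed

lemma R_1_subset: "R 1 \<subseteq> subst r ` forms n 1"
proof
  fix F assume F: "F \<in> R 1"
  have "\<theta> F \<in> lin_system g p" using F \<theta>_image by blast
  also have "lin_system g p = cpoly.span (s ` {..<n})" using basis by (simp add: is_basis_def)
  also have "s ` {..<n} = \<theta> ` r ` {..<n}" using r(2) by (auto simp: image_image)
  finally have "\<theta> F \<in> \<theta> ` cpoly.span (r ` {..<n})" by (simp add: linear_span_image[OF linear_\<theta>])
  then obtain F' where F': "F' \<in> cpoly.span (r ` {..<n})" "\<theta> F = \<theta> F'" by blast
  have "cpoly.span (r ` {..<n}) \<subseteq> R 1"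
    by (intro cpoly.span_minimal subspace_invariant_sections) (use r(1) in blast)
  then have "F - F' \<in> R 1"
    using F F'(1) cpoly.subspace_diff[OF subspace_invariant_sections] by blast
  then have "F - F' = 0" by (rule \<theta>_inj) (simp add: F'(2))
  then have "F \<in> cpoly.span (r ` {..<n})" using F'(1) by simp
  also have "\<dots> \<subseteq> subst r ` forms n 1"
  proof (intro cpoly.span_minimal subspace_subst_r_forms subsetI)
    fix f assume "f \<in> r ` {..<n}"
    then obtain j where "j < n" "f = subst r (Var j)" by auto
    then show "f \<in> subst r ` forms n 1" using Var_forms by blast
  qed
  finally show "F \<in> subst r ` forms n 1" .
qed

text \<open>In degree one this comes from \<open>\<theta>_image\<close> and the injectivity of
  \<open>\<theta>\<close>; \<open>kempe\<close> carries it to all higher degrees.\<close>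

lemma subst_r_forms: "subst r ` forms n t = R t"
proof
  show "subst r ` forms n t \<subseteq> R t" using subst_r by blast
  show "R t \<subseteq> subst r ` forms n t"
  proof (induction t)
    case 0
    show ?case
    proof
      fix F assume "F \<in> R 0"
      then obtain a where a: "F = Cst a" by (rule invariant_sections_0)
      have "Cst a \<in> forms n 0" by (simp add: forms_iff graded_Cst)
      then show "F \<in> subst r ` forms n 0" using a by (metis image_eqI subst_Cst)
    qed
  next
    case (Suc t)
    show ?case unfolding kempe
    proof (intro cpoly.span_minimal subspace_subst_r_forms, safe)
      fix a b assume "a \<in> R 1" "b \<in> R t"
      then obtain G H where "G \<in> forms n 1" "a = subst r G" "H \<in> forms n t" "b = subst r H"
        using R_1_subset Suc by blast
      then show "a * b \<in> subst r ` forms n (Suc t)"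
        using forms_mult[of G n 1 H t] by (metis image_eqI plus_1_eq_Suc subst_mult)
    qed
  qed
qed

lemma n_pos: "n > 0"
proof (rule ccontr)
  assume "\<not> n > 0"
  then have "lin_system g p = {0}" using basis by (simp add: is_basis_def)
  then have "\<theta> F = 0" if "F \<in> R 1" for F using that \<theta>_image by blast
  then show False using invariant_sections_1_nonzero \<theta>_inj by blast
qed

lemma s_0_nonzero: "s 0 \<noteq> 0"
  using basis n_pos cpoly.dependent_zero unfolding is_basis_def by (metis image_eqI lessThan_iff)

definition img :: "(nat \<Rightarrow> complex) set" where
  "img = hcoords n \<inter> (\<lambda>x j. if j < n then eval (s j) x else 0) ` hcoords (2 * g)"

lemma image_closure_img: "image_closure (2 * g) n s = zariski_closure n img"
  by (simp add: image_closure_def img_def)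

lemma subst_s: "G \<in> forms n t \<Longrightarrow> subst s G = \<theta> (subst r G)"
  unfolding \<theta>_subst by (rule subst_cong_polys_in[of _ n]) (simp_all add: forms_iff r)

text \<open>Every vector with \<open>s 0\<close> nonzero gives a point of the image, and multiplying
  by \<open>s 0\<close> extends the vanishing of \<open>subst s G\<close> to all vectors.
  Injectivity of \<open>\<theta>\<close> on invariants then passes from \<open>subst s G\<close> to
  \<open>subst r G\<close>.\<close>

lemma vanishing_forms_img: "vanishing_forms n img t = {G \<in> forms n t. subst r G = 0}"
proof (rule Set.set_eqI, rule iffI)
  fix G assume "G \<in> vanishing_forms n img t"
  then have G: "G \<in> forms n t" "\<And>y. y \<in> img \<Longrightarrow> eval G y = 0" by (auto simp: vanishing_forms_def)
  have "eval (s 0 * subst s G) x = 0" for x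
  proof (cases "eval (s 0) x = 0")
    case False
    let ?x = "\<lambda>j. if j < 2 * g then x j else 0"
    have s: "s j \<in> forms (2 * g) g" if "j < n" for j using s_lin_system[OF that] by (simp add: lin_system_def)
    have e: "eval (s j) ?x = eval (s j) x" if "j < n" for j
      by (rule eval_cong_polys_in[of _ "2 * g"]) (use s[OF that] in \<open>auto simp: forms_iff\<close>)
    \<comment> \<open>A form of positive degree \<open>g\<close> vanishes at the zero vector, while
      \<open>s 0\<close> does not vanish here.\<close>
    have "?x \<in> hcoords (2 * g)"
    proof (rule ccontr)
      assume "?x \<notin> hcoords (2 * g)"
      then have "?x = (\<lambda>i. 0 * x i)" by (auto simp: hcoords_def)
      then have "eval (s 0) ?x = 0 ^ g * eval (s 0) x" using eval_forms_scale[OF s[OF n_pos]] by metis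
      then have "eval (s 0) ?x = 0" using g by (simp add: power_0_left)
      then show False using False e[OF n_pos] by simp
    qed
    moreover have "(\<lambda>j. if j < n then eval (s j) ?x else 0) \<in> hcoords n"
      using False e[OF n_pos] n_pos unfolding hcoords_def
      by (intro CollectI conjI allI impI exI[of _ 0]) simp_all
    ultimately have "(\<lambda>j. if j < n then eval (s j) ?x else 0) \<in> img" by (auto simp: img_def)
    from G(2)[OF this] have "eval G (\<lambda>j. if j < n then eval (s j) ?x else 0) = 0" .
    also have "eval G (\<lambda>j. if j < n then eval (s j) ?x else 0) = eval G (\<lambda>j. eval (s j) x)"
      by (rule eval_cong_polys_in[of _ n]) (use G(1) e in \<open>auto simp: forms_iff\<close>)
    finally show ?thesis by simp
  qed simp
  then have "s 0 * subst s G = 0" by (rule eval_eq_0_imp)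
  then have "\<theta> (subst r G) = 0" using s_0_nonzero subst_s[OF G(1)] by simp
  then have "subst r G = 0" using \<theta>_inj subst_r[OF G(1)] by blast
  then show "G \<in> {G \<in> forms n t. subst r G = 0}" using G(1) by simp
next
  fix G assume "G \<in> {G \<in> forms n t. subst r G = 0}"
  then have G: "G \<in> forms n t" "subst s G = 0" using subst_s by auto
  have "eval G y = 0" if y_img: "y \<in> img" for y
  proof -
    obtain x where y: "y = (\<lambda>j. if j < n then eval (s j) x else 0)" using y_img unfolding img_def by blast
    have "eval G y = eval G (\<lambda>j. eval (s j) x)"
      by (rule eval_cong_polys_in[of _ n]) (use G(1) y in \<open>auto simp: forms_iff\<close>)
    also have "\<dots> = eval (subst s G) x" by simp
    finally show ?thesis using G(2) by simp
  qed
  then show "G \<in> vanishing_forms n img t" using G(1) by (simp add: vanishing_forms_def)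
qed

abbreviation "X \<equiv> image_closure (2 * g) n s"

lemma X_iff: "y \<in> X \<longleftrightarrow> y \<in> hcoords n \<and> (\<forall>t G. G \<in> forms n t \<longrightarrow> subst r G = 0 \<longrightarrow> eval G y = 0)"
  unfolding image_closure_img zariski_closure_def vanishing_forms_img by blast

lemma vanishing_forms_X: "vanishing_forms n X t = {G \<in> forms n t. subst r G = 0}"
proof
  show "vanishing_forms n X t \<subseteq> {G \<in> forms n t. subst r G = 0}"
  proof -
    have "img \<subseteq> X"
      unfolding image_closure_img zariski_closure_def by (auto simp: img_def vanishing_forms_def)
    then have "vanishing_forms n X t \<subseteq> vanishing_forms n img t" by (auto simp: vanishing_forms_def)
    then show ?thesis by (simp add: vanishing_forms_img)
  qed
  show "{G \<in> forms n t. subst r G = 0} \<subseteq> vanishing_forms n X t"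
    using X_iff by (auto simp: vanishing_forms_def)
qed

text \<open>Rank-nullity for \<open>subst r\<close>, whose kernel is the space of vanishing forms
  and whose image is \<open>R t\<close>.\<close>

lemma hilbert_function_X: "hilbert_function n X t = cpoly.dim (R t)"
proof -
  obtain B where "finite B" "forms n t \<subseteq> cpoly.span B" using finite_dim_forms .
  from rank_nullity[OF subspace_forms this linear_subst, of r]
  show ?thesis by (simp add: hilbert_function_def vanishing_forms_X subst_r_forms)
qed

section \<open>The two morphisms between the quotient and the image\<close>

definition \<phi> :: "(cpoly \<Rightarrow> complex) \<Rightarrow> nat \<Rightarrow> complex" where
  "\<phi> l j = (if j < n then l (r j) else 0)"

text \<open>The preimage is chosen among forms of all degrees; for \<open>y\<close> in
  \<open>X\<close> and \<open>F\<close> in some \<open>R t\<close> the value does not depend on the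
  choice, by \<open>\<psi>_subst_r\<close>.\<close>

definition \<psi> :: "(nat \<Rightarrow> complex) \<Rightarrow> cpoly \<Rightarrow> complex" where
  "\<psi> y F = eval (SOME G. (\<exists>t. G \<in> forms n t) \<and> subst r G = F) y"

text \<open>A point respects sums and products of homogeneous elements only, so
  \<open>subst r G\<close> is expanded into monomials without leaving the graded pieces.\<close>

lemma point_subst_r:
  assumes l: "l \<in> points (GIT_quotient (2 * g + 2))" and G: "G \<in> forms n t"
  shows "l (subst r G) = eval G (\<phi> l)"
proof -
  have l1: "l 1 = 1"
    and ladd: "\<And>d a b. a \<in> R d \<Longrightarrow> b \<in> R d \<Longrightarrow> l (a + b) = l a + l b"
    and lscale: "\<And>d c a. a \<in> R d \<Longrightarrow> l (cscale c a) = c * l a"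
    and lmult: "\<And>d e a b. a \<in> R d \<Longrightarrow> b \<in> R e \<Longrightarrow> l (a * b) = l a * l b"
    using l by (auto simp: GIT_quotient_def graded_Proj_def)
  have l0: "l 0 = 0" using lscale[OF one_invariant, of 0] by simp
  have lpow: "l (r j ^ k) = l (r j) ^ k" for j k
    by (induction k) (simp_all add: l1 lmult[OF r_R r_power])
  have lprod: "l (\<Prod>i\<in>I. r i ^ d i) = (\<Prod>i\<in>I. l (r i) ^ d i)" for I d
  proof (induction I rule: infinite_finite_induct)
    case (insert i I)
    then show ?case
      using lmult[OF r_power[of i "d i"] prod_R[of I "\<lambda>i. r i ^ d i" d, OF r_power]] by (simp add: lpow)
  qed (simp_all add: l1)
  have lsum: "l (\<Sum>i\<in>I. F i) = (\<Sum>i\<in>I. l (F i))" if "\<And>i. i \<in> I \<Longrightarrow> F i \<in> R t" for I :: "monomial set" and F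
    using that
  proof (induction I rule: infinite_finite_induct)
    case (insert i I)
    then show ?case
      using ladd[of "F i" t "\<Sum>i\<in>I. F i"] cpoly.subspace_sum[OF subspace_invariant_sections, of I F]
      by simp
  qed (simp_all add: l0)
  have m: "mono_val r \<mu> \<in> R t" if "\<mu> \<in> keys G" for \<mu>
    using mono_val_r[of \<mu>] G that by (auto simp: forms_iff graded_def)
  have "l (subst r G) = (\<Sum>\<mu>\<in>keys G. l (cscale (lookup G \<mu>) (mono_val r \<mu>)))"
    unfolding subst_expand cscale_Cst[symmetric]
    by (rule lsum) (use m cpoly.subspace_scale[OF subspace_invariant_sections] in blast)
  also have "\<dots> = (\<Sum>\<mu>\<in>keys G. lookup G \<mu> * mono_val (\<phi> l) \<mu>)"
  proof (intro sum.cong refl)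
    fix \<mu> assume \<mu>: "\<mu> \<in> keys G"
    then have "keys \<mu> \<subseteq> {..<n}" using G by (auto simp: forms_iff polys_in_def)
    then have "mono_val (\<lambda>i. l (r i)) \<mu> = mono_val (\<phi> l) \<mu>"
      by (intro mono_val_cong) (auto simp: \<phi>_def)
    moreover have "l (mono_val r \<mu>) = mono_val (\<lambda>i. l (r i)) \<mu>" unfolding mono_val_def by (rule lprod)
    ultimately show "l (cscale (lookup G \<mu>) (mono_val r \<mu>)) = lookup G \<mu> * mono_val (\<phi> l) \<mu>"
      using lscale[OF m[OF \<mu>]] by simp
  qed
  also have "\<dots> = eval G (\<phi> l)" by (simp add: eval_expand)
  finally show ?thesis .
qed

lemma \<phi>_point:
  assumes l: "l \<in> points (GIT_quotient (2 * g + 2))"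
  shows "\<phi> l \<in> X"
  unfolding X_iff
proof (intro conjI allI impI)
  have l0: "l 0 = 0" using point_subst_r[OF l, of 0 0] by (simp add: cpoly.subspace_0[OF subspace_forms])
  fix t G assume "G \<in> forms n t" "subst r G = 0"
  then show "eval G (\<phi> l) = 0" using point_subst_r[OF l, of G t] l0 by simp
next
  show "\<phi> l \<in> hcoords n"
  proof (rule ccontr)
    assume "\<phi> l \<notin> hcoords n"
    then have 0: "\<phi> l = (\<lambda>i. 0 * 0)" by (auto simp: hcoords_def \<phi>_def)
    obtain d a where d: "d > 0" "a \<in> R d" "l a \<noteq> 0"
      using l by (auto simp: GIT_quotient_def graded_Proj_def)
    then obtain G where G: "G \<in> forms n d" "a = subst r G" using subst_r_forms by blast
    have "l a = 0 ^ d * eval G (\<lambda>_. 0)"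
      using point_subst_r[OF l G(1)] eval_forms_scale[OF G(1), of 0 "\<lambda>_. 0"] G(2) 0 by simp
    then show False using d by simp
  qed
qed

text \<open>Two lifts of the same degree differ by a form in the ideal of \<open>X\<close>. Lifts of
  different degrees force the lifted element to be 0, and then both lie in this ideal.\<close>

lemma \<psi>_subst_r:
  assumes y: "y \<in> X" and G: "G \<in> forms n t"
  shows "\<psi> y (subst r G) = eval G y"
proof -
  let ?H = "SOME H. (\<exists>t. H \<in> forms n t) \<and> subst r H = subst r G"
  have "(\<exists>t. ?H \<in> forms n t) \<and> subst r ?H = subst r G"
    by (rule someI[of _ G]) (use G in blast)
  then obtain t' where H: "?H \<in> forms n t'" "subst r ?H = subst r G" by blast
  have "eval ?H y = eval G y"
  proof (cases "t' = t")
    case True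
    then have "?H - G \<in> forms n t" using H G cpoly.subspace_diff[OF subspace_forms] by blast
    moreover have "subst r (?H - G) = 0" using H by simp
    ultimately have "eval (?H - G) y = 0" using y X_iff by blast
    then show ?thesis by simp
  next
    case False
    then have "subst r G = 0"
      using invariant_sections_disjoint[of "subst r G" "2 * g + 2" t' t] subst_r[OF H(1)] subst_r[OF G] H(2) by simp
    moreover from this have "subst r ?H = 0" using H(2) by simp
    ultimately have "eval G y = 0" "eval ?H y = 0" using y X_iff G H(1) by blast+
    then show ?thesis by simp
  qed
  then show ?thesis by (simp add: \<psi>_def)
qed

lemma \<psi>_point:
  assumes y: "y \<in> X"
  shows "\<psi> y \<in> points (GIT_quotient (2 * g + 2))"
proof -
  note E = \<psi>_subst_r[OF y]
  have ex: "\<exists>G. G \<in> forms n d \<and> a = subst r G" if "a \<in> R d" for a d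
    using that subst_r_forms by blast
  have "\<psi> y 1 = 1" using E[OF one_forms] by simp
  moreover have "\<psi> y (a + b) = \<psi> y a + \<psi> y b" if ab: "a \<in> R d" "b \<in> R d" for a b d
  proof -
    obtain G H where "G \<in> forms n d" "a = subst r G" "H \<in> forms n d" "b = subst r H"
      using ex ab by metis
    then show ?thesis using E[of "G + H" d] E[of G d] E[of H d] cpoly.subspace_add[OF subspace_forms, of G n d H] by simp
  qed
  moreover have "\<psi> y (cscale c a) = c * \<psi> y a" if ab: "a \<in> R d" for a c d
  proof -
    obtain G where "G \<in> forms n d" "a = subst r G" using ex ab by metis
    then show ?thesis using E[of "cscale c G" d] E[of G d] cpoly.subspace_scale[OF subspace_forms, of G n d c] by simp
  qed
  moreover have "\<psi> y (a * b) = \<psi> y a * \<psi> y b" if ab: "a \<in> R d" "b \<in> R e" for a b d e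
  proof -
    obtain G H where "G \<in> forms n d" "a = subst r G" "H \<in> forms n e" "b = subst r H"
      using ex ab by metis
    then show ?thesis using E[of "G * H" "d + e"] E[of G d] E[of H e] forms_mult[of G n d H e] by simp
  qed
  moreover have "\<exists>d>0. \<exists>a\<in>R d. \<psi> y a \<noteq> 0"
  proof -
    obtain j where j: "j < n" "y j \<noteq> 0" using y X_iff by (auto simp: hcoords_def)
    then have "\<psi> y (r j) \<noteq> 0" using E[OF Var_forms[OF j(1)]] by simp
    then show ?thesis using r_R by (intro exI[of _ 1]) auto
  qed
  ultimately show ?thesis by (simp add: GIT_quotient_def graded_Proj_def)
qed

theorem isomorphic_X: "isomorphic (GIT_quotient (2 * g + 2)) (closed_subvariety n X)"
proof -
  let ?M = "GIT_quotient (2 * g + 2)" and ?N = "closed_subvariety n X"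
  have hM: "hfuns ?M d = (\<lambda>a l. l a) ` R d" for d by (simp add: GIT_quotient_def graded_Proj_def)
  have hN: "hfuns ?N d = eval ` forms n d" for d by (simp add: closed_subvariety_def)
  have pN: "points ?N = X" by (simp add: closed_subvariety_def)
  have "morphism ?M ?N \<phi>"
  proof (rule morphism_of_pullback)
    show "\<phi> ` points ?M \<subseteq> points ?N" unfolding pN using \<phi>_point by blast
    fix d b assume "b \<in> hfuns ?N d"
    then obtain G where G: "G \<in> forms n d" "b = eval G" unfolding hN by blast
    then have "(\<lambda>l. l (subst r G)) \<in> hfuns ?M d" unfolding hM using subst_r by blast
    then show "\<exists>a\<in>hfuns ?M d. \<forall>x\<in>points ?M. b (\<phi> x) = a x"
      using point_subst_r G by (intro bexI[of _ "\<lambda>l. l (subst r G)"]) auto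
  qed
  moreover have "morphism ?N ?M \<psi>"
  proof (rule morphism_of_pullback)
    show "\<psi> ` points ?N \<subseteq> points ?M" unfolding pN using \<psi>_point by blast
    fix d b assume "b \<in> hfuns ?M d"
    then obtain F where F: "F \<in> R d" "b = (\<lambda>l. l F)" unfolding hM by blast
    then obtain G where G: "G \<in> forms n d" "F = subst r G" using subst_r_forms by blast
    then have "eval G \<in> hfuns ?N d" unfolding hN by blast
    then show "\<exists>a\<in>hfuns ?N d. \<forall>x\<in>points ?N. b (\<psi> x) = a x"
      unfolding pN using \<psi>_subst_r G F by (intro bexI[of _ "eval G"]) auto
  qed
  \<comment> \<open>The composite recovers \<open>l\<close> on invariants only, which is all that
    \<open>same_point\<close> compares.\<close>
  moreover have "same_point ?M (\<psi> (\<phi> l)) l" if l: "l \<in> points ?M" for l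
    unfolding same_point_def
  proof (intro exI[of _ 1] conjI allI ballI)
    fix d a assume "a \<in> hfuns ?M d"
    then obtain F where F: "F \<in> R d" "a = (\<lambda>l. l F)" unfolding hM by blast
    then obtain G where G: "G \<in> forms n d" "F = subst r G" using subst_r_forms by blast
    show "a l = 1 ^ d * a (\<psi> (\<phi> l))"
      using point_subst_r[OF l G(1)] \<psi>_subst_r[OF \<phi>_point[OF l] G(1)] F G by simp
  qed simp
  moreover have "same_point ?N (\<phi> (\<psi> y)) y" if y: "y \<in> points ?N" for y
  proof -
    have "\<phi> (\<psi> y) j = y j" for j
    proof (cases "j < n")
      case True
      then show ?thesis using \<psi>_subst_r[OF y[unfolded pN] Var_forms[OF True]] by (simp add: \<phi>_def)
    next
      case False
      then show ?thesis using y X_iff by (auto simp: pN \<phi>_def hcoords_def)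
    qed
    then have "\<phi> (\<psi> y) = y" by blast
    then show ?thesis unfolding same_point_def by (intro exI[of _ 1]) simp
  qed
  ultimately show ?thesis unfolding isomorphic_def by blast
qed

end

lemma dim_R_formula:
  assumes "g \<ge> 1" "t \<ge> 1"
  shows "of_nat (cpoly.dim (invariant_sections (2 * g + 2) t)) = poly (sigma_poly g) (of_nat t)"
proof -
  have "2 * (g * t) + t = (2 * g + 1) * t" by simp
  from dim_invariant_sections[OF this] show ?thesis
    using dim_tinv_formula[OF assms] poly_sigma_poly[OF assms(1), of t] by simp
qed

lemma (in linear_system_basis) is_hilbert_polynomial_X: "is_hilbert_polynomial n X (sigma_poly g)"
  unfolding is_hilbert_polynomial_def hilbert_function_X
  using dim_R_formula[OF g] by (intro eventually_sequentiallyI[of 1]) simp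

subsection \<open>General points\<close>

lemma comm_ring_hom_eval: "comm_ring_hom (\<lambda>f. eval f x)"
  by unfold_locales simp_all

definition point_det :: "nat \<Rightarrow> (nat \<Rightarrow> nat) \<Rightarrow> cpoly" where
  "point_det k a = det (mat k k (\<lambda>(j, i). Var (a i * k + j)))"

lemma eval_point_det:
  "eval (point_det k a) (\<lambda>v. p (v div k) (v mod k)) = det (mat k k (\<lambda>(j, i). p (a i) j))"
proof -
  interpret h: comm_ring_hom "\<lambda>f. eval f (\<lambda>v. p (v div k) (v mod k))" by (rule comm_ring_hom_eval)
  have "map_mat (\<lambda>f. eval f (\<lambda>v. p (v div k) (v mod k))) (mat k k (\<lambda>(j, i). Var (a i * k + j)))
     = mat k k (\<lambda>(j, i). p (a i) j)"
    by (rule eq_matI) simp_all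
  with h.hom_det[of "mat k k (\<lambda>(j, i). Var (a i * k + j))"] show ?thesis
    unfolding point_det_def by (simp only:)
qed

text \<open>Every term of the Leibniz expansion uses each column exactly once, so its degree in the
  point \<open>l\<close> is the number of columns that carry this point.\<close>

lemma point_det_multiforms:
  assumes "k > 0" "\<And>i. i < k \<Longrightarrow> a i < m"
  shows "point_det k a \<in> multiforms m k (\<lambda>l. card {i. i < k \<and> a i = l})"
proof -
  let ?A = "mat k k (\<lambda>(j, i). Var (a i * k + j)) :: cpoly mat"
  have D: "point_det k a = (\<Sum>\<pi>\<in>{\<pi>. \<pi> permutes {0..<k}}. signof \<pi> * (\<Prod>j = 0..<k. ?A $$ (j, \<pi> j)))"
    unfolding point_det_def by (rule det_def') simp
  have "signof \<pi> * (\<Prod>j = 0..<k. ?A $$ (j, \<pi> j)) \<in> multiforms m k (\<lambda>l. card {i. i < k \<and> a i = l})"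
    if \<pi>: "\<pi> permutes {0..<k}" for \<pi>
  proof -
    have lt: "\<pi> j < k" if "j < k" for j using permutes_in_image[OF \<pi>, of j] that by simp
    have P: "(\<Prod>j = 0..<k. ?A $$ (j, \<pi> j)) = (\<Prod>j\<in>{0..<k}. Var (a (\<pi> j) * k + j))"
      by (intro prod.cong refl) (simp add: lt)
    have "(\<Prod>j\<in>{0..<k}. Var (a (\<pi> j) * k + j)) \<in> graded (=) (\<lambda>v. if v div k = l then 1 else 0)
        (\<Sum>j\<in>{0..<k}. if a (\<pi> j) = l then 1 else 0)" for l
      by (intro graded_prod graded_Var) auto
    moreover have "(\<Sum>j\<in>{0..<k}. if a (\<pi> j) = l then 1 else 0) = card {i. i < k \<and> a i = l}" for l
    proof -
      have "(\<Sum>j\<in>{0..<k}. if a (\<pi> j) = l then 1 else 0) = (\<Sum>j\<in>{0..<k}. if a j = l then 1 else 0 :: nat)"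
        using sum.permute[OF \<pi>, of "\<lambda>j. if a j = l then 1 else 0", symmetric] by (simp only: comp_def)
      also have "\<dots> = card {i \<in> {0..<k}. a i = l}"
        by (simp only: card_eq_sum sum.inter_filter finite_atLeastLessThan)
      finally show ?thesis by simp
    qed
    moreover have "(\<Prod>j\<in>{0..<k}. Var (a (\<pi> j) * k + j)) \<in> polys_in (m * k)"
    proof -
      have "(\<Prod>j\<in>J. Var (a (\<pi> j) * k + j)) \<in> polys_in (m * k)" if "J \<subseteq> {0..<k}" for J
        using that
      proof (induction J rule: infinite_finite_induct)
        case (insert j J)
        then have j: "j < k" "a (\<pi> j) + 1 \<le> m" using assms(2)[OF lt] by (auto simp: Suc_le_eq)
        have "a (\<pi> j) * k + j < (a (\<pi> j) + 1) * k" using j by simp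
        also have "\<dots> \<le> m * k" using j by (intro mult_right_mono) auto
        finally show ?case using insert by (auto intro: polys_in_mult polys_in_Var)
      qed (simp_all add: polys_in_Cst[of 1, simplified])
      then show ?thesis by blast
    qed
    ultimately have M: "(\<Prod>j = 0..<k. ?A $$ (j, \<pi> j)) \<in> multiforms m k (\<lambda>l. card {i. i < k \<and> a i = l})"
      unfolding P multiforms_iff[OF assms(1)] by simp
    show ?thesis
    proof (cases "evenperm \<pi>")
      case True
      then show ?thesis using M by (simp add: sign_def)
    next
      case False
      then show ?thesis using cpoly.subspace_neg[OF subspace_multiforms[OF assms(1)] M] by (simp add: sign_def)
    qed
  qed
  then show ?thesis unfolding D
    by (intro cpoly.subspace_sum[OF subspace_multiforms[OF assms(1)]]) auto
qed

lemma prod_multiforms: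
  assumes "k > 0" "\<And>i. i \<in> I \<Longrightarrow> F i \<in> multiforms m k (D i)"
  shows "(\<Prod>i\<in>I. F i) \<in> multiforms m k (\<lambda>l. \<Sum>i\<in>I. D i l)"
proof -
  have "(\<Prod>i\<in>I. F i) \<in> polys_in (m * k)"
    using assms
    by (induction I rule: infinite_finite_induct)
       (auto simp: multiforms_iff polys_in_Cst[of 1, simplified] intro: polys_in_mult)
  moreover have "(\<Prod>i\<in>I. F i) \<in> graded (=) (\<lambda>v. if v div k = l then 1 else 0) (\<Sum>i\<in>I. D i l)" if "l < m" for l
    by (rule graded_prod) (use assms that in \<open>auto simp: multiforms_iff\<close>)
  ultimately show ?thesis by (simp add: multiforms_iff assms(1))
qed

text \<open>\<open>M\<close> inverts the matrix of the first \<open>2 * g\<close> points, and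
  \<open>c\<close> expresses the last point in their basis. By Cramer's rule \<open>c i\<close>
  times the determinant is the determinant with column \<open>i\<close> replaced by the last point,
  hence not 0. Dividing the rows of \<open>M\<close> by the \<open>c i\<close> gives the last point
  all coordinates 1.\<close>

lemma projective_frame_of_det:
  fixes p :: "nat \<Rightarrow> nat \<Rightarrow> complex"
  assumes g: "g \<ge> 1"
    and det0: "det (mat (2 * g) (2 * g) (\<lambda>(j, i). p i j)) \<noteq> 0"
    and deti: "\<And>l. l < 2 * g \<Longrightarrow> det (mat (2 * g) (2 * g) (\<lambda>(j, i). p (if i = l then 2 * g else i) j)) \<noteq> 0"
  shows "\<exists>B c. projective_frame g p B c"
proof -
  define k where "k = 2 * g"
  let ?A = "mat k k (\<lambda>(j, i). p i j)"
  let ?b = "vec k (\<lambda>j. p k j)"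
  have A: "?A \<in> carrier_mat k k" by simp
  have "?A \<in> Units (ring_mat TYPE(complex) k ())"
    by (rule det_non_zero_imp_unit[OF A]) (use det0 in \<open>simp add: k_def\<close>)
  then obtain M where M: "M \<in> carrier_mat k k" "M * ?A = 1\<^sub>m k" "?A * M = 1\<^sub>m k"
    unfolding Units_def ring_mat_def by auto
  define c where "c i = vec_index (M *\<^sub>v ?b) i" for i
  have bA: "?A *\<^sub>v (M *\<^sub>v ?b) = ?b"
    using M A by (simp add: assoc_mult_mat_vec[symmetric, of _ k k _ k])
  have ci: "c i = (\<Sum>j<k. M $$ (i, j) * p k j)" if "i < k" for i
    using M(1) that by (simp add: c_def scalar_prod_def lessThan_atLeast0)
  have c: "c i \<noteq> 0" if i: "i < k" for i
  proof -
    have col: "mat k k (\<lambda>(j, l). p (if l = i then k else l) j) = replace_col ?A (?A *\<^sub>v (M *\<^sub>v ?b)) i"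
      unfolding bA replace_col_def by (rule eq_matI) auto
    have "det (mat k k (\<lambda>(j, l). p (if l = i then k else l) j)) \<noteq> 0"
      using deti[of i] i unfolding k_def .
    then have "det (replace_col ?A (?A *\<^sub>v (M *\<^sub>v ?b)) i) \<noteq> 0"
      unfolding col .
    moreover have "det (replace_col ?A (?A *\<^sub>v (M *\<^sub>v ?b)) i) = vec_index (M *\<^sub>v ?b) i * det ?A"
      by (rule cramer_lemma_mat[OF A _ i]) (use M in simp)
    ultimately show ?thesis by (auto simp: c_def)
  qed
  define B where "B i j = M $$ (i, j) / c i" for i j
  have MA: "(\<Sum>j<k. M $$ (i, j) * p l j) = (if i = l then 1 else 0)" if "i < k" "l < k" for i l
  proof -
    have "(M * ?A) $$ (i, l) = (\<Sum>j<k. M $$ (i, j) * p l j)"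
      using M(1) that by (simp add: scalar_prod_def lessThan_atLeast0)
    then show ?thesis unfolding M(2) using that by simp
  qed
  have AM: "(\<Sum>i<k. p i j * M $$ (i, l)) = (if j = l then 1 else 0)" if "j < k" "l < k" for j l
  proof -
    have "(?A * M) $$ (j, l) = (\<Sum>i<k. p i j * M $$ (i, l))"
      using M(1) that by (simp add: scalar_prod_def lessThan_atLeast0)
    then show ?thesis unfolding M(3) using that by simp
  qed
  have "projective_frame g p B c"
  proof
    show "g \<ge> 1" by (rule g)
    show "c i \<noteq> 0" if "i < 2 * g" for i using c that by (simp add: k_def)
    show "(\<Sum>j<2 * g. B i j * p l j) = (if i = l then 1 / c l else 0)" if "i < 2 * g" "l < 2 * g" for i l
    proof -
      have "(\<Sum>j<k. B i j * p l j) = (\<Sum>j<k. M $$ (i, j) * p l j) / c i"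
        by (simp add: B_def sum_divide_distrib)
      then show ?thesis using MA[of i l] that by (simp add: k_def)
    qed
    show "(\<Sum>j<2 * g. B i j * p (2 * g) j) = 1" if "i < 2 * g" for i
    proof -
      have "(\<Sum>j<k. B i j * p k j) = (\<Sum>j<k. M $$ (i, j) * p k j) / c i"
        by (simp add: B_def sum_divide_distrib)
      then show ?thesis using ci[of i] c[of i] that by (simp add: k_def)
    qed
    show "(\<Sum>i<2 * g. (\<Sum>l<2 * g. B i l * x l) * c i * p i j) = x j" if "j < 2 * g" for x j
    proof -
      have "(\<Sum>i<k. (\<Sum>l<k. B i l * x l) * c i * p i j) = (\<Sum>i<k. \<Sum>l<k. x l * (p i j * M $$ (i, l)))"
        unfolding sum_distrib_right using c by (intro sum.cong refl) (simp add: B_def)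
      also have "\<dots> = (\<Sum>l<k. x l * (\<Sum>i<k. p i j * M $$ (i, l)))"
        by (subst sum.swap) (simp add: sum_distrib_left)
      also have "\<dots> = (\<Sum>l<k. if l = j then x l else 0)"
        using AM that by (intro sum.cong refl) (auto simp: k_def)
      finally show ?thesis using that by (simp add: k_def)
    qed
  qed
  then show ?thesis by blast
qed

text \<open>The multihomogeneous polynomial is the product of the \<open>2 * g + 1\<close> maximal
  minors of the points.\<close>

lemma for_general_points_frame:
  assumes g: "g \<ge> 1" and Q: "\<And>p B c. projective_frame g p B c \<Longrightarrow> Q p"
  shows "for_general_points (2 * g + 1) (2 * g) Q"
proof -
  define k where "k = 2 * g"
  have k: "k > 0" using g by (simp add: k_def)
  \<comment> \<open>The index \<open>l = k\<close> replaces nothing and gives the minor of the first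
    \<open>k\<close> points.\<close>
  let ?a = "\<lambda>l i. if i = l then k else i"
  define \<Phi> where "\<Phi> = (\<Prod>l\<in>{..k}. point_det k (?a l))"
  have ev: "eval \<Phi> (\<lambda>v. p (v div k) (v mod k)) = (\<Prod>l\<in>{..k}. det (mat k k (\<lambda>(j, i). p (?a l i) j)))" for p
    unfolding \<Phi>_def eval_prod eval_point_det ..
  have "\<Phi> \<in> multiforms (k + 1) k (\<lambda>v. \<Sum>l\<in>{..k}. card {i. i < k \<and> ?a l i = v})"
    unfolding \<Phi>_def by (intro prod_multiforms point_det_multiforms k) auto
  moreover have "\<Phi> \<noteq> 0"
  proof
    assume "\<Phi> = 0"
    \<comment> \<open>The unit vectors together with their sum; every minor is 1 there.\<close>
    let ?p = "\<lambda>i j. if i = k \<or> i = j then 1 else 0 :: complex"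
    let ?one = "vec k (\<lambda>_. 1) :: complex vec"
    have "det (mat k k (\<lambda>(j, i). ?p (?a l i) j)) = 1" if "l \<le> k" for l
    proof (cases "l = k")
      case True
      have "mat k k (\<lambda>(j, i). ?p (?a l i) j) = 1\<^sub>m k" by (rule eq_matI) (auto simp: True)
      then show ?thesis by simp
    next
      case False
      with that have l: "l < k" by simp
      have "mat k k (\<lambda>(j, i). ?p (?a l i) j) = replace_col (1\<^sub>m k) (1\<^sub>m k *\<^sub>v ?one) l"
        unfolding replace_col_def by (rule eq_matI) auto
      moreover have "det (replace_col (1\<^sub>m k) (1\<^sub>m k *\<^sub>v ?one) l) = vec_index ?one l * det (1\<^sub>m k)"
        by (rule cramer_lemma_mat[OF _ _ l]) simp_all
      ultimately show ?thesis using l by simp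
    qed
    then have "(\<Prod>l\<in>{..k}. det (mat k k (\<lambda>(j, i). ?p (?a l i) j))) = 1" by (intro prod.neutral) simp
    then have "eval \<Phi> (\<lambda>v. ?p (v div k) (v mod k)) = 1" using ev[of ?p] by (rule trans[rotated])
    then show False using \<open>\<Phi> = 0\<close> by simp
  qed
  moreover have "Q p" if "eval \<Phi> (\<lambda>v. p (v div k) (v mod k)) \<noteq> 0" for p
  proof -
    have D: "det (mat k k (\<lambda>(j, i). p (?a l i) j)) \<noteq> 0" if "l \<le> k" for l
      using \<open>eval \<Phi> _ \<noteq> 0\<close> that unfolding ev by (auto simp: prod_zero_iff)
    have "mat k k (\<lambda>(j, i). p (?a k i) j) = mat k k (\<lambda>(j, i). p i j)" by (rule eq_matI) auto
    then have "det (mat k k (\<lambda>(j, i). p i j)) \<noteq> 0" using D[of k] by simp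
    then have "\<exists>B c. projective_frame g p B c"
      using projective_frame_of_det[OF g, of p] D unfolding k_def by (meson less_imp_le)
    then obtain B c where "projective_frame g p B c" by blast
    then show ?thesis by (rule Q)
  qed
  ultimately show ?thesis unfolding for_general_points_def k_def by blast
qed

theorem corollary3p4:
  fixes g :: nat
  assumes "g \<ge> 1"
  shows "for_general_points (2 * g + 1) (2 * g) (\<lambda>p.
    (\<forall>n s. is_basis n s (lin_system g p) \<longrightarrow>
      isomorphic (GIT_quotient (2 * g + 2)) (closed_subvariety n (image_closure (2 * g) n s)) \<and>
      is_hilbert_polynomial n (image_closure (2 * g) n s)
        (binomial_poly [:of_nat (2 * g - 1), of_nat g:] (2 * g - 1) +
         (\<Sum>r<g - 1. (-1) ^ (r + 1) * of_nat ((2 * g + 1) choose (r + 1)) *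
            binomial_poly [:of_nat (2 * g - 1 - r - 1), of_nat (g - r - 1):] (2 * g - 1))) \<and>
      projective_degree n (image_closure (2 * g) n s) =
        of_nat g ^ (2 * g - 1) +
        (\<Sum>r<g - 1. (-1) ^ (r + 1) * of_nat ((2 * g + 1) choose (r + 1)) *
            of_nat (g - r - 1) ^ (2 * g - 1))) \<and>
    int (cpoly.dim (lin_system g p)) =
      int ((3 * g - 1) choose (2 * g - 1)) +
      (\<Sum>r<g - 1. (-1) ^ (r + 1) * int ((2 * g + 1) choose (r + 1)) *
          int ((3 * g - 2 * r - 3) choose (2 * g - 1))))"
proof (rule for_general_points_frame[OF assms], intro conjI allI impI)
  fix p B c n s
  assume frame: "projective_frame g p B c" and basis: "is_basis n s (lin_system g p)"
  interpret projective_frame g p B c by (rule frame)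
  interpret linear_system_basis g p B c n s by unfold_locales (rule basis)
  show "isomorphic (GIT_quotient (2 * g + 2)) (closed_subvariety n (image_closure (2 * g) n s))"
    by (rule isomorphic_X)
  show "is_hilbert_polynomial n (image_closure (2 * g) n s)
        (binomial_poly [:of_nat (2 * g - 1), of_nat g:] (2 * g - 1) +
         (\<Sum>r<g - 1. (-1) ^ (r + 1) * of_nat ((2 * g + 1) choose (r + 1)) *
            binomial_poly [:of_nat (2 * g - 1 - r - 1), of_nat (g - r - 1):] (2 * g - 1)))"
    using is_hilbert_polynomial_X unfolding sigma_poly_def .
  show "projective_degree n (image_closure (2 * g) n s) =
        of_nat g ^ (2 * g - 1) +
        (\<Sum>r<g - 1. (-1) ^ (r + 1) * of_nat ((2 * g + 1) choose (r + 1)) *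
            of_nat (g - r - 1) ^ (2 * g - 1))"
    unfolding projective_degree_def hilbert_polynomial_eqI[OF is_hilbert_polynomial_X]
    by (rule sigma_poly_lead[OF assms])
next
  fix p B c
  assume frame: "projective_frame g p B c"
  interpret projective_frame g p B c by (rule frame)
  obtain h where h: "g = Suc h" using assms by (cases g) auto
  \<comment> \<open>The dimension formula already holds at \<open>t = 1\<close>, so the polynomial
    may be evaluated there.\<close>
  have "(of_nat (cpoly.dim (lin_system g p)) :: rat) = poly (sigma_poly g) (of_nat 1)"
    unfolding dim_lin_system by (rule dim_R_formula[OF assms]) simp
  also have "\<dots> = (\<Sum>j<g. (-1) ^ j * of_nat ((2 * g + 1) choose j) *
       of_nat ((1 * (g - j) + (2 * g - 1 - j)) choose (2 * g - 1)))"
    by (rule poly_sigma_poly[OF assms])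
  also have "\<dots> = of_int (\<Sum>j<g. (-1) ^ j * int ((2 * g + 1) choose j) *
       int ((3 * g - 1 - 2 * j) choose (2 * g - 1)))"
    unfolding of_int_sum
  proof (intro sum.cong refl)
    fix j assume "j \<in> {..<g}"
    then have "1 * (g - j) + (2 * g - 1 - j) = 3 * g - 1 - 2 * j" by simp
    then show "(-1) ^ j * of_nat ((2 * g + 1) choose j) * of_nat ((1 * (g - j) + (2 * g - 1 - j)) choose (2 * g - 1)) =
      (of_int ((-1) ^ j * int ((2 * g + 1) choose j) * int ((3 * g - 1 - 2 * j) choose (2 * g - 1))) :: rat)"
      by (simp only: of_int_mult of_int_power of_int_minus of_int_1 of_int_of_nat_eq)
  qed
  finally have "(of_int (int (cpoly.dim (lin_system g p))) :: rat) = of_int (\<Sum>j<g. (-1) ^ j * int ((2 * g + 1) choose j) *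
       int ((3 * g - 1 - 2 * j) choose (2 * g - 1)))" by (simp only: of_int_of_nat_eq)
  then have "int (cpoly.dim (lin_system g p)) = (\<Sum>j<g. (-1) ^ j * int ((2 * g + 1) choose j) *
       int ((3 * g - 1 - 2 * j) choose (2 * g - 1)))"
    by (simp only: of_int_eq_iff)
  also have "\<dots> = int ((3 * g - 1) choose (2 * g - 1)) +
      (\<Sum>r<g - 1. (-1) ^ (r + 1) * int ((2 * g + 1) choose (r + 1)) *
          int ((3 * g - 2 * r - 3) choose (2 * g - 1)))"
    unfolding h sum.lessThan_Suc_shift by simp
  finally show "int (cpoly.dim (lin_system g p)) = int ((3 * g - 1) choose (2 * g - 1)) +
      (\<Sum>r<g - 1. (-1) ^ (r + 1) * int ((2 * g + 1) choose (r + 1)) *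
          int ((3 * g - 2 * r - 3) choose (2 * g - 1)))" .
qed

end
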